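(* Let $M$ be a time-like surface in the Robertson-Walker space-time $L^4_1(f,0)$. Then $M$ has positive relative nullity if and only if it is one of the following surfaces: (1) $M$ is an open part of $I\times_f\alpha\subset I\times_f\mathbb E^3$ for a curve $\alpha$ in $\mathbb E^3$; (2) $M$ is locally congruent to a time-like surface parametrized by $$\phi(u,v)=\left(u,\ \phi_1(v)\alpha_1(v)+\left(\int_{u_0}^u\frac{a}{f(\bar u)\sqrt{a^2+f(\bar u)^2}}\,d\bar u+\phi_2(v)\right)\alpha_2(v)+\phi_3(v)\alpha_3(v)\right),$$ where $a$ is a non-zero constant, $u_0\in I$, $I_v$ is an open interval, $a_1,a_2,\phi_1:I_v\to\mathbb R$ are smooth functions, $\phi_2,\phi_3:I_v\to\mathbb R$ are smooth functions satisfying $$\phi_2'=-a_1\phi_1,\qquad \phi_3'=-a_2\phi_1,$$ and $\alpha_1,\alpha_2,\alpha_3:I_v\to\mathbb R^3$ are smooth functions satisfying $$\alpha_1'=a_1\alpha_2+a_2\alpha_3,\quad \alpha_2'=-a_1\alpha_1,\quad \alpha_3'=-a_2\alpha_1,\qquad \alpha_i(v_0)=C_i\ (i=1,2,3),$$ for some $v_0\in I_v$ and constant orthonormal vectors $C_1,C_2,C_3$ in $\mathbb E^3$.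
   Context: Let $I$ be an open interval and $f:I\to\mathbb R$ a smooth nowhere vanishing function. The Robertson-Walker space-time $L^4_1(f,0)=I\times_f\mathbb E^3$ is $I\times\mathbb E^3$ with metric $\langle\cdot,\cdot\rangle=-dt^2+f(t)^2g_0$, where $g_0$ is the Euclidean metric of $\mathbb E^3$; $I\times_f\alpha$ denotes the surface $\{(t,\alpha(s))\}$ with the induced metric, where $\alpha$ is a regular curve. A surface $M$ in $L^4_1(f,0)$ is time-like if its induced metric is Lorentzian; $h$ is its second fundamental form. Write $\frac{\partial}{\partial t}|_M=T+\eta$ with $T$ tangent and $\eta$ normal to $M$. The relative null space at $p\in M$ is $\mathcal N_p=\{X\in T_pM: h_p(X,Y)=0\ \text{for all } Y\in T_pM\}$; $M$ has positive relative nullity if $\dim\mathcal N_p>0$ for all $p\in M$. "Locally congruent" means that every point of $M$ has a neighbourhood which is mapped by an isometry of the ambient space onto an open part of a surface of the given type; parametrizations are understood on domains where they are immersions. Standing assumptions: (i) $\frac{f''(t)}{f(t)}-\frac{f'(t)^2}{f(t)^2}\neq0$ for all $t\in I$; (ii) $T$ does not vanish on $M$; (iii) when $M$ has positive relative nullity, the spaces $\mathcal N_p$ form a smooth 1-dimensional distribution; (iv) $M$ is connected and no open part of $M$ lies in a 3-dimensional totally geodesic hypersurface of $L^4_1(f,0)$. *)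

theory Defs
  imports "HOL-Analysis.Analysis"
begin

definition open_interval :: "real set \<Rightarrow> bool" where
  "open_interval J \<longleftrightarrow> open J \<and> is_interval J \<and> J \<noteq> {}"

text \<open>Smoothness is only used on open sets, where \<^term>\<open>at p\<close> is the right filter.\<close>

primrec Ck_on :: "nat \<Rightarrow> 'a::real_normed_vector set \<Rightarrow> ('a \<Rightarrow> 'b::real_normed_vector) \<Rightarrow> bool" where
  "Ck_on 0 S F \<longleftrightarrow> continuous_on S F"
| "Ck_on (Suc k) S F \<longleftrightarrow> (\<forall>p\<in>S. F differentiable (at p)) \<and>
     (\<forall>v. Ck_on k S (\<lambda>p. frechet_derivative F (at p) v))"

definition smooth_on :: "'a::real_normed_vector set \<Rightarrow> ('a \<Rightarrow> 'b::real_normed_vector) \<Rightarrow> bool" where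
  "smooth_on S F \<longleftrightarrow> (\<forall>k. Ck_on k S F)"


section \<open>Metrics on open subsets of a vector space\<close>

text \<open>A metric assigns to each point a symmetric bilinear form; tangent vectors are
  vectors of the ambient vector space.\<close>

type_synonym 'e metric_tensor = "'e \<Rightarrow> 'e \<Rightarrow> 'e \<Rightarrow> real"

text \<open>The Levi-Civita connection is \<open>\<nabla>\<^sub>X Y = D\<^sub>X Y + \<Gamma>(X, Y)\<close>, where \<open>\<Gamma>\<close> is given by the
  Koszul formula for constant vector fields.\<close>

definition christoffel :: "'e::euclidean_space metric_tensor \<Rightarrow> 'e \<Rightarrow> 'e \<Rightarrow> 'e \<Rightarrow> 'e" where
  "christoffel g p X Y = (THE Z. \<forall>W. 2 * g p Z W =
      frechet_derivative (\<lambda>q. g q Y W) (at p) X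
    + frechet_derivative (\<lambda>q. g q X W) (at p) Y
    - frechet_derivative (\<lambda>q. g q X Y) (at p) W)"

definition isometry_on :: "'e::euclidean_space metric_tensor \<Rightarrow> 'e set \<Rightarrow> ('e \<Rightarrow> 'e) \<Rightarrow> bool" where
  "isometry_on g L \<Phi> \<longleftrightarrow> bij_betw \<Phi> L L \<and> smooth_on L \<Phi> \<and> smooth_on L (inv_into L \<Phi>) \<and>
     (\<forall>p\<in>L. \<forall>X Y. g (\<Phi> p) (frechet_derivative \<Phi> (at p) X) (frechet_derivative \<Phi> (at p) Y) = g p X Y)"

text \<open>Components relative to a subspace on which the metric is nondegenerate.\<close>

definition tangent_part :: "'e::euclidean_space metric_tensor \<Rightarrow> 'e \<Rightarrow> 'e set \<Rightarrow> 'e \<Rightarrow> 'e" where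
  "tangent_part g p P v = (THE w. w \<in> P \<and> (\<forall>z\<in>P. g p (v - w) z = 0))"

definition normal_part :: "'e::euclidean_space metric_tensor \<Rightarrow> 'e \<Rightarrow> 'e set \<Rightarrow> 'e \<Rightarrow> 'e" where
  "normal_part g p P v = v - tangent_part g p P v"

definition lorentzian_plane :: "'e::euclidean_space metric_tensor \<Rightarrow> 'e \<Rightarrow> 'e set \<Rightarrow> bool" where
  "lorentzian_plane g p P \<longleftrightarrow>
     (\<exists>e1 e2. P = span {e1, e2} \<and> g p e1 e1 = -1 \<and> g p e1 e2 = 0 \<and> g p e2 e2 = 1)"


section \<open>Local geometry of a parametrized submanifold\<close>

definition smooth_immersion_on :: "'a::euclidean_space set \<Rightarrow> ('a \<Rightarrow> 'e::euclidean_space) \<Rightarrow> bool" where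
  "smooth_immersion_on V y \<longleftrightarrow> smooth_on V y \<and> (\<forall>q\<in>V. inj (frechet_derivative y (at q)))"

definition tangent_space :: "('a::euclidean_space \<Rightarrow> 'e::euclidean_space) \<Rightarrow> 'a \<Rightarrow> 'e set" where
  "tangent_space y q = range (frechet_derivative y (at q))"

text \<open>Ambient covariant derivative, in direction \<open>dy(a)\<close>, of the tangent field \<open>dy(b)\<close> along
  \<open>y\<close>, where \<open>a\<close> and \<open>b\<close> are constant vectors in the parameter space.\<close>

definition cov_deriv :: "'e::euclidean_space metric_tensor \<Rightarrow> ('a::euclidean_space \<Rightarrow> 'e) \<Rightarrow> 'a \<Rightarrow> 'a \<Rightarrow> 'a \<Rightarrow> 'e" where
  "cov_deriv g y q a b =
     frechet_derivative (\<lambda>r. frechet_derivative y (at r) b) (at q) a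
     + christoffel g (y q) (frechet_derivative y (at q) a) (frechet_derivative y (at q) b)"

text \<open>\<open>second_ff g y q a b\<close> is \<open>h(X, Y)\<close> for the tangent vectors \<open>X = dy(a)\<close>, \<open>Y = dy(b)\<close>.\<close>

definition second_ff :: "'e::euclidean_space metric_tensor \<Rightarrow> ('a::euclidean_space \<Rightarrow> 'e) \<Rightarrow> 'a \<Rightarrow> 'a \<Rightarrow> 'a \<Rightarrow> 'e" where
  "second_ff g y q a b = normal_part g (y q) (tangent_space y q) (cov_deriv g y q a b)"

definition relative_null_space :: "'e::euclidean_space metric_tensor \<Rightarrow> ('a::euclidean_space \<Rightarrow> 'e) \<Rightarrow> 'a \<Rightarrow> 'e set" where
  "relative_null_space g y q = {frechet_derivative y (at q) a | a. \<forall>b. second_ff g y q a b = 0}"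


section \<open>Immersed submanifolds\<close>

text \<open>A submanifold is a topological space \<open>M\<close> with a map \<open>x\<close> into the ambient space. Its local
  parametrizations are the open topological embeddings \<open>\<psi>\<close> of open sets \<open>V\<close> of the parameter
  space for which \<open>x \<circ> \<psi>\<close> is a smooth immersion. For a manifold immersed by \<open>x\<close> these are exactly
  the inverses of its smooth charts, so the smooth structure need not be given separately.
  Geometric conditions are imposed in all local parametrizations.\<close>

definition local_param ::
  "'m topology \<Rightarrow> ('m \<Rightarrow> 'e::euclidean_space) \<Rightarrow> 'a::euclidean_space set \<Rightarrow> ('a \<Rightarrow> 'm) \<Rightarrow> bool" where
  "local_param M x V \<psi> \<longleftrightarrow> open V \<and> embedding_map (top_of_set V) M \<psi> \<and> openin M (\<psi> ` V) \<and>
     smooth_immersion_on V (x \<circ> \<psi>)"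

type_synonym spacetime = "real \<times> (real^3)"

definition immersed_surface :: "spacetime set \<Rightarrow> 'm topology \<Rightarrow> ('m \<Rightarrow> spacetime) \<Rightarrow> bool" where
  "immersed_surface L M x \<longleftrightarrow> Hausdorff_space M \<and> second_countable M \<and> x ` topspace M \<subseteq> L \<and>
     (\<forall>p \<in> topspace M. \<exists>(V :: (real \<times> real) set) \<psi>. local_param M x V \<psi> \<and> p \<in> \<psi> ` V)"

text \<open>The covariant derivative condition makes sense for hypersurfaces of any causal character and
  is the vanishing of the second fundamental form when the induced metric is nondegenerate.\<close>

definition totally_geodesic_hypersurface :: "spacetime metric_tensor \<Rightarrow> spacetime set \<Rightarrow> spacetime set \<Rightarrow> bool" where
  "totally_geodesic_hypersurface g L S \<longleftrightarrow> S \<subseteq> L \<and>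
     (\<forall>p\<in>S. \<exists>(W :: (real^3) set) z. local_param (top_of_set S) id W z \<and> p \<in> z ` W) \<and>
     (\<forall>(W :: (real^3) set) z. local_param (top_of_set S) id W z \<longrightarrow>
        (\<forall>w\<in>W. \<forall>a b. cov_deriv g z w a b \<in> tangent_space z w))"


section \<open>Surfaces in the Robertson-Walker space-time\<close>

definition rw_space :: "real set \<Rightarrow> spacetime set" where
  "rw_space I = I \<times> UNIV"

definition rw_metric :: "(real \<Rightarrow> real) \<Rightarrow> spacetime metric_tensor" where
  "rw_metric f p X Y = - (fst X * fst Y) + (f (fst p))\<^sup>2 * (snd X \<bullet> snd Y)"

definition d_dt :: spacetime where
  "d_dt = (1, 0)"

definition timelike_patch :: "(real \<Rightarrow> real) \<Rightarrow> (real \<times> real) set \<Rightarrow> (real \<times> real \<Rightarrow> spacetime) \<Rightarrow> bool" where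
  "timelike_patch f V y \<longleftrightarrow> smooth_immersion_on V y \<and>
     (\<forall>q\<in>V. lorentzian_plane (rw_metric f) (y q) (tangent_space y q))"

definition timelike_surface :: "real set \<Rightarrow> (real \<Rightarrow> real) \<Rightarrow> 'm topology \<Rightarrow> ('m \<Rightarrow> spacetime) \<Rightarrow> bool" where
  "timelike_surface I f M x \<longleftrightarrow> immersed_surface (rw_space I) M x \<and>
     (\<forall>V \<psi>. local_param M x V \<psi> \<longrightarrow> timelike_patch f V (x \<circ> \<psi>))"

definition T_nonvanishing :: "(real \<Rightarrow> real) \<Rightarrow> 'm topology \<Rightarrow> ('m \<Rightarrow> spacetime) \<Rightarrow> bool" where
  "T_nonvanishing f M x \<longleftrightarrow> (\<forall>(V :: (real \<times> real) set) \<psi>. local_param M x V \<psi> \<longrightarrow>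
     (\<forall>q\<in>V. tangent_part (rw_metric f) ((x \<circ> \<psi>) q) (tangent_space (x \<circ> \<psi>) q) d_dt \<noteq> 0))"

definition positive_relative_nullity :: "(real \<Rightarrow> real) \<Rightarrow> 'm topology \<Rightarrow> ('m \<Rightarrow> spacetime) \<Rightarrow> bool" where
  "positive_relative_nullity f M x \<longleftrightarrow> (\<forall>(V :: (real \<times> real) set) \<psi>. local_param M x V \<psi> \<longrightarrow>
     (\<forall>q\<in>V. dim (relative_null_space (rw_metric f) (x \<circ> \<psi>) q) > 0))"

definition null_spaces_smooth_line_distribution :: "(real \<Rightarrow> real) \<Rightarrow> 'm topology \<Rightarrow> ('m \<Rightarrow> spacetime) \<Rightarrow> bool" where
  "null_spaces_smooth_line_distribution f M x \<longleftrightarrow>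
     (\<forall>(V :: (real \<times> real) set) \<psi>. local_param M x V \<psi> \<longrightarrow>
       (\<forall>q\<in>V. \<exists>W \<xi>. open W \<and> q \<in> W \<and> W \<subseteq> V \<and> smooth_on W \<xi> \<and>
          (\<forall>r\<in>W. \<xi> r \<noteq> 0 \<and>
             relative_null_space (rw_metric f) (x \<circ> \<psi>) r
               = span {frechet_derivative (x \<circ> \<psi>) (at r) (\<xi> r)})))"

text \<open>\<open>p\<close> has a neighbourhood in \<open>M\<close> on which \<open>x\<close> is, up to the choice of local parametrization, the
  restriction of \<open>y\<close> to an open part \<open>D\<close> of its domain \<open>E\<close>.\<close>

definition open_part_near ::
  "'m topology \<Rightarrow> ('m \<Rightarrow> spacetime) \<Rightarrow> 'm \<Rightarrow> (real \<times> real) set \<Rightarrow> (real \<times> real \<Rightarrow> spacetime) \<Rightarrow> bool" where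
  "open_part_near M x p E y \<longleftrightarrow>
     (\<exists>D \<sigma>. D \<subseteq> E \<and> local_param M x D \<sigma> \<and> p \<in> \<sigma> ` D \<and> (\<forall>q\<in>D. x (\<sigma> q) = y q))"

text \<open>The curve is the same for all points of \<open>M\<close>. It need not be injective, and the
  parametrization of \<open>M\<close> by \<open>(t, s)\<close> need not be global: \<open>M\<close> may be a cylinder over a closed curve.\<close>

definition open_part_of_warped_cylinder :: "real set \<Rightarrow> 'm topology \<Rightarrow> ('m \<Rightarrow> spacetime) \<Rightarrow> bool" where
  "open_part_of_warped_cylinder I M x \<longleftrightarrow>
     (\<exists>J (\<alpha> :: real \<Rightarrow> real^3). open_interval J \<and> smooth_on J \<alpha> \<and>
        (\<forall>s\<in>J. vector_derivative \<alpha> (at s) \<noteq> 0) \<and>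
        (\<forall>p \<in> topspace M. open_part_near M x p (I \<times> J) (\<lambda>(t, s). (t, \<alpha> s))))"

definition model_data ::
  "real set \<Rightarrow> real set \<Rightarrow> real \<Rightarrow> real \<Rightarrow> real \<Rightarrow> (real \<Rightarrow> real) \<Rightarrow> (real \<Rightarrow> real) \<Rightarrow>
   (real \<Rightarrow> real) \<Rightarrow> (real \<Rightarrow> real) \<Rightarrow> (real \<Rightarrow> real) \<Rightarrow>
   (real \<Rightarrow> real^3) \<Rightarrow> (real \<Rightarrow> real^3) \<Rightarrow> (real \<Rightarrow> real^3) \<Rightarrow> bool" where
  "model_data I J a u0 v0 a1 a2 \<phi>1 \<phi>2 \<phi>3 \<alpha>1 \<alpha>2 \<alpha>3 \<longleftrightarrow>
     a \<noteq> 0 \<and> u0 \<in> I \<and> open_interval J \<and>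
     smooth_on J a1 \<and> smooth_on J a2 \<and> smooth_on J \<phi>1 \<and> smooth_on J \<phi>2 \<and> smooth_on J \<phi>3 \<and>
     (\<forall>v\<in>J. (\<phi>2 has_real_derivative - a1 v * \<phi>1 v) (at v)) \<and>
     (\<forall>v\<in>J. (\<phi>3 has_real_derivative - a2 v * \<phi>1 v) (at v)) \<and>
     smooth_on J \<alpha>1 \<and> smooth_on J \<alpha>2 \<and> smooth_on J \<alpha>3 \<and>
     (\<forall>v\<in>J. (\<alpha>1 has_vector_derivative a1 v *\<^sub>R \<alpha>2 v + a2 v *\<^sub>R \<alpha>3 v) (at v)) \<and>
     (\<forall>v\<in>J. (\<alpha>2 has_vector_derivative - a1 v *\<^sub>R \<alpha>1 v) (at v)) \<and>
     (\<forall>v\<in>J. (\<alpha>3 has_vector_derivative - a2 v *\<^sub>R \<alpha>1 v) (at v)) \<and>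
     v0 \<in> J \<and>
     (\<exists>C1 C2 C3. \<alpha>1 v0 = C1 \<and> \<alpha>2 v0 = C2 \<and> \<alpha>3 v0 = C3 \<and>
        norm C1 = 1 \<and> norm C2 = 1 \<and> norm C3 = 1 \<and> C1 \<bullet> C2 = 0 \<and> C1 \<bullet> C3 = 0 \<and> C2 \<bullet> C3 = 0)"

definition model_surface ::
  "(real \<Rightarrow> real) \<Rightarrow> real \<Rightarrow> real \<Rightarrow> (real \<Rightarrow> real) \<Rightarrow> (real \<Rightarrow> real) \<Rightarrow> (real \<Rightarrow> real) \<Rightarrow>
   (real \<Rightarrow> real^3) \<Rightarrow> (real \<Rightarrow> real^3) \<Rightarrow> (real \<Rightarrow> real^3) \<Rightarrow> real \<times> real \<Rightarrow> spacetime" where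
  "model_surface f a u0 \<phi>1 \<phi>2 \<phi>3 \<alpha>1 \<alpha>2 \<alpha>3 = (\<lambda>(u, v).
     (u, \<phi>1 v *\<^sub>R \<alpha>1 v
         + ((LBINT w=ereal u0..ereal u. a / (f w * sqrt (a\<^sup>2 + (f w)\<^sup>2))) + \<phi>2 v) *\<^sub>R \<alpha>2 v
         + \<phi>3 v *\<^sub>R \<alpha>3 v))"

text \<open>The data of the model surface may depend on the point of \<open>M\<close>. \<open>E\<close> is an open part of its
  domain on which it is a time-like immersion.\<close>

definition locally_congruent_to_model :: "real set \<Rightarrow> (real \<Rightarrow> real) \<Rightarrow> 'm topology \<Rightarrow> ('m \<Rightarrow> spacetime) \<Rightarrow> bool" where
  "locally_congruent_to_model I f M x \<longleftrightarrow>
     (\<forall>p \<in> topspace M. \<exists>\<Phi> J a u0 v0 a1 a2 \<phi>1 \<phi>2 \<phi>3 \<alpha>1 \<alpha>2 \<alpha>3 E.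
        isometry_on (rw_metric f) (rw_space I) \<Phi> \<and>
        model_data I J a u0 v0 a1 a2 \<phi>1 \<phi>2 \<phi>3 \<alpha>1 \<alpha>2 \<alpha>3 \<and>
        open E \<and> E \<subseteq> I \<times> J \<and>
        timelike_patch f E (model_surface f a u0 \<phi>1 \<phi>2 \<phi>3 \<alpha>1 \<alpha>2 \<alpha>3) \<and>
        open_part_near M (\<Phi> \<circ> x) p E (model_surface f a u0 \<phi>1 \<phi>2 \<phi>3 \<alpha>1 \<alpha>2 \<alpha>3))"

end

theory Submission
  imports Defs
begin

text \<open>Write a local parametrization as \<open>y = (t, p)\<close>. The normal planes are spanned by \<open>(0, n)\<close> and
  \<open>(1, w)\<close>, where \<open>n\<close> is the unit normal of the map \<open>p\<close> into \<open>\<real>\<^sup>3\<close> and \<open>w\<close> is tangent to \<open>p\<close> and dual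
  to \<open>dt / f\<^sup>2\<close>. If \<open>\<xi>\<close> spans the relative null spaces, then \<open>D\<^sub>\<xi> n = 0\<close> and
  \<open>D\<^sub>\<xi> w = - (f' / f) dp(\<xi>)\<close>. So \<open>p\<close> is a developable surface, and the integrability condition for
  \<open>dw\<close> yields \<open>(f' / f)' \<noteq> 0\<close> times the obstruction to \<open>\<xi> \<parallel> T\<close>, wherever \<open>dn \<noteq> 0\<close>. Where \<open>dn = 0\<close> on
  an open set, \<open>p\<close> takes values in a plane, which contradicts the assumption on totally geodesic
  hypersurfaces. Hence \<open>T\<close> is in the relative null space everywhere.

  Then \<open>f\<^sup>2 \<langle>\<eta>, \<eta>\<rangle>\<close> is a constant \<open>a\<^sup>2\<close> on the connected surface. If it is zero, \<open>\<partial>\<^sub>t\<close> is tangent and the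
  surface is locally a cylinder; the countably many pieces of base curve are joined to one regular
  curve. If it is not zero, the unit vector \<open>\<alpha>\<^sub>2\<close> in the direction of \<open>w\<close> and the point
  \<open>p - (\<integral> a / (f \<surd>(a\<^sup>2 + f\<^sup>2))) \<alpha>\<^sub>2\<close> are constant along \<open>T\<close>, which gives the model surface.\<close>

section \<open>Smooth maps\<close>

text \<open>The field f d/dt is conformal: its covariant derivative in a direction Z is f' Z. Hence
  the derivative of <f eta, f eta> along Z is -2 <h(Z, f T), f eta>, which vanishes as soon as T is
  a null direction; this is where the constant a^2 comes from. The integrand of the model surface
  has a similar origin: (u, x(u)) in the direction of a fixed unit vector is an unparametrized
  geodesic exactly when x'' = f f' x'^3 - 2 (f'/f) x', and x' = a / (f sqrt (a^2 + f^2)) solves this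
  equation. The converse direction uses the equation to see that d/du is a null direction of the
  model.

  Two obstacles shape the proof. The smooth structure of M is present only through topological
  embeddings, so changes of parametrization have to be shown smooth before a property can be moved
  between parametrizations. And adapted coordinates come from t together with a first integral of T
  that is already at hand: a component of p in the cylinder case, a component of the direction of w
  or of the base point of the ruling otherwise.\<close>

abbreviation dd :: "('a::real_normed_vector \<Rightarrow> 'b::real_normed_vector) \<Rightarrow> 'a \<Rightarrow> 'a \<Rightarrow> 'b" where
  "dd F p \<equiv> frechet_derivative F (at p)"

lemma dd_eqI: "(F has_derivative F') (at p) \<Longrightarrow> dd F p v = F' v"
  using frechet_derivative_at by metis

lemma dd_works: "F differentiable (at p) \<Longrightarrow> (F has_derivative dd F p) (at p)"
  using frechet_derivative_works by blast

section \<open>Locality of derivatives and of the C^k conditions\<close>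

lemma dd_cong:
  assumes "open S" "p \<in> S" "\<And>q. q \<in> S \<Longrightarrow> F q = G q"
  shows "dd F p = dd G p"
proof (cases "F differentiable (at p)")
  case True
  then show ?thesis using frechet_derivative_transform_within_open assms by blast
next
  case False
  have *: "(F has_derivative D) (at p) \<longleftrightarrow> (G has_derivative D) (at p)" for D
    using has_derivative_transform_within_open[of F D p UNIV S G]
      has_derivative_transform_within_open[of G D p UNIV S F] assms by auto
  then show ?thesis unfolding frechet_derivative_def by simp
qed

lemma differentiable_cong_open:
  assumes "open S" "p \<in> S" "\<And>q. q \<in> S \<Longrightarrow> F q = G q" "F differentiable (at p)"
  shows "G differentiable (at p)"
  using assms unfolding differentiable_def by (metis has_derivative_transform_within_open)

lemma Ck_on_cong:
  assumes "open S" "Ck_on k S F" "\<And>q. q \<in> S \<Longrightarrow> F q = G q"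
  shows "Ck_on k S G"
  using assms(2,3)
proof (induction k arbitrary: F G)
  case 0
  then show ?case using continuous_on_eq by fastforce
next
  case (Suc k)
  have "Ck_on k S (\<lambda>p. dd G p v)" for v
  proof (rule Suc.IH)
    show "Ck_on k S (\<lambda>p. dd F p v)" using Suc.prems by simp
    show "dd F q v = dd G q v" if "q \<in> S" for q
      using dd_cong[OF assms(1) that, of F G] Suc.prems(2) by simp
  qed
  moreover have "\<forall>p\<in>S. G differentiable (at p)"
    using differentiable_cong_open[OF assms(1), of _ F G] Suc.prems by simp
  ultimately show ?case by simp
qed

lemma Ck_on_subset: "Ck_on k S F \<Longrightarrow> T \<subseteq> S \<Longrightarrow> Ck_on k T F"
  by (induction k arbitrary: F) (auto intro: continuous_on_subset)

lemma Ck_on_Suc_imp: "Ck_on (Suc k) S F \<Longrightarrow> Ck_on k S F"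
proof (induction k arbitrary: F)
  case 0
  then show ?case
    by (auto intro!: continuous_at_imp_continuous_on differentiable_imp_continuous_within)
qed simp

text \<open>All derivatives in \<open>Ck_on\<close> use the filter \<open>at p\<close> and so see
  only a neighbourhood of the point. This lets glued curves be checked piece by piece.\<close>

lemma Ck_on_local:
  assumes "\<And>p. p \<in> S \<Longrightarrow> \<exists>U. open U \<and> p \<in> U \<and> Ck_on k U F"
  shows "Ck_on k S F"
  using assms
proof (induction k arbitrary: F)
  case 0
  then show ?case
    by (auto intro!: continuous_at_imp_continuous_on simp: continuous_on_eq_continuous_at)
       (metis continuous_on_eq_continuous_at)
next
  case (Suc k)
  have "Ck_on k S (\<lambda>p. dd F p v)" for v
  proof (rule Suc.IH)
    fix p assume "p \<in> S"
    then show "\<exists>U. open U \<and> p \<in> U \<and> Ck_on k U (\<lambda>p. dd F p v)"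
      using Suc.prems[of p] by auto
  qed
  moreover have "\<forall>p\<in>S. F differentiable (at p)" using Suc.prems by fastforce
  ultimately show ?case by simp
qed

lemma smooth_on_cong: "open S \<Longrightarrow> smooth_on S F \<Longrightarrow> (\<And>q. q \<in> S \<Longrightarrow> F q = G q) \<Longrightarrow> smooth_on S G"
  unfolding smooth_on_def using Ck_on_cong by blast

lemma smooth_on_subset: "smooth_on S F \<Longrightarrow> T \<subseteq> S \<Longrightarrow> smooth_on T F"
  unfolding smooth_on_def using Ck_on_subset by blast

lemma smooth_on_local:
  assumes "\<And>p. p \<in> S \<Longrightarrow> \<exists>U. open U \<and> p \<in> U \<and> smooth_on U F"
  shows "smooth_on S F"
  unfolding smooth_on_def using assms Ck_on_local unfolding smooth_on_def by metis

text \<open>Removes the order k from later arguments. The right-hand side yields only the orders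
  \<open>Suc k\<close> directly; \<open>Ck_on_Suc_imp\<close> then reaches every order, including
  0.\<close>

lemma smooth_on_iff:
  "smooth_on S F \<longleftrightarrow> (\<forall>p\<in>S. F differentiable (at p)) \<and> (\<forall>v. smooth_on S (\<lambda>p. dd F p v))"
  (is "?L \<longleftrightarrow> ?R")
proof
  assume L: ?L
  have "Ck_on (Suc k) S F" for k using L unfolding smooth_on_def by blast
  then show ?R unfolding smooth_on_def by simp
next
  assume R: ?R
  have "Ck_on (Suc k) S F" for k using R unfolding smooth_on_def by simp
  then show ?L unfolding smooth_on_def using Ck_on_Suc_imp by blast
qed

lemma smooth_on_dd: "smooth_on S F \<Longrightarrow> smooth_on S (\<lambda>p. dd F p v)"
  using smooth_on_iff by blast

lemma smooth_on_has_derivative: "smooth_on S F \<Longrightarrow> p \<in> S \<Longrightarrow> (F has_derivative dd F p) (at p)"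
  using smooth_on_iff frechet_derivative_works by blast

lemma smooth_on_differentiable: "smooth_on S F \<Longrightarrow> p \<in> S \<Longrightarrow> F differentiable (at p)"
  using smooth_on_iff by blast

lemma smooth_on_linear_dd: "smooth_on S F \<Longrightarrow> p \<in> S \<Longrightarrow> linear (dd F p)"
  by (simp add: smooth_on_differentiable linear_frechet_derivative)

lemma smooth_on_continuous_on: "smooth_on S F \<Longrightarrow> continuous_on S F"
  unfolding smooth_on_def by (metis Ck_on.simps(1))

section \<open>Algebraic operations and composition at a fixed order\<close>

lemma Ck_on_const: "Ck_on k S (\<lambda>p. c)"
  by (induction k arbitrary: c) auto

lemma Ck_on_linear:
  assumes "open S" "bounded_linear L" "Ck_on k S F"
  shows "Ck_on k S (\<lambda>p. L (F p))"
  using assms(3)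
proof (induction k arbitrary: F)
  case 0
  then show ?case
    using bounded_linear.continuous_on[OF assms(2)] by (simp)
next
  case (Suc k)
  have D: "((\<lambda>p. L (F p)) has_derivative (\<lambda>v. L (dd F p v))) (at p)" if "p \<in> S" for p
    using Suc.prems that by (intro bounded_linear.has_derivative[OF assms(2)] dd_works) auto
  have "Ck_on k S (\<lambda>p. dd (\<lambda>p. L (F p)) p v)" for v
  proof (rule Ck_on_cong[OF assms(1)])
    show "Ck_on k S (\<lambda>p. L (dd F p v))" using Suc by simp
  qed (use dd_eqI[OF D] in auto)
  then show ?case using differentiableI[OF D] by auto
qed

lemma Ck_on_add:
  assumes "open S" "Ck_on k S F" "Ck_on k S G"
  shows "Ck_on k S (\<lambda>p. F p + G p)"
  using assms(2,3)
proof (induction k arbitrary: F G)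
  case 0
  then show ?case by (simp add: continuous_on_add)
next
  case (Suc k)
  have D: "((\<lambda>p. F p + G p) has_derivative (\<lambda>v. dd F p v + dd G p v)) (at p)" if "p \<in> S" for p
    using Suc.prems that by (intro has_derivative_add dd_works) auto
  have "Ck_on k S (\<lambda>p. dd (\<lambda>p. F p + G p) p v)" for v
  proof (rule Ck_on_cong[OF assms(1)])
    show "Ck_on k S (\<lambda>p. dd F p v + dd G p v)" using Suc by simp
  qed (use dd_eqI[OF D] in auto)
  then show ?case using differentiableI[OF D] by auto
qed

text \<open>In the Leibniz rule each term keeps one factor undifferentiated. That factor has order
  \<open>Suc k\<close> and is lowered to k so that the induction hypothesis applies to the
  pair.\<close>

lemma Ck_on_bilinear:
  assumes "open S" "bounded_bilinear B" "Ck_on k S F" "Ck_on k S G"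
  shows "Ck_on k S (\<lambda>p. B (F p) (G p))"
  using assms(3,4)
proof (induction k arbitrary: F G)
  case 0
  then show ?case using bounded_bilinear.continuous_on[OF assms(2)] by simp
next
  case (Suc k)
  have D: "((\<lambda>p. B (F p) (G p)) has_derivative (\<lambda>v. B (F p) (dd G p v) + B (dd F p v) (G p))) (at p)"
    if "p \<in> S" for p
    using Suc.prems that by (intro bounded_bilinear.FDERIV[OF assms(2)] dd_works) auto
  have "Ck_on k S (\<lambda>p. dd (\<lambda>p. B (F p) (G p)) p v)" for v
  proof (rule Ck_on_cong[OF assms(1)])
    show "Ck_on k S (\<lambda>p. B (F p) (dd G p v) + B (dd F p v) (G p))"
      using Suc.prems Ck_on_Suc_imp[OF Suc.prems(1)] Ck_on_Suc_imp[OF Suc.prems(2)]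
      by (intro Ck_on_add[OF assms(1)] Suc.IH) auto
  qed (use dd_eqI[OF D] in auto)
  then show ?case using differentiableI[OF D] by auto
qed

lemma Ck_on_sum:
  assumes "open S" "finite A" "\<And>i. i \<in> A \<Longrightarrow> Ck_on k S (F i)"
  shows "Ck_on k S (\<lambda>p. \<Sum>i\<in>A. F i p)"
  using assms(2,3) by (induction A) (auto intro!: Ck_on_const Ck_on_add[OF assms(1)])

text \<open>\<open>Ck_on\<close> controls derivatives only in fixed directions, but the chain rule
  produces dG in the direction dF(v), which varies with the point. Expanding that direction in the
  basis of the Euclidean middle space reduces it to finitely many fixed directions with varying
  coefficients.\<close>

lemma Ck_on_compose:
  fixes F :: "'a::real_normed_vector \<Rightarrow> 'b::euclidean_space"
  assumes "open S" "open T" "Ck_on k T G" "Ck_on k S F" "F ` S \<subseteq> T"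
  shows "Ck_on k S (\<lambda>p. G (F p))"
  using assms(3,4)
proof (induction k arbitrary: G)
  case 0
  then show ?case using assms(5) by (auto intro: continuous_on_compose2)
next
  case (Suc k)
  have D: "((\<lambda>p. G (F p)) has_derivative (\<lambda>v. dd G (F p) (dd F p v))) (at p)" if "p \<in> S" for p
    using Suc.prems that assms(5) by (intro has_derivative_compose[of F "dd F p" p UNIV G] dd_works) auto
  have "Ck_on k S (\<lambda>p. dd (\<lambda>p. G (F p)) p v)" for v
  proof (rule Ck_on_cong[OF assms(1)])
    show "Ck_on k S (\<lambda>p. \<Sum>i\<in>Basis. (dd F p v \<bullet> i) *\<^sub>R dd G (F p) i)"
    proof (intro Ck_on_sum[OF assms(1)] Ck_on_bilinear[OF assms(1) bounded_bilinear_scaleR])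
      fix i :: 'b
      show "Ck_on k S (\<lambda>p. dd F p v \<bullet> i)"
        using Suc.prems by (intro Ck_on_linear[OF assms(1) bounded_linear_inner_left]) simp
      show "Ck_on k S (\<lambda>p. dd G (F p) i)"
        using Suc.prems Ck_on_Suc_imp by (intro Suc.IH) auto
    qed simp
    fix q assume q: "q \<in> S"
    have lin: "linear (dd G (F q))" using Suc.prems q assms(5) linear_frechet_derivative by auto
    have "dd G (F q) (dd F q v) = dd G (F q) (\<Sum>i\<in>Basis. (dd F q v \<bullet> i) *\<^sub>R i)"
      by (simp add: euclidean_representation)
    also have "\<dots> = (\<Sum>i\<in>Basis. (dd F q v \<bullet> i) *\<^sub>R dd G (F q) i)"
      by (simp add: linear_sum[OF lin] linear_scale[OF lin])
    finally show "(\<Sum>i\<in>Basis. (dd F q v \<bullet> i) *\<^sub>R dd G (F q) i) = dd (\<lambda>p. G (F p)) q v"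
      using dd_eqI[OF D[OF q]] by simp
  qed
  then show ?case using differentiableI[OF D] by auto
qed

section \<open>Calculus of smooth maps\<close>

lemma smooth_on_const: "smooth_on S (\<lambda>p. c)"
  unfolding smooth_on_def using Ck_on_const by blast

lemma smooth_on_linear: "open S \<Longrightarrow> bounded_linear L \<Longrightarrow> smooth_on S F \<Longrightarrow> smooth_on S (\<lambda>p. L (F p))"
  unfolding smooth_on_def using Ck_on_linear by blast

lemma smooth_on_add: "open S \<Longrightarrow> smooth_on S F \<Longrightarrow> smooth_on S G \<Longrightarrow> smooth_on S (\<lambda>p. F p + G p)"
  unfolding smooth_on_def using Ck_on_add by blast

lemma smooth_on_bilinear:
  "open S \<Longrightarrow> bounded_bilinear B \<Longrightarrow> smooth_on S F \<Longrightarrow> smooth_on S G \<Longrightarrow> smooth_on S (\<lambda>p. B (F p) (G p))"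
  unfolding smooth_on_def using Ck_on_bilinear by blast

lemma smooth_on_compose:
  fixes F :: "'a::real_normed_vector \<Rightarrow> 'b::euclidean_space"
  shows "open S \<Longrightarrow> open T \<Longrightarrow> smooth_on T G \<Longrightarrow> smooth_on S F \<Longrightarrow> F ` S \<subseteq> T \<Longrightarrow> smooth_on S (\<lambda>p. G (F p))"
  unfolding smooth_on_def using Ck_on_compose by blast

lemma smooth_on_bounded_linear: "bounded_linear L \<Longrightarrow> smooth_on S L"
proof -
  assume L: "bounded_linear L"
  have "dd L p v = L v" for p v using dd_eqI bounded_linear_imp_has_derivative[OF L] by blast
  then have "smooth_on S (\<lambda>p. dd L p v)" for v by (simp add: smooth_on_const)
  then show "smooth_on S L"
    unfolding smooth_on_iff[of S L] using bounded_linear_imp_differentiable[OF L] by simp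
qed

lemma smooth_on_ident: "smooth_on S (\<lambda>p. p)"
  by (rule smooth_on_bounded_linear) (rule bounded_linear_ident)

lemma smooth_on_minus: "open S \<Longrightarrow> smooth_on S F \<Longrightarrow> smooth_on S (\<lambda>p. - F p)"
  by (rule smooth_on_linear) (auto intro: bounded_linear_minus bounded_linear_ident)

lemma smooth_on_diff: "open S \<Longrightarrow> smooth_on S F \<Longrightarrow> smooth_on S G \<Longrightarrow> smooth_on S (\<lambda>p. F p - G p)"
  using smooth_on_add[of S F "\<lambda>p. - G p"] smooth_on_minus by auto

lemma smooth_on_scaleR: "open S \<Longrightarrow> smooth_on S F \<Longrightarrow> smooth_on S G \<Longrightarrow> smooth_on S (\<lambda>p. F p *\<^sub>R G p)"
  by (rule smooth_on_bilinear[OF _ bounded_bilinear_scaleR])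

lemma smooth_on_mult:
  fixes F G :: "_ \<Rightarrow> real"
  shows "open S \<Longrightarrow> smooth_on S F \<Longrightarrow> smooth_on S G \<Longrightarrow> smooth_on S (\<lambda>p. F p * G p)"
  by (rule smooth_on_bilinear[OF _ bounded_bilinear_mult])

lemma smooth_on_inner: "open S \<Longrightarrow> smooth_on S F \<Longrightarrow> smooth_on S G \<Longrightarrow> smooth_on S (\<lambda>p. F p \<bullet> G p)"
  by (rule smooth_on_bilinear[OF _ bounded_bilinear_inner])

lemma bounded_bilinear_cross3: "bounded_bilinear cross3"
  using bilinear_conv_bounded_bilinear bilinear_cross by blast

lemma smooth_on_cross3: "open S \<Longrightarrow> smooth_on S F \<Longrightarrow> smooth_on S G \<Longrightarrow> smooth_on S (\<lambda>p. cross3 (F p) (G p))"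
  by (rule smooth_on_bilinear[OF _ bounded_bilinear_cross3])

lemma smooth_on_fst: "open S \<Longrightarrow> smooth_on S F \<Longrightarrow> smooth_on S (\<lambda>p. fst (F p))"
  by (rule smooth_on_linear[OF _ bounded_linear_fst])

lemma smooth_on_snd: "open S \<Longrightarrow> smooth_on S F \<Longrightarrow> smooth_on S (\<lambda>p. snd (F p))"
  by (rule smooth_on_linear[OF _ bounded_linear_snd])

lemma smooth_on_Pair:
  assumes "open S" "smooth_on S F" "smooth_on S G"
  shows "smooth_on S (\<lambda>p. (F p, G p))"
proof -
  have "smooth_on S (\<lambda>p. (F p, 0) + (0, G p))"
    using assms by (intro smooth_on_add smooth_on_linear[of S "\<lambda>x. (x, 0)"] smooth_on_linear[of S "\<lambda>x. (0, x)"]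
        bounded_linear_Pair bounded_linear_ident bounded_linear_zero) auto
  then show ?thesis by simp
qed

lemma smooth_on_power:
  fixes F :: "_ \<Rightarrow> real"
  shows "open S \<Longrightarrow> smooth_on S F \<Longrightarrow> smooth_on S (\<lambda>p. F p ^ n)"
  by (induction n) (auto intro: smooth_on_const smooth_on_mult)

text \<open>A bootstrap: the derivative is a polynomial in the function itself, so order k of the
  function gives order \<open>Suc k\<close>. The square root below is treated alike, its derivative
  being half its own reciprocal.\<close>

lemma smooth_on_inverse_real: "smooth_on {x::real. x \<noteq> 0} inverse"
  unfolding smooth_on_def
proof
  fix k
  have op: "open {x::real. x \<noteq> 0}" by (simp add: open_Collect_neq continuous_on_const continuous_on_id)
  show "Ck_on k {x::real. x \<noteq> 0} inverse"
  proof (induction k)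
    case 0
    then show ?case by (auto intro!: continuous_intros)
  next
    case (Suc k)
    have D: "(inverse has_derivative (\<lambda>v. - (inverse x * v * inverse x))) (at x)" if "x \<noteq> 0" for x :: real
      by (rule has_derivative_inverse'[OF that])
    have "Ck_on k {x::real. x \<noteq> 0} (\<lambda>p. dd inverse p v)" for v
    proof (rule Ck_on_cong[OF op])
      show "Ck_on k {x::real. x \<noteq> 0} (\<lambda>p. (-v) * (inverse p * inverse p))"
        by (intro Ck_on_bilinear[OF op bounded_bilinear_mult] Ck_on_const Suc)
    qed (use dd_eqI[OF D] in auto)
    then show ?case using differentiableI[OF D] by auto
  qed
qed

lemma smooth_on_inverse:
  fixes F :: "'a::real_normed_vector \<Rightarrow> real"
  assumes "open S" "smooth_on S F" "\<And>p. p \<in> S \<Longrightarrow> F p \<noteq> 0"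
  shows "smooth_on S (\<lambda>p. inverse (F p))"
  by (rule smooth_on_compose[OF assms(1) _ smooth_on_inverse_real assms(2)])
     (use assms in \<open>auto simp: open_Collect_neq\<close>)

lemma smooth_on_divide:
  fixes F G :: "'a::real_normed_vector \<Rightarrow> real"
  assumes "open S" "smooth_on S F" "smooth_on S G" "\<And>p. p \<in> S \<Longrightarrow> G p \<noteq> 0"
  shows "smooth_on S (\<lambda>p. F p / G p)"
  using smooth_on_mult[OF assms(1,2) smooth_on_inverse[OF assms(1,3,4)]] by (simp add: divide_inverse)

lemma smooth_on_sqrt_real: "smooth_on {x::real. x > 0} sqrt"
  unfolding smooth_on_def
proof
  fix k
  have op: "open {x::real. x > 0}" by (simp add: open_Collect_less)
  show "Ck_on k {x::real. x > 0} sqrt"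
  proof (induction k)
    case 0
    then show ?case by (auto intro!: continuous_intros)
  next
    case (Suc k)
    have D: "(sqrt has_derivative (\<lambda>v. v * (inverse (sqrt x) / 2))) (at x)" if "x > 0" for x :: real
      using DERIV_real_sqrt[OF that] unfolding has_field_derivative_def
      by (rule has_derivative_eq_rhs) (simp add: fun_eq_iff)
    have "Ck_on k {x::real. x > 0} (\<lambda>p. dd sqrt p v)" for v
    proof (rule Ck_on_cong[OF op])
      have "Ck_on k {x::real. x \<noteq> 0} inverse" using smooth_on_inverse_real smooth_on_def by blast
      then show "Ck_on k {x::real. x > 0} (\<lambda>p. (v/2) * inverse (sqrt p))"
        by (intro Ck_on_bilinear[OF op bounded_bilinear_mult] Ck_on_const
            Ck_on_compose[OF op _ _ Suc, of "{x. x \<noteq> 0}"]) (auto simp: open_Collect_neq)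
    qed (use dd_eqI[OF D] in auto)
    then show ?case using differentiableI[OF D] by auto
  qed
qed

lemma smooth_on_sqrt:
  fixes F :: "'a::real_normed_vector \<Rightarrow> real"
  assumes "open S" "smooth_on S F" "\<And>p. p \<in> S \<Longrightarrow> F p > 0"
  shows "smooth_on S (\<lambda>p. sqrt (F p))"
  by (rule smooth_on_compose[OF assms(1) _ smooth_on_sqrt_real assms(2)])
     (use assms in \<open>auto simp: open_Collect_less\<close>)

lemma smooth_on_norm:
  fixes F :: "'a::real_normed_vector \<Rightarrow> 'b::real_inner"
  assumes "open S" "smooth_on S F" "\<And>p. p \<in> S \<Longrightarrow> F p \<noteq> 0"
  shows "smooth_on S (\<lambda>p. norm (F p))"
  unfolding norm_eq_sqrt_inner
  by (rule smooth_on_sqrt) (use assms in \<open>auto intro: smooth_on_inner\<close>)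

lemma smooth_on_has_vector_derivative:
  fixes F :: "real \<Rightarrow> 'b::real_normed_vector"
  assumes "smooth_on S F" "s \<in> S"
  shows "(F has_vector_derivative dd F s 1) (at s)"
  using assms smooth_on_differentiable
  by (metis frechet_derivative_eq_vector_derivative scaleR_one vector_derivative_works)

lemma dd_real_eq:
  fixes F :: "real \<Rightarrow> 'b::real_normed_vector"
  assumes "(F has_vector_derivative D) (at s)"
  shows "dd F s v = v *\<^sub>R D"
  using dd_eqI assms unfolding has_vector_derivative_def by metis

lemma smooth_on_vector_derivativeI:
  fixes F :: "real \<Rightarrow> 'b::real_normed_vector"
  assumes "open S" "\<And>s. s \<in> S \<Longrightarrow> (F has_vector_derivative F' s) (at s)" "smooth_on S F'"
  shows "smooth_on S F"
proof -
  have "smooth_on S (\<lambda>s. dd F s v)" for v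
    by (rule smooth_on_cong[OF assms(1), of "\<lambda>s. v *\<^sub>R F' s"])
       (use assms dd_real_eq[OF assms(2), symmetric] in \<open>auto intro!: smooth_on_scaleR smooth_on_const\<close>)
  then show ?thesis using smooth_on_iff assms(2)
    by (metis differentiableI_vector)
qed

lemma dd_compose:
  assumes "F differentiable (at p)" "G differentiable (at (F p))"
  shows "dd (\<lambda>q. G (F q)) p v = dd G (F p) (dd F p v)"
  by (rule dd_eqI) (intro has_derivative_compose[of F "dd F p" p UNIV G] dd_works assms)

lemma dd_bounded_linear:
  assumes "bounded_linear L" "F differentiable (at p)"
  shows "dd (\<lambda>q. L (F q)) p v = L (dd F p v)"
  by (rule dd_eqI) (intro bounded_linear.has_derivative[OF assms(1)] dd_works assms(2))

lemma dd_fst: "F differentiable (at p) \<Longrightarrow> dd (\<lambda>q. fst (F q)) p v = fst (dd F p v)"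
  by (rule dd_bounded_linear[OF bounded_linear_fst])

lemma dd_snd: "F differentiable (at p) \<Longrightarrow> dd (\<lambda>q. snd (F q)) p v = snd (dd F p v)"
  by (rule dd_bounded_linear[OF bounded_linear_snd])

lemma dd_add:
  "F differentiable (at p) \<Longrightarrow> G differentiable (at p) \<Longrightarrow> dd (\<lambda>q. F q + G q) p v = dd F p v + dd G p v"
  by (rule dd_eqI) (intro has_derivative_add dd_works)

lemma dd_bilinear:
  assumes "bounded_bilinear B" "F differentiable (at p)" "G differentiable (at p)"
  shows "dd (\<lambda>q. B (F q) (G q)) p v = B (F p) (dd G p v) + B (dd F p v) (G p)"
  by (rule dd_eqI) (intro bounded_bilinear.FDERIV[OF assms(1)] dd_works assms(2,3))

lemmas dd_inner = dd_bilinear[OF bounded_bilinear_inner]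
lemmas dd_mult = dd_bilinear[OF bounded_bilinear_mult]
lemmas dd_scaleR = dd_bilinear[OF bounded_bilinear_scaleR]

section \<open>Symmetry of second derivatives\<close>

lemma second_difference_mvt:
  fixes F :: "'a::real_normed_vector \<Rightarrow> real"
  assumes h: "h > 0" and D1: "\<And>s t. 0 \<le> s \<Longrightarrow> s \<le> h \<Longrightarrow> 0 \<le> t \<Longrightarrow> t \<le> h \<Longrightarrow> F differentiable (at (p + s *\<^sub>R a + t *\<^sub>R b))"
    and D2: "\<And>s t. 0 \<le> s \<Longrightarrow> s \<le> h \<Longrightarrow> 0 \<le> t \<Longrightarrow> t \<le> h \<Longrightarrow>
      (\<lambda>q. dd F q a) differentiable (at (p + s *\<^sub>R a + t *\<^sub>R b))"
  obtains s t where "0 < s" "s < h" "0 < t" "t < h"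
    "F (p + h *\<^sub>R a + h *\<^sub>R b) - F (p + h *\<^sub>R a) - F (p + h *\<^sub>R b) + F p
      = h * h * dd (\<lambda>q. dd F q a) (p + s *\<^sub>R a + t *\<^sub>R b) b"
proof -
  have G: "((\<lambda>s. F (p + s *\<^sub>R a + t *\<^sub>R b)) has_real_derivative dd F (p + s *\<^sub>R a + t *\<^sub>R b) a) (at s)"
    if "0 \<le> s" "s \<le> h" "0 \<le> t" "t \<le> h" for s t
  proof -
    have "((\<lambda>s. p + s *\<^sub>R a + t *\<^sub>R b) has_derivative (\<lambda>v. v *\<^sub>R a)) (at s)"
      by (auto intro!: derivative_eq_intros)
    from has_derivative_compose[OF this, of F "dd F (p + s *\<^sub>R a + t *\<^sub>R b)"]
    have "((\<lambda>s. F (p + s *\<^sub>R a + t *\<^sub>R b)) has_derivative (\<lambda>v. dd F (p + s *\<^sub>R a + t *\<^sub>R b) (v *\<^sub>R a))) (at s)"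
      using D1[OF that] frechet_derivative_works by auto
    moreover have "linear (dd F (p + s *\<^sub>R a + t *\<^sub>R b))" using D1[OF that] linear_frechet_derivative by blast
    ultimately show ?thesis unfolding has_field_derivative_def
      by (elim has_derivative_eq_rhs) (simp add: fun_eq_iff linear_scale)
  qed
  \<comment> \<open>The second difference of \<open>F\<close> is \<open>g h - g 0\<close>. One mean
    value theorem in direction a introduces the derivative along a, a second one in direction b
    differentiates it once more.\<close>
  define g where "g = (\<lambda>s. F (p + s *\<^sub>R a + h *\<^sub>R b) - F (p + s *\<^sub>R a + 0 *\<^sub>R b))"
  have g': "(g has_real_derivative (dd F (p + s *\<^sub>R a + h *\<^sub>R b) a - dd F (p + s *\<^sub>R a + 0 *\<^sub>R b) a)) (at s)"
    if "0 \<le> s" "s \<le> h" for s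
    unfolding g_def using that h by (intro DERIV_diff G) auto
  obtain s where s: "0 < s" "s < h" "g h - g 0 = (h - 0) * (dd F (p + s *\<^sub>R a + h *\<^sub>R b) a - dd F (p + s *\<^sub>R a + 0 *\<^sub>R b) a)"
    using MVT2[OF h g'] by auto
  define k where "k = (\<lambda>t. dd F (p + s *\<^sub>R a + t *\<^sub>R b) a)"
  have k': "(k has_real_derivative dd (\<lambda>q. dd F q a) (p + s *\<^sub>R a + t *\<^sub>R b) b) (at t)"
    if t: "0 \<le> t" "t \<le> h" for t
  proof -
    let ?Q = "p + s *\<^sub>R a + t *\<^sub>R b"
    have diff: "(\<lambda>q. dd F q a) differentiable (at ?Q)" using D2 s t by simp
    have "((\<lambda>t. p + s *\<^sub>R a + t *\<^sub>R b) has_derivative (\<lambda>v. v *\<^sub>R b)) (at t)"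
      by (auto intro!: derivative_eq_intros)
    from has_derivative_compose[OF this, of "\<lambda>q. dd F q a" "dd (\<lambda>q. dd F q a) ?Q"]
    have "(k has_derivative (\<lambda>v. dd (\<lambda>q. dd F q a) ?Q (v *\<^sub>R b))) (at t)"
      unfolding k_def using diff frechet_derivative_works by auto
    moreover have "linear (dd (\<lambda>q. dd F q a) ?Q)" using diff linear_frechet_derivative by blast
    ultimately show ?thesis unfolding has_field_derivative_def
      by (elim has_derivative_eq_rhs) (simp add: fun_eq_iff linear_scale)
  qed
  obtain t where t: "0 < t" "t < h" "k h - k 0 = (h - 0) * dd (\<lambda>q. dd F q a) (p + s *\<^sub>R a + t *\<^sub>R b) b"
    using MVT2[OF h k'] by auto
  show ?thesis
    by (rule that[OF s(1,2) t(1,2)]) (use s(3) t(3) in \<open>simp add: g_def k_def\<close>)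
qed

text \<open>Schwarz's argument: the second difference along h a and h b is symmetric in a and b, and
  it equals h^2 times either mixed derivative, each at some point of the same small parallelogram.
  If the mixed derivatives differed at p, continuity would keep them apart on that
  parallelogram.\<close>

lemma second_derivative_symmetric_real:
  fixes F :: "'a::real_normed_vector \<Rightarrow> real"
  assumes "open S" "smooth_on S F" "p \<in> S"
  shows "dd (\<lambda>q. dd F q b) p a = dd (\<lambda>q. dd F q a) p b"
proof (rule ccontr)
  assume ne: "\<not> ?thesis"
  define A where "A = (\<lambda>q. dd (\<lambda>q. dd F q b) q a)"
  define B where "B = (\<lambda>q. dd (\<lambda>q. dd F q a) q b)"
  have cA: "continuous_on S A" and cB: "continuous_on S B"
    unfolding A_def B_def using assms smooth_on_dd smooth_on_continuous_on by blast+
  define e where "e = \<bar>A p - B p\<bar> / 2"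
  have e: "e > 0" using ne unfolding e_def A_def B_def by simp
  have "\<forall>\<^sub>F q in nhds p. q \<in> S \<and> \<bar>A q - A p\<bar> < e \<and> \<bar>B q - B p\<bar> < e"
  proof (intro eventually_conj)
    show "\<forall>\<^sub>F q in nhds p. q \<in> S" using assms(1,3) eventually_nhds by blast
    have "isCont A p" "isCont B p" using cA cB assms(1,3) continuous_on_eq_continuous_at by blast+
    then have "(A \<longlongrightarrow> A p) (nhds p)" "(B \<longlongrightarrow> B p) (nhds p)" by (simp_all add: isCont_def tendsto_at_iff_tendsto_nhds)
    then show "\<forall>\<^sub>F q in nhds p. \<bar>A q - A p\<bar> < e" "\<forall>\<^sub>F q in nhds p. \<bar>B q - B p\<bar> < e"
      using e tendstoD by (fastforce simp: dist_real_def)+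
  qed
  then obtain r where r: "r > 0" "\<And>q. dist q p < r \<Longrightarrow> q \<in> S \<and> \<bar>A q - A p\<bar> < e \<and> \<bar>B q - B p\<bar> < e"
    unfolding eventually_nhds_metric by blast
  \<comment> \<open>Small enough for the whole parallelogram to stay within distance r of p; the
    summand 1 guards against a = b = 0.\<close>
  define h where "h = r / (2 * (norm a + norm b + 1))"
  have nn: "norm a + norm b + 1 > 0" by (smt (verit) norm_ge_zero)
  have h: "h > 0" unfolding h_def using r nn by simp
  have near: "dist (p + s *\<^sub>R a + t *\<^sub>R b) p < r" if "0 \<le> s" "s \<le> h" "0 \<le> t" "t \<le> h" for s t
  proof -
    have "dist (p + s *\<^sub>R a + t *\<^sub>R b) p \<le> norm (s *\<^sub>R a) + norm (t *\<^sub>R b)"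
      unfolding dist_norm using norm_triangle_ineq[of "s *\<^sub>R a" "t *\<^sub>R b"] by (simp add: algebra_simps)
    also have "\<dots> \<le> h * norm a + h * norm b" using that by (auto intro!: add_mono mult_right_mono)
    also have "\<dots> < h * (2 * (norm a + norm b + 1))" using h nn
      by (simp add: algebra_simps) (smt (verit) norm_ge_zero mult_nonneg_nonneg)
    also have "\<dots> = r" unfolding h_def using nn by simp
    finally show ?thesis .
  qed
  have S: "p + s *\<^sub>R a + t *\<^sub>R b \<in> S" if "0 \<le> s" "s \<le> h" "0 \<le> t" "t \<le> h" for s t
    using near r that by blast
  have dF: "F differentiable (at q)" "(\<lambda>q. dd F q v) differentiable (at q)" if "q \<in> S" for q v
    using assms that smooth_on_dd smooth_on_differentiable by blast+
  obtain s t where st: "0 < s" "s < h" "0 < t" "t < h"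
    "F (p + h *\<^sub>R a + h *\<^sub>R b) - F (p + h *\<^sub>R a) - F (p + h *\<^sub>R b) + F p = h * h * B (p + s *\<^sub>R a + t *\<^sub>R b)"
    unfolding B_def by (rule second_difference_mvt[OF h dF(1)[OF S] dF(2)[OF S]])
  have S': "p + s *\<^sub>R b + t *\<^sub>R a \<in> S" if "0 \<le> s" "s \<le> h" "0 \<le> t" "t \<le> h" for s t
    using S[of t s] that by (simp add: algebra_simps)
  obtain s' t' where st': "0 < s'" "s' < h" "0 < t'" "t' < h"
    "F (p + h *\<^sub>R b + h *\<^sub>R a) - F (p + h *\<^sub>R b) - F (p + h *\<^sub>R a) + F p = h * h * A (p + s' *\<^sub>R b + t' *\<^sub>R a)"
    unfolding A_def by (rule second_difference_mvt[OF h dF(1)[OF S'] dF(2)[OF S']])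
  have "h * h * B (p + s *\<^sub>R a + t *\<^sub>R b) = h * h * A (p + t' *\<^sub>R a + s' *\<^sub>R b)"
    using st(5) st'(5) by (simp add: algebra_simps)
  then have "B (p + s *\<^sub>R a + t *\<^sub>R b) = A (p + t' *\<^sub>R a + s' *\<^sub>R b)" using h by simp
  moreover have "\<bar>B (p + s *\<^sub>R a + t *\<^sub>R b) - B p\<bar> < e" "\<bar>A (p + t' *\<^sub>R a + s' *\<^sub>R b) - A p\<bar> < e"
    using r(2) near st st' by (meson less_imp_le)+
  ultimately show False unfolding e_def by (smt (verit) field_sum_of_halves)
qed

lemma second_derivative_symmetric:
  fixes F :: "'a::real_normed_vector \<Rightarrow> 'b::euclidean_space"
  assumes "open S" "smooth_on S F" "p \<in> S"
  shows "dd (\<lambda>q. dd F q b) p a = dd (\<lambda>q. dd F q a) p b"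
proof (rule euclidean_eqI)
  fix i :: 'b assume "i \<in> Basis"
  have *: "dd (\<lambda>q. dd F q v) p u \<bullet> i = dd (\<lambda>q. dd (\<lambda>q. F q \<bullet> i) q v) p u" for u v
  proof -
    have "dd (\<lambda>q. dd (\<lambda>q. F q \<bullet> i) q v) p u = dd (\<lambda>q. dd F q v \<bullet> i) p u"
      using dd_cong[OF assms(1,3), of "\<lambda>q. dd (\<lambda>q. F q \<bullet> i) q v" "\<lambda>q. dd F q v \<bullet> i"]
        dd_bounded_linear[OF bounded_linear_inner_left] assms smooth_on_differentiable by metis
    also have "\<dots> = dd (\<lambda>q. dd F q v) p u \<bullet> i"
      by (rule dd_bounded_linear[OF bounded_linear_inner_left])
         (use assms smooth_on_dd smooth_on_differentiable in blast)
    finally show ?thesis by simp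
  qed
  have "smooth_on S (\<lambda>q. F q \<bullet> i)" using smooth_on_linear[OF assms(1) bounded_linear_inner_left assms(2)] .
  then show "dd (\<lambda>q. dd F q b) p a \<bullet> i = dd (\<lambda>q. dd F q a) p b \<bullet> i"
    using second_derivative_symmetric_real[OF assms(1) _ assms(3)] * by metis
qed

section \<open>The smooth inverse function theorem in the plane\<close>

lemma linear_R2: "linear L \<Longrightarrow> L v = fst v *\<^sub>R L (1, 0) + snd v *\<^sub>R L (0, 1)" for L :: "real \<times> real \<Rightarrow> _"
  by (metis (no_types, lifting) add.commute add.right_neutral add_Pair add_cancel_right_left linear_add linear_scale mult.right_neutral mult_zero_right prod.collapse real_scaleR_def scaleR_Pair)

text \<open>The inverse function theorem makes the local inverse G differentiable. Cramer's rule
  writes its derivative as a smooth function \<open>H\<close> of the value of G, so G of order k has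
  a derivative of order k and is of order k + 1.\<close>

theorem smooth_inverse_function:
  fixes F :: "real \<times> real \<Rightarrow> real \<times> real"
  assumes "open S" "smooth_on S F" "p \<in> S" "inj (dd F p)"
  obtains U V G where "open U" "p \<in> U" "U \<subseteq> S" "open V" "homeomorphism U V F G" "smooth_on V G"
    "\<And>q. q \<in> U \<Longrightarrow> inj (dd F q)"
proof -
  define f' where "f' q = Blinfun (dd F q)" for q
  have bl: "bounded_linear (dd F q)" if "q \<in> S" for q
    using smooth_on_linear_dd[OF assms(2) that] linear_conv_bounded_linear by blast
  have f': "blinfun_apply (f' q) = dd F q" if "q \<in> S" for q
    unfolding f'_def using bl[OF that] bounded_linear_Blinfun_apply by blast
  have cont: "continuous_on S f'"
  proof (rule continuous_on_blinfun_componentwise)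
    fix i :: "real \<times> real"
    have "continuous_on S (\<lambda>q. dd F q i)" using assms(2) smooth_on_dd smooth_on_continuous_on by blast
    then show "continuous_on S (\<lambda>x. blinfun_apply (f' x) i)"
      by (rule continuous_on_eq) (simp add: f')
  qed
  obtain gi where gi: "linear gi" "gi \<circ> dd F p = id"
    using linear_injective_left_inverse[OF smooth_on_linear_dd[OF assms(2,3)] assms(4)] by blast
  have inv: "Blinfun gi o\<^sub>L f' p = id_blinfun"
  proof (rule blinfun_eqI)
    fix v
    have "blinfun_apply (Blinfun gi) = gi"
      using gi(1) bounded_linear_Blinfun_apply linear_conv_bounded_linear by blast
    then show "blinfun_apply (Blinfun gi o\<^sub>L f' p) v = blinfun_apply id_blinfun v"
      using gi(2) f'[OF assms(3)] by (metis blinfun_apply_blinfun_compose blinfun_apply_id_blinfun comp_apply id_apply)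
  qed
  obtain U V G G' where I: "open U" "U \<subseteq> S" "p \<in> U" "open V" "F p \<in> V" "homeomorphism U V F G"
    "\<And>y. y \<in> V \<Longrightarrow> (G has_derivative (G' y)) (at y)"
    "\<And>y. y \<in> V \<Longrightarrow> G' y = Hilbert_Choice.inv (blinfun_apply (f'(G y)))"
    "\<And>y. y \<in> V \<Longrightarrow> bij (blinfun_apply (f'(G y)))"
    using inverse_function_theorem[OF assms(1) _ cont assms(3) inv, of F]
      smooth_on_has_derivative[OF assms(2)] f' by metis
  have GV: "G y \<in> U" if "y \<in> V" for y using I(6) that unfolding homeomorphism_def by blast
  have bijU: "bij (dd F q)" if "q \<in> U" for q
    using I(9)[of "F q"] f'[of q] that I(2,6) unfolding homeomorphism_def by fastforce
  define A where "A q = fst (dd F q (1,0))" for q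
  define C where "C q = snd (dd F q (1,0))" for q
  define B where "B q = fst (dd F q (0,1))" for q
  define D where "D q = snd (dd F q (0,1))" for q
  define det where "det q = A q * D q - B q * C q" for q
  have ddF: "dd F q v = (fst v * A q + snd v * B q, fst v * C q + snd v * D q)" if "q \<in> S" for q v
    using linear_R2[OF smooth_on_linear_dd[OF assms(2) that], of v]
    by (simp add: A_def B_def C_def D_def prod_eq_iff)
  have det: "det q \<noteq> 0" if "q \<in> U" for q
  proof
    assume d0: "det q = 0"
    have inj: "inj (dd F q)" using bijU that bij_is_inj by blast
    have q: "q \<in> S" using that I(2) by blast
    have z: "v = 0" if "dd F q v = 0" for v
    proof -
      have "dd F q 0 = 0" using ddF[OF q, of 0] by (simp add: zero_prod_def)
      then show ?thesis using inj that by (metis injD)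
    qed
    \<comment> \<open>A singular matrix kills (D, -C) and (B, -A); injectivity then makes all four
      entries vanish.\<close>
    have "dd F q (D q, - C q) = 0" using d0 unfolding ddF[OF q] det_def by (simp add: zero_prod_def algebra_simps)
    from z[OF this] have "C q = 0" "D q = 0" by (auto simp: zero_prod_def)
    moreover have "dd F q (B q, - A q) = 0" using d0 unfolding ddF[OF q] det_def by (simp add: zero_prod_def algebra_simps)
    from z[OF this] have "A q = 0" "B q = 0" by (auto simp: zero_prod_def)
    ultimately have "dd F q (1, 0) = 0" using ddF[OF q] by (simp add: zero_prod_def)
    from z[OF this] show False by (simp add: zero_prod_def)
  qed
  define H where "H v q = ((D q * fst v - B q * snd v) / det q, (A q * snd v - C q * fst v) / det q)" for v q
  have sm: "smooth_on U A" "smooth_on U B" "smooth_on U C" "smooth_on U D"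
    unfolding A_def B_def C_def D_def
    by (intro smooth_on_fst smooth_on_snd I(1) smooth_on_dd smooth_on_subset[OF assms(2) I(2)])+
  have H: "smooth_on U (H v)" for v
    unfolding H_def det_def using sm det[unfolded det_def]
    by (intro smooth_on_Pair I(1) smooth_on_divide smooth_on_diff smooth_on_mult smooth_on_const) auto
  have ddG: "dd G y v = H v (G y)" if "y \<in> V" for y v
  proof -
    have q: "G y \<in> U" "G y \<in> S" using GV[OF that] I(2) by blast+
    have "dd F (G y) (H v (G y)) = v"
      unfolding ddF[OF q(2)] H_def using det[OF q(1)]
      by (simp add: prod_eq_iff field_simps) (simp add: det_def algebra_simps)
    then have "Hilbert_Choice.inv (dd F (G y)) v = H v (G y)"
      by (rule inv_f_eq[OF bij_is_inj[OF bijU[OF q(1)]]])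
    then show ?thesis using dd_eqI[OF I(7)[OF that]] I(8)[OF that] f'[OF q(2)] by simp
  qed
  have "Ck_on k V G" for k
  proof (induction k)
    case 0
    then show ?case using I(6) unfolding homeomorphism_def by simp
  next
    case (Suc k)
    have "Ck_on k V (\<lambda>y. dd G y v)" for v
    proof (rule Ck_on_cong[OF I(4)])
      show "Ck_on k V (\<lambda>y. H v (G y))"
        by (rule Ck_on_compose[OF I(4,1) _ Suc]) (use H GV in \<open>auto simp: smooth_on_def\<close>)
    qed (simp add: ddG)
    then show ?case using differentiableI[OF I(7)] by auto
  qed
  then have "smooth_on V G" unfolding smooth_on_def by blast
  then show ?thesis by (rule that[OF I(1,3,2,4,6) _ bij_is_inj[OF bijU]])
qed

section \<open>Submanifolds of the Robertson-Walker space-time\<close>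

text \<open>The product rule for a differential applied to a moving vector at a moving point. It
  yields second derivatives of composites, and derivatives of fields of the form dy(xi) when tau is
  the identity.\<close>

lemma dd_dd_apply:
  fixes F :: "'b::euclidean_space \<Rightarrow> 'c::euclidean_space" and \<tau> :: "'a::euclidean_space \<Rightarrow> 'b"
  assumes "open S" "smooth_on S F" "open U" "smooth_on U \<tau>" "\<tau> ` U \<subseteq> S" "smooth_on U V" "q \<in> U"
  shows "dd (\<lambda>r. dd F (\<tau> r) (V r)) q a
    = dd (\<lambda>r. dd F r (V q)) (\<tau> q) (dd \<tau> q a) + dd F (\<tau> q) (dd V q a)"
proof -
  have S: "\<tau> r \<in> S" if "r \<in> U" for r using assms(5) that by blast
  have lin: "linear (dd F p)" if "p \<in> S" for p using smooth_on_linear_dd[OF assms(2) that] .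
  have expand: "dd F p v = (\<Sum>i\<in>Basis. (v \<bullet> i) *\<^sub>R dd F p i)" if "p \<in> S" for p v
    using linear_sum[OF lin[OF that], of "\<lambda>i. (v \<bullet> i) *\<^sub>R i" Basis] linear_scale[OF lin[OF that]]
    by (simp add: euclidean_representation)
  have D1: "((\<lambda>r. dd F (\<tau> r) i) has_derivative (\<lambda>v. dd (\<lambda>r. dd F r i) (\<tau> q) (dd \<tau> q v))) (at q)" for i
    by (rule has_derivative_compose[OF smooth_on_has_derivative[OF assms(4,7)]
          smooth_on_has_derivative[OF smooth_on_dd[OF assms(2)] S[OF assms(7)]]])
  have D2: "((\<lambda>r. V r \<bullet> i) has_derivative (\<lambda>v. dd V q v \<bullet> i)) (at q)" for i
    by (rule has_derivative_inner_left[OF smooth_on_has_derivative[OF assms(6,7)]])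
  have D: "((\<lambda>r. \<Sum>i\<in>Basis. (V r \<bullet> i) *\<^sub>R dd F (\<tau> r) i) has_derivative
     (\<lambda>v. \<Sum>i\<in>Basis. (V q \<bullet> i) *\<^sub>R dd (\<lambda>r. dd F r i) (\<tau> q) (dd \<tau> q v) + (dd V q v \<bullet> i) *\<^sub>R dd F (\<tau> q) i)) (at q)"
    by (intro has_derivative_sum has_derivative_scaleR D1 D2)
  have "dd (\<lambda>r. dd F (\<tau> r) (V r)) q a = dd (\<lambda>r. \<Sum>i\<in>Basis. (V r \<bullet> i) *\<^sub>R dd F (\<tau> r) i) q a"
    by (subst dd_cong[OF assms(3,7)]) (use expand S in auto)
  also have "\<dots> = (\<Sum>i\<in>Basis. (V q \<bullet> i) *\<^sub>R dd (\<lambda>r. dd F r i) (\<tau> q) (dd \<tau> q a)) + dd F (\<tau> q) (dd V q a)"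
    using dd_eqI[OF D] by (simp add: sum.distrib expand[OF S[OF assms(7)], of "dd V q a"])
  also have "(\<Sum>i\<in>Basis. (V q \<bullet> i) *\<^sub>R dd (\<lambda>r. dd F r i) (\<tau> q) (dd \<tau> q a)) = dd (\<lambda>r. dd F r (V q)) (\<tau> q) (dd \<tau> q a)"
  proof -
    \<comment> \<open>Linearity in the inner vector becomes visible after exchanging the two
      directions: the inner vector turns into the direction of an outer derivative.\<close>
    let ?L = "\<lambda>v. dd (\<lambda>r. dd F r v) (\<tau> q) (dd \<tau> q a)"
    have "?L = dd (\<lambda>r. dd F r (dd \<tau> q a)) (\<tau> q)"
      using second_derivative_symmetric[OF assms(1,2) S[OF assms(7)]] by auto
    moreover have "linear (dd (\<lambda>r. dd F r (dd \<tau> q a)) (\<tau> q))"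
      using smooth_on_linear_dd[OF smooth_on_dd[OF assms(2)] S[OF assms(7)]] .
    ultimately have L: "linear ?L" by simp
    show ?thesis using linear_sum[OF L, of "\<lambda>i. (V q \<bullet> i) *\<^sub>R i" Basis] linear_scale[OF L]
      by (simp add: euclidean_representation)
  qed
  finally show ?thesis .
qed

text \<open>For a Lorentzian tangent plane this says that h(dy(a), .) = 0, by
  \<open>normal_part_eq_0\<close>. Stating it as tangency of covariant derivatives removes the
  projection, which makes it easy to move under reparametrizations and isometries.\<close>

definition null_dir :: "(real \<Rightarrow> real) \<Rightarrow> (real \<times> real \<Rightarrow> spacetime) \<Rightarrow> real \<times> real \<Rightarrow> real \<times> real \<Rightarrow> bool" where
  "null_dir f y q a \<longleftrightarrow> (\<forall>b. cov_deriv (rw_metric f) y q a b \<in> tangent_space y q)"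

section \<open>Projections onto Lorentzian planes\<close>

lemma rw_metric_simps:
  "rw_metric f p (X + Y) Z = rw_metric f p X Z + rw_metric f p Y Z"
  "rw_metric f p Z (X + Y) = rw_metric f p Z X + rw_metric f p Z Y"
  "rw_metric f p (X - Y) Z = rw_metric f p X Z - rw_metric f p Y Z"
  "rw_metric f p Z (X - Y) = rw_metric f p Z X - rw_metric f p Z Y"
  "rw_metric f p (c *\<^sub>R X) Z = c * rw_metric f p X Z"
  "rw_metric f p Z (c *\<^sub>R X) = c * rw_metric f p Z X"
  "rw_metric f p X Z = rw_metric f p Z X"
  by (simp_all add: rw_metric_def inner_add_left inner_add_right inner_diff_left inner_diff_right
      distrib_left distrib_right left_diff_distrib right_diff_distrib mult.commute inner_commute mult.left_commute)

text \<open>The coefficients are those of a pseudo-orthonormal basis; the minus sign in the first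
  one comes from the norm -1 of the time-like basis vector.\<close>

lemma tangent_part_exists:
  assumes "lorentzian_plane (rw_metric f) p P"
  shows "\<exists>!w. w \<in> P \<and> (\<forall>z\<in>P. rw_metric f p (v - w) z = 0)"
proof -
  let ?g = "rw_metric f p"
  obtain e1 e2 where e: "P = span {e1, e2}" "?g e1 e1 = -1" "?g e1 e2 = 0" "?g e2 e2 = 1"
    using assms unfolding lorentzian_plane_def by blast
  have e21: "?g e2 e1 = 0" using e(3) rw_metric_simps(7) by metis
  have P: "z \<in> P \<longleftrightarrow> (\<exists>a b. z = a *\<^sub>R e1 + b *\<^sub>R e2)" for z
    by (simp add: e(1) span_breakdown_eq diff_diff_eq)
  show ?thesis
  proof (rule ex1I[of _ "(- ?g v e1) *\<^sub>R e1 + ?g v e2 *\<^sub>R e2"])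
    show "(- ?g v e1) *\<^sub>R e1 + ?g v e2 *\<^sub>R e2 \<in> P \<and>
        (\<forall>z\<in>P. ?g (v - ((- ?g v e1) *\<^sub>R e1 + ?g v e2 *\<^sub>R e2)) z = 0)"
    proof (intro conjI ballI)
      show "(- ?g v e1) *\<^sub>R e1 + ?g v e2 *\<^sub>R e2 \<in> P" unfolding P by blast
      fix z assume "z \<in> P"
      then obtain a b where "z = a *\<^sub>R e1 + b *\<^sub>R e2" using P by blast
      then show "?g (v - ((- ?g v e1) *\<^sub>R e1 + ?g v e2 *\<^sub>R e2)) z = 0"
        by (simp only: rw_metric_simps(1-6) e(2-4) e21) simp
    qed
  next
    fix w assume w: "w \<in> P \<and> (\<forall>z\<in>P. ?g (v - w) z = 0)"
    then obtain a b where ab: "w = a *\<^sub>R e1 + b *\<^sub>R e2" using P by blast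
    have "e1 \<in> P" "e2 \<in> P" unfolding e(1) by (auto intro: span_base)
    then have "?g (v - w) e1 = 0" "?g (v - w) e2 = 0" using w by blast+
    then have "a = - ?g v e1" "b = ?g v e2"
      unfolding ab by (simp_all add: rw_metric_simps(1-6) e e21)
    then show "w = (- ?g v e1) *\<^sub>R e1 + ?g v e2 *\<^sub>R e2" using ab by blast
  qed
qed

lemma tangent_part_eqI:
  assumes "lorentzian_plane (rw_metric f) p P" "w \<in> P" "\<And>z. z \<in> P \<Longrightarrow> rw_metric f p (v - w) z = 0"
  shows "tangent_part (rw_metric f) p P v = w"
  unfolding tangent_part_def using the1_equality[OF tangent_part_exists[OF assms(1)]] assms(2,3) by blast

lemma normal_part_eq_0:
  assumes "lorentzian_plane (rw_metric f) p P"
  shows "normal_part (rw_metric f) p P v = 0 \<longleftrightarrow> v \<in> P"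
proof
  assume "normal_part (rw_metric f) p P v = 0"
  then have "v = tangent_part (rw_metric f) p P v" unfolding normal_part_def by simp
  moreover have "tangent_part (rw_metric f) p P v \<in> P"
    unfolding tangent_part_def by (rule conjunct1[OF theI'[OF tangent_part_exists[OF assms]]])
  ultimately show "v \<in> P" by simp
next
  assume "v \<in> P"
  then have "tangent_part (rw_metric f) p P v = v"
    by (intro tangent_part_eqI[OF assms]) (auto simp: rw_metric_def)
  then show "normal_part (rw_metric f) p P v = 0" unfolding normal_part_def by simp
qed

lemma relative_null_space_eq:
  assumes "lorentzian_plane (rw_metric f) (y q) (tangent_space y q)"
  shows "relative_null_space (rw_metric f) y q = {dd y q a | a. null_dir f y q a}"
  unfolding relative_null_space_def second_ff_def null_dir_def normal_part_eq_0[OF assms] ..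

section \<open>Null directions under reparametrization\<close>

lemma tangent_space_compose:
  fixes \<tau> :: "'a::euclidean_space \<Rightarrow> 'a"
  assumes "open U" "q \<in> U" "\<And>r. r \<in> U \<Longrightarrow> y r = y0 (\<tau> r)" "\<tau> differentiable (at q)"
    "y0 differentiable (at (\<tau> q))" "inj (dd y q)"
  shows "tangent_space y q = tangent_space y0 (\<tau> q)" "bij (dd \<tau> q)"
proof -
  have y: "dd y q a = dd y0 (\<tau> q) (dd \<tau> q a)" for a
    by (simp add: dd_cong[OF assms(1-3)] dd_compose[OF assms(4,5)])
  have inj: "inj (dd \<tau> q)" using assms(6) unfolding inj_def y by metis
  have "surj (dd \<tau> q)"
    using linear_inj_imp_surj[OF linear_frechet_derivative[OF assms(4)] inj] .
  then show "tangent_space y q = tangent_space y0 (\<tau> q)" "bij (dd \<tau> q)"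
    unfolding tangent_space_def y using inj by (auto simp: bij_def) (metis rangeI surjD)+
qed

lemma cov_deriv_compose:
  fixes y0 :: "'b::euclidean_space \<Rightarrow> 'e::euclidean_space" and \<tau> :: "'a::euclidean_space \<Rightarrow> 'b"
  assumes "open S" "smooth_on S y0" "open U" "smooth_on U \<tau>" "\<tau> ` U \<subseteq> S" "q \<in> U"
    "\<And>r. r \<in> U \<Longrightarrow> y r = y0 (\<tau> r)"
  shows "cov_deriv g y q a b = cov_deriv g y0 (\<tau> q) (dd \<tau> q a) (dd \<tau> q b)
    + dd y0 (\<tau> q) (dd (\<lambda>r. dd \<tau> r b) q a)"
proof -
  have y: "dd y r v = dd y0 (\<tau> r) (dd \<tau> r v)" if "r \<in> U" for r v
  proof -
    have "\<tau> r \<in> S" using that assms(5) by blast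
    then show ?thesis
      by (simp add: dd_cong[OF assms(3) that assms(7)]
          dd_compose[OF smooth_on_differentiable[OF assms(4) that] smooth_on_differentiable[OF assms(2)]])
  qed
  have "dd (\<lambda>r. dd y r b) q a = dd (\<lambda>r. dd y0 (\<tau> r) (dd \<tau> r b)) q a"
    using dd_cong[OF assms(3,6), of "\<lambda>r. dd y r b" "\<lambda>r. dd y0 (\<tau> r) (dd \<tau> r b)"] y by simp
  also have "\<dots> = dd (\<lambda>r. dd y0 r (dd \<tau> q b)) (\<tau> q) (dd \<tau> q a) + dd y0 (\<tau> q) (dd (\<lambda>r. dd \<tau> r b) q a)"
    by (rule dd_dd_apply[OF assms(1-5) smooth_on_dd[OF assms(4)] assms(6)])
  finally show ?thesis unfolding cov_deriv_def y[OF assms(6)] assms(7)[OF assms(6)] by simp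
qed

lemma null_dir_compose:
  assumes "open S" "smooth_on S y0" "open U" "smooth_on U \<tau>" "\<tau> ` U \<subseteq> S" "q \<in> U"
    "\<And>r. r \<in> U \<Longrightarrow> y r = y0 (\<tau> r)" "inj (dd y q)" "null_dir f y0 (\<tau> q) (dd \<tau> q a)"
  shows "null_dir f y q a"
proof -
  have "\<tau> q \<in> S" using assms by blast
  then have T: "tangent_space y q = tangent_space y0 (\<tau> q)"
    using tangent_space_compose(1)[OF assms(3,6,7) smooth_on_differentiable[OF assms(4,6)]
        smooth_on_differentiable[OF assms(2)] assms(8)] by simp
  have sub: "linear (dd y0 (\<tau> q))" using smooth_on_linear_dd[OF assms(2) \<open>\<tau> q \<in> S\<close>] .
  show ?thesis
    unfolding null_dir_def T
  proof
    fix b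
    obtain c where "cov_deriv (rw_metric f) y0 (\<tau> q) (dd \<tau> q a) (dd \<tau> q b) = dd y0 (\<tau> q) c"
      using assms(9) unfolding null_dir_def tangent_space_def by blast
    then show "cov_deriv (rw_metric f) y q a b \<in> tangent_space y0 (\<tau> q)"
      unfolding tangent_space_def
      by (subst cov_deriv_compose[OF assms(1-7)]) (auto simp flip: linear_add[OF sub])
  qed
qed

lemma null_dir_cong:
  assumes "open S" "q \<in> S" "\<And>r. r \<in> S \<Longrightarrow> y r = y' r"
  shows "null_dir f y q a \<longleftrightarrow> null_dir f y' q a"
proof -
  have *: "dd y r = dd y' r" if "r \<in> S" for r by (rule dd_cong[OF assms(1) that assms(3)])
  have "dd (\<lambda>r. dd y r b) q = dd (\<lambda>r. dd y' r b) q" for b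
    by (rule dd_cong[OF assms(1,2)]) (simp add: *)
  then show ?thesis
    unfolding null_dir_def cov_deriv_def tangent_space_def using * assms(2,3) by simp
qed

text \<open>A priori the transition between two embeddings is only continuous. It is smooth because
  an immersion can be inverted near d after a linear projection to the parameter plane. The two
  parametrizations may belong to different maps x and x', so that x' can be x followed by an
  isometry.\<close>

lemma local_param_transition:
  fixes \<psi> \<sigma> :: "real \<times> real \<Rightarrow> 'm" and x' :: "'m \<Rightarrow> 'e::euclidean_space"
  assumes V: "local_param M x V \<psi>" and D: "local_param M x' D \<sigma>" and "q \<in> V" "d \<in> D" "\<psi> q = \<sigma> d"
    and sm: "smooth_on V (x' \<circ> \<psi>)"
  obtains U \<tau> where "open U" "q \<in> U" "U \<subseteq> V" "smooth_on U \<tau>" "\<tau> ` U \<subseteq> D" "\<tau> q = d"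
    "\<And>r. r \<in> U \<Longrightarrow> \<psi> r = \<sigma> (\<tau> r)"
proof -
  have opV: "open V" and opD: "open D" using V D unfolding local_param_def by auto
  have "homeomorphic_map (top_of_set D) (subtopology M (\<sigma> ` D)) \<sigma>"
    using D unfolding local_param_def embedding_map_def by simp
  then obtain \<sigma>' where \<sigma>': "homeomorphic_maps (top_of_set D) (subtopology M (\<sigma> ` D)) \<sigma> \<sigma>'"
    using homeomorphic_map_maps by blast
  have \<sigma>D: "openin M (\<sigma> ` D)" using D unfolding local_param_def by blast
  have inv1: "\<sigma>' (\<sigma> r) = r" if "r \<in> D" for r using \<sigma>' that unfolding homeomorphic_maps_def by simp
  have c\<psi>: "continuous_map (top_of_set V) M \<psi>"
    using V unfolding local_param_def embedding_map_def
    by (metis continuous_map_in_subtopology homeomorphic_imp_continuous_map)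
  define U0 where "U0 = {r \<in> V. \<psi> r \<in> \<sigma> ` D}"
  have "openin (top_of_set V) U0"
    using openin_continuous_map_preimage[OF c\<psi> \<sigma>D] unfolding U0_def by simp
  then have opU0: "open U0" using opV openin_open_eq by blast
  define \<tau>0 where "\<tau>0 = \<sigma>' \<circ> \<psi>"
  have "continuous_map (top_of_set U0) (subtopology M (\<sigma> ` D)) \<psi>"
    unfolding continuous_map_in_subtopology
  proof
    show "continuous_map (top_of_set U0) M \<psi>"
      using continuous_map_from_subtopology_mono[OF c\<psi>, of U0] unfolding U0_def by blast
  qed (auto simp: U0_def)
  then have "continuous_map (top_of_set U0) (top_of_set D) \<tau>0"
    using continuous_map_compose \<sigma>' unfolding \<tau>0_def homeomorphic_maps_def by blast
  then have c\<tau>: "continuous_on U0 \<tau>0" and \<tau>D: "\<tau>0 ` U0 \<subseteq> D"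
    unfolding continuous_map_in_subtopology by auto
  have \<sigma>\<tau>: "\<sigma> (\<tau>0 r) = \<psi> r" if "r \<in> U0" for r
    using that inv1 unfolding U0_def \<tau>0_def by auto
  let ?y = "x' \<circ> \<sigma>"
  have smy: "smooth_on D ?y" and injy: "inj (dd ?y d)"
    using D assms(4) unfolding local_param_def smooth_immersion_on_def by blast+
  \<comment> \<open>Projecting by a left inverse of the differential turns the immersion into a map
    \<open>F\<close> of the plane whose differential at d is the identity.\<close>
  obtain \<pi> where \<pi>: "linear \<pi>" "\<pi> \<circ> dd ?y d = id"
    using linear_injective_left_inverse[OF smooth_on_linear_dd[OF smy assms(4)] injy] by blast
  have bl: "bounded_linear \<pi>" using \<pi>(1) linear_conv_bounded_linear by blast
  define F where "F = (\<lambda>r. \<pi> (?y r))"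
  have smF: "smooth_on D F" unfolding F_def by (rule smooth_on_linear[OF opD bl smy])
  have "dd F d v = v" for v
    unfolding F_def using dd_bounded_linear[OF bl smooth_on_differentiable[OF smy assms(4)]] \<pi>(2)
    by (metis comp_apply id_apply)
  then have "inj (dd F d)" by (simp add: inj_def)
  then obtain U1 V1 G where G: "open U1" "d \<in> U1" "U1 \<subseteq> D" "open V1" "homeomorphism U1 V1 F G" "smooth_on V1 G"
    using smooth_inverse_function[OF opD smF assms(4)] by metis
  define U where "U = {r \<in> U0. \<tau>0 r \<in> U1}"
  have opU: "open U" using continuous_open_preimage[OF c\<tau> opU0 G(1)] unfolding U_def
    by (simp add: vimage_def Int_def)
  \<comment> \<open>On \<open>U\<close> this is the continuous transition \<open>\<tau>0\<close>,
    rewritten as a composite of smooth maps.\<close>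
  define \<tau> where "\<tau> = (\<lambda>r. G (\<pi> ((x' \<circ> \<psi>) r)))"
  have \<pi>\<psi>: "\<pi> ((x' \<circ> \<psi>) r) = F (\<tau>0 r)" if "r \<in> U" for r
    using \<sigma>\<tau> that unfolding F_def U_def by simp
  have \<tau>: "\<tau> r = \<tau>0 r" if "r \<in> U" for r
    using \<pi>\<psi>[OF that] G(5) that unfolding \<tau>_def U_def homeomorphism_def by auto
  have qU0: "q \<in> U0" using assms unfolding U0_def by auto
  have \<tau>0q: "\<tau>0 q = d" using inv1[OF assms(4)] assms(5) unfolding \<tau>0_def by simp
  have qU: "q \<in> U" using qU0 \<tau>0q G(2) unfolding U_def by simp
  show ?thesis
  proof (rule that[OF opU qU])
    show UV: "U \<subseteq> V" unfolding U_def U0_def by blast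
    show "smooth_on U \<tau>" unfolding \<tau>_def
    proof (rule smooth_on_compose[OF opU G(4,6)])
      show "smooth_on U (\<lambda>p. \<pi> ((x' \<circ> \<psi>) p))"
        by (rule smooth_on_linear[OF opU bl smooth_on_subset[OF sm UV]])
      show "(\<lambda>p. \<pi> ((x' \<circ> \<psi>) p)) ` U \<subseteq> V1"
        using \<pi>\<psi> G(5) unfolding U_def homeomorphism_def by fastforce
    qed
    show "\<tau> ` U \<subseteq> D" using \<tau> \<tau>D unfolding U_def by auto
    show "\<tau> q = d" using \<tau>[OF qU] \<tau>0q by simp
    show "\<psi> r = \<sigma> (\<tau> r)" if "r \<in> U" for r using \<sigma>\<tau>[of r] \<tau>[OF that] that unfolding U_def by simp
  qed
qed

section \<open>The Levi-Civita connection of the warped metric and its isometries\<close>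

locale rw =
  fixes I :: "real set" and f :: "real \<Rightarrow> real"
  assumes opI: "open I" and smf: "smooth_on I f" and fnz: "\<And>t. t \<in> I \<Longrightarrow> f t \<noteq> 0"
begin

abbreviation f' :: "real \<Rightarrow> real" where "f' \<equiv> deriv f"

lemma f_deriv: "t \<in> I \<Longrightarrow> (f has_real_derivative f' t) (at t)"
  using smooth_on_differentiable[OF smf] DERIV_deriv_iff_real_differentiable by blast

lemma smf': "smooth_on I f'"
proof (rule smooth_on_cong[OF opI smooth_on_dd[OF smf, of 1]])
  fix t assume "t \<in> I"
  then show "dd f t 1 = f' t" using dd_eqI f_deriv unfolding has_field_derivative_def by fastforce
qed

definition "\<rho> t = f' t / f t"

lemma sm\<rho>: "smooth_on I \<rho>"
  unfolding \<rho>_def by (intro smooth_on_divide opI smf smf' fnz)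

lemma f'_deriv: "t \<in> I \<Longrightarrow> (f' has_real_derivative deriv f' t) (at t)"
  using smooth_on_differentiable[OF smf'] DERIV_deriv_iff_real_differentiable by blast

text \<open>This derivative is the quantity that the standing assumption on f keeps away from
  zero.\<close>

lemma \<rho>_deriv: "t \<in> I \<Longrightarrow> (\<rho> has_real_derivative (deriv f' t / f t - (f' t)\<^sup>2 / (f t)\<^sup>2)) (at t)"
  unfolding \<rho>_def using f_deriv f'_deriv fnz
  by (auto intro!: derivative_eq_intros simp: field_simps power2_eq_square)

abbreviation "g \<equiv> rw_metric f"
abbreviation "L \<equiv> rw_space I"

lemma L_iff: "p \<in> L \<longleftrightarrow> fst p \<in> I" by (cases p) (simp add: rw_space_def)

lemma opL: "open L" unfolding rw_space_def using opI by (simp add: open_Times)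

text \<open>The derivative of g(Y, W) at p in the direction X for constant Y and W: only the factor
  f^2 varies with the point.\<close>

definition "Dg p Y W X = 2 * f (fst p) * f' (fst p) * fst X * (snd Y \<bullet> snd W)"

lemma metric_has_derivative:
  assumes P: "(P has_derivative P') (at q)" and A: "(A has_derivative A') (at q)" and B: "(B has_derivative B') (at q)"
    and q: "P q \<in> L"
  shows "((\<lambda>r. g (P r) (A r) (B r)) has_derivative
     (\<lambda>v. Dg (P q) (A q) (B q) (P' v) + g (P q) (A' v) (B q) + g (P q) (A q) (B' v))) (at q)"
proof -
  have "(f has_derivative (\<lambda>v. f' (fst (P q)) * v)) (at (fst (P q)))"
    using f_deriv q L_iff unfolding has_field_derivative_def by blast
  then have F: "((\<lambda>r. f (fst (P r))) has_derivative (\<lambda>v. f' (fst (P q)) * fst (P' v))) (at q)"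
    using has_derivative_compose[OF has_derivative_fst[OF P]] by fastforce
  show ?thesis unfolding rw_metric_def Dg_def
    by (rule has_derivative_eq_rhs, (rule derivative_eq_intros F P A B | rule refl)+)
       (auto simp: fun_eq_iff algebra_simps power2_eq_square)
qed

lemma dd_metric_const: "p \<in> L \<Longrightarrow> dd (\<lambda>q. g q Y W) p X = Dg p Y W X"
  using dd_eqI[OF metric_has_derivative[OF has_derivative_ident has_derivative_const has_derivative_const, of p Y W]]
  by (simp add: rw_metric_def)

lemma rw_nondegenerate: "p \<in> L \<Longrightarrow> (\<And>W. g p Z W = g p Z' W) \<Longrightarrow> Z = Z'"
proof -
  assume p: "p \<in> L" and *: "\<And>W. g p Z W = g p Z' W"
  have "fst Z = fst Z'" using *[of "(1, 0)"] by (simp add: rw_metric_def)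
  moreover have "(snd Z - snd Z') \<bullet> (snd Z - snd Z') = 0"
    using *[of "(0, snd Z - snd Z')"] fnz p L_iff by (simp add: rw_metric_def inner_diff_left)
  ultimately show ?thesis by (simp add: prod_eq_iff)
qed

lemma christoffel_rw:
  assumes "p \<in> L"
  shows "christoffel g p X Y = (f (fst p) * f' (fst p) * (snd X \<bullet> snd Y), \<rho> (fst p) *\<^sub>R (fst X *\<^sub>R snd Y + fst Y *\<^sub>R snd X))"
    (is "_ = ?Z")
  unfolding christoffel_def dd_metric_const[OF assms]
proof (rule the_equality)
  have "f (fst p) \<noteq> 0" using fnz assms L_iff by blast
  then show *: "\<forall>W. 2 * g p ?Z W = Dg p Y W X + Dg p X W Y - Dg p X Y W"
    by (auto simp: rw_metric_def Dg_def \<rho>_def algebra_simps power2_eq_square inner_add_left)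
  fix Z assume "\<forall>W. 2 * g p Z W = Dg p Y W X + Dg p X W Y - Dg p X Y W"
  then show "Z = ?Z" using * rw_nondegenerate[OF assms] by (metis mult_left_cancel zero_neq_numeral)
qed

lemma christoffel_char:
  assumes "p \<in> L"
  shows "2 * g p (christoffel g p X Y) W = Dg p Y W X + Dg p X W Y - Dg p X Y W"
proof -
  have "f (fst p) \<noteq> 0" using fnz assms L_iff by blast
  then show ?thesis unfolding christoffel_rw[OF assms]
    by (auto simp: rw_metric_def Dg_def \<rho>_def algebra_simps power2_eq_square inner_add_left)
qed

text \<open>Isometries preserve the connection. Differentiating the isometry identity gives one
  equation for each placement of X, Y, W; in the Koszul combination of the three, symmetry of the
  second derivatives of Phi leaves a single Hessian term. Nondegeneracy then strips off the test
  vector, since d Phi is onto.\<close>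

lemma isometry_christoffel:
  assumes iso: "isometry_on g L \<Phi>" and p: "p \<in> L"
  shows "christoffel g (\<Phi> p) (dd \<Phi> p X) (dd \<Phi> p Y) + dd (\<lambda>q. dd \<Phi> q Y) p X = dd \<Phi> p (christoffel g p X Y)"
    and "inj (dd \<Phi> p)"
proof -
  have sm: "smooth_on L \<Phi>" and \<Phi>L: "\<And>q. q \<in> L \<Longrightarrow> \<Phi> q \<in> L"
    and met: "\<And>q X Y. q \<in> L \<Longrightarrow> g (\<Phi> q) (dd \<Phi> q X) (dd \<Phi> q Y) = g q X Y"
    using iso unfolding isometry_on_def bij_betw_def by blast+
  have lin: "linear (dd \<Phi> p)" using smooth_on_linear_dd[OF sm p] .
  show inj: "inj (dd \<Phi> p)"
    by (rule injI) (rule rw_nondegenerate[OF p], metis met p)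
  have surj: "surj (dd \<Phi> p)" using linear_inj_imp_surj[OF lin inj] .
  define S where "S X Y = dd (\<lambda>q. dd \<Phi> q Y) p X" for X Y
  have sym: "S X Y = S Y X" for X Y unfolding S_def using second_derivative_symmetric[OF opL sm p] .
  have diff: "Dg (\<Phi> p) (dd \<Phi> p X) (dd \<Phi> p Y) (dd \<Phi> p W) + g (\<Phi> p) (S W X) (dd \<Phi> p Y) + g (\<Phi> p) (dd \<Phi> p X) (S W Y)
      = Dg p X Y W" for X Y W
  proof -
    have "((\<lambda>q. g (\<Phi> q) (dd \<Phi> q X) (dd \<Phi> q Y)) has_derivative
      (\<lambda>v. Dg (\<Phi> p) (dd \<Phi> p X) (dd \<Phi> p Y) (dd \<Phi> p v) + g (\<Phi> p) (S v X) (dd \<Phi> p Y) + g (\<Phi> p) (dd \<Phi> p X) (S v Y))) (at p)"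
      unfolding S_def
      by (rule metric_has_derivative[OF smooth_on_has_derivative[OF sm p]
            smooth_on_has_derivative[OF smooth_on_dd[OF sm] p]
            smooth_on_has_derivative[OF smooth_on_dd[OF sm] p] \<Phi>L[OF p]])
    from dd_eqI[OF this, of W] have "dd (\<lambda>q. g (\<Phi> q) (dd \<Phi> q X) (dd \<Phi> q Y)) p W =
      Dg (\<Phi> p) (dd \<Phi> p X) (dd \<Phi> p Y) (dd \<Phi> p W) + g (\<Phi> p) (S W X) (dd \<Phi> p Y) + g (\<Phi> p) (dd \<Phi> p X) (S W Y)" .
    moreover have "dd (\<lambda>q. g (\<Phi> q) (dd \<Phi> q X) (dd \<Phi> q Y)) p = dd (\<lambda>q. g q X Y) p"
      by (rule dd_cong[OF opL p met])
    ultimately show ?thesis using dd_metric_const[OF p] by simp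
  qed
  have eq: "g (\<Phi> p) (christoffel g (\<Phi> p) (dd \<Phi> p X) (dd \<Phi> p Y) + S X Y) (dd \<Phi> p W)
      = g (\<Phi> p) (dd \<Phi> p (christoffel g p X Y)) (dd \<Phi> p W)" for W
  proof -
    have "2 * g (\<Phi> p) (dd \<Phi> p (christoffel g p X Y)) (dd \<Phi> p W) = Dg p Y W X + Dg p X W Y - Dg p X Y W"
      using met[OF p] christoffel_char[OF p] by simp
    moreover have "2 * g (\<Phi> p) (christoffel g (\<Phi> p) (dd \<Phi> p X) (dd \<Phi> p Y)) (dd \<Phi> p W)
      = Dg (\<Phi> p) (dd \<Phi> p Y) (dd \<Phi> p W) (dd \<Phi> p X) + Dg (\<Phi> p) (dd \<Phi> p X) (dd \<Phi> p W) (dd \<Phi> p Y)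
        - Dg (\<Phi> p) (dd \<Phi> p X) (dd \<Phi> p Y) (dd \<Phi> p W)"
      by (rule christoffel_char[OF \<Phi>L[OF p]])
    ultimately show ?thesis
      using diff[of Y W X] diff[of X W Y] diff[of X Y W] sym[of W X] sym[of W Y] sym[of X Y]
        rw_metric_simps(7)[of f "\<Phi> p" "dd \<Phi> p X"] rw_metric_simps(7)[of f "\<Phi> p" "dd \<Phi> p Y"]
      by (simp add: rw_metric_simps(1))
  qed
  have "christoffel g (\<Phi> p) (dd \<Phi> p X) (dd \<Phi> p Y) + S X Y = dd \<Phi> p (christoffel g p X Y)"
  proof (rule rw_nondegenerate[OF \<Phi>L[OF p]])
    fix W obtain V where "W = dd \<Phi> p V" using surjD[OF surj] by blast
    then show "g (\<Phi> p) (christoffel g (\<Phi> p) (dd \<Phi> p X) (dd \<Phi> p Y) + S X Y) W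
      = g (\<Phi> p) (dd \<Phi> p (christoffel g p X Y)) W" using eq by simp
  qed
  then show "christoffel g (\<Phi> p) (dd \<Phi> p X) (dd \<Phi> p Y) + dd (\<lambda>q. dd \<Phi> q Y) p X = dd \<Phi> p (christoffel g p X Y)"
    unfolding S_def .
qed

text \<open>The covariant derivatives along Phi o y are the d Phi-images of those along y, and so
  are the tangent spaces. Since d Phi is injective, tangency can be pulled back.\<close>

lemma null_dir_isometry:
  assumes iso: "isometry_on g L \<Phi>" and V: "open V" "smooth_on V y" "y ` V \<subseteq> L" "q \<in> V"
    and null: "null_dir f (\<Phi> \<circ> y) q a"
  shows "null_dir f y q a"
proof -
  have sm: "smooth_on L \<Phi>" using iso unfolding isometry_on_def by blast
  have L: "y r \<in> L" if "r \<in> V" for r using V(3) that by blast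
  have dy: "dd (\<Phi> \<circ> y) r b = dd \<Phi> (y r) (dd y r b)" if "r \<in> V" for r b
    unfolding comp_def
    by (rule dd_compose[OF smooth_on_differentiable[OF V(2) that] smooth_on_differentiable[OF sm L[OF that]]])
  have lin: "linear (dd \<Phi> (y q))" using smooth_on_linear_dd[OF sm L[OF V(4)]] .
  have cov: "cov_deriv g (\<Phi> \<circ> y) q a b = dd \<Phi> (y q) (cov_deriv g y q a b)" for b
  proof -
    have "dd (\<lambda>r. dd (\<Phi> \<circ> y) r b) q a = dd (\<lambda>r. dd \<Phi> (y r) (dd y r b)) q a"
      using dd_cong[OF V(1,4), of "\<lambda>r. dd (\<Phi> \<circ> y) r b" "\<lambda>r. dd \<Phi> (y r) (dd y r b)"] dy by simp
    also have "\<dots> = dd (\<lambda>r. dd \<Phi> r (dd y q b)) (y q) (dd y q a) + dd \<Phi> (y q) (dd (\<lambda>r. dd y r b) q a)"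
      by (rule dd_dd_apply[OF opL sm V(1,2,3) smooth_on_dd[OF V(2)] V(4)])
    finally show ?thesis
      unfolding cov_deriv_def dy[OF V(4)] linear_add[OF lin]
      using isometry_christoffel(1)[OF iso L[OF V(4)], of "dd y q a" "dd y q b"] by (simp add: algebra_simps)
  qed
  have T: "tangent_space (\<Phi> \<circ> y) q = dd \<Phi> (y q) ` tangent_space y q"
    unfolding tangent_space_def dy[OF V(4)] by auto
  show ?thesis
    using null isometry_christoffel(2)[OF iso L[OF V(4)]]
    unfolding null_dir_def cov T by (simp add: inj_image_mem_iff)
qed

text \<open>Positive nullity concerns every local parametrization, whereas the surfaces of the
  theorem come with one parametrization near each point, possibly after an isometry. The null vector
  is carried through the smooth transition and then back through the isometry.\<close>

lemma positive_nullity_transfer: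
  fixes M :: "'m topology"
  assumes tl: "timelike_surface I f M x"
    and cover: "\<And>p. p \<in> topspace M \<Longrightarrow> \<exists>\<Phi> D \<sigma>. isometry_on g L \<Phi> \<and>
      local_param M (\<Phi> \<circ> x) D \<sigma> \<and> p \<in> \<sigma> ` D \<and> (\<forall>d\<in>D. \<exists>a. a \<noteq> 0 \<and> null_dir f (\<Phi> \<circ> x \<circ> \<sigma>) d a)"
  shows "positive_relative_nullity f M x"
  unfolding positive_relative_nullity_def
proof (intro allI impI ballI)
  fix V :: "(real \<times> real) set" and \<psi> q
  assume V: "local_param M x V \<psi>" and q: "q \<in> V"
  have patch: "timelike_patch f V (x \<circ> \<psi>)" using tl V unfolding timelike_surface_def by blast
  have opV: "open V" and smV: "smooth_on V (x \<circ> \<psi>)" and injV: "\<And>q. q \<in> V \<Longrightarrow> inj (dd (x \<circ> \<psi>) q)"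
    using V unfolding local_param_def smooth_immersion_on_def by blast+
  have sub: "\<psi> ` V \<subseteq> topspace M"
    using V unfolding local_param_def using openin_subset by blast
  then have xL: "(x \<circ> \<psi>) ` V \<subseteq> L" using tl unfolding timelike_surface_def immersed_surface_def by auto
  obtain \<Phi> D \<sigma> where iso: "isometry_on g L \<Phi>" and D: "local_param M (\<Phi> \<circ> x) D \<sigma>" "\<psi> q \<in> \<sigma> ` D"
    "\<And>d. d\<in>D \<Longrightarrow> \<exists>a. a \<noteq> 0 \<and> null_dir f (\<Phi> \<circ> x \<circ> \<sigma>) d a"
    using cover[of "\<psi> q"] sub q by blast
  have sm\<Phi>: "smooth_on L \<Phi>" using iso unfolding isometry_on_def by blast
  have sm: "smooth_on V (\<lambda>r. \<Phi> ((x \<circ> \<psi>) r))"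
    by (rule smooth_on_compose[OF opV opL sm\<Phi> smV xL])
  obtain d where d: "d \<in> D" "\<psi> q = \<sigma> d" using D(2) by blast
  obtain U \<tau> where U: "open U" "q \<in> U" "U \<subseteq> V" "smooth_on U \<tau>" "\<tau> ` U \<subseteq> D" "\<tau> q = d"
    "\<And>r. r \<in> U \<Longrightarrow> \<psi> r = \<sigma> (\<tau> r)"
    using local_param_transition[OF V D(1) q d] sm unfolding comp_def by metis
  obtain a0 where a0: "a0 \<noteq> 0" "null_dir f (\<Phi> \<circ> x \<circ> \<sigma>) d a0" using D(3)[OF d(1)] by blast
  have opD: "open D" and smD: "smooth_on D (\<Phi> \<circ> x \<circ> \<sigma>)"
    using D(1) unfolding local_param_def smooth_immersion_on_def by blast+
  have eq: "(\<Phi> \<circ> (x \<circ> \<psi>)) r = (\<Phi> \<circ> x \<circ> \<sigma>) (\<tau> r)" if "r \<in> U" for r using U(7)[OF that] by simp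
  have qL: "(x \<circ> \<psi>) q \<in> L" using xL q by blast
  have inj: "inj (dd (\<Phi> \<circ> (x \<circ> \<psi>)) q)"
  proof -
    have "dd (\<Phi> \<circ> (x \<circ> \<psi>)) q b = dd \<Phi> ((x \<circ> \<psi>) q) (dd (x \<circ> \<psi>) q b)" for b
      unfolding comp_def[of \<Phi>]
      by (rule dd_compose[OF smooth_on_differentiable[OF smV q] smooth_on_differentiable[OF sm\<Phi> qL]])
    then show ?thesis using injV[OF q] isometry_christoffel(2)[OF iso qL] unfolding inj_def by metis
  qed
  have "\<tau> q \<in> D" using d(1) U(6) by simp
  then have bij: "bij (dd \<tau> q)"
    by (intro tangent_space_compose(2)[OF U(1,2) eq smooth_on_differentiable[OF U(4,2)]
      smooth_on_differentiable[OF smD] inj])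
  then obtain a where a: "dd \<tau> q a = a0" using bij_is_surj surjD by metis
  have "null_dir f (\<Phi> \<circ> (x \<circ> \<psi>)) q a"
    by (rule null_dir_compose[OF opD smD U(1,4,5,2) eq inj]) (use a a0 U(6) in \<open>simp_all add: comp_def\<close>)
  then have nd: "null_dir f (x \<circ> \<psi>) q a"
    by (rule null_dir_isometry[OF iso opV smV xL q])
  have "a \<noteq> 0" using a a0 linear_0[OF smooth_on_linear_dd[OF U(4,2)]] by auto
  then have "dd (x \<circ> \<psi>) q a \<noteq> 0"
    using injV[OF q] linear_0[OF smooth_on_linear_dd[OF smV q]] by (metis injD)
  moreover have "dd (x \<circ> \<psi>) q a \<in> relative_null_space g (x \<circ> \<psi>) q"
    using nd relative_null_space_eq patch q unfolding timelike_patch_def by blast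
  ultimately have "\<not> relative_null_space g (x \<circ> \<psi>) q \<subseteq> {0}" by blast
  then show "0 < dim (relative_null_space g (x \<circ> \<psi>) q)"
    using dim_eq_0 by blast
qed

end

section \<open>The model surfaces have positive relative nullity\<close>

lemma has_derivative_fst_arg:
  fixes h :: "real \<Rightarrow> 'b::real_normed_vector"
  assumes "(h has_vector_derivative D) (at (fst r))"
  shows "((\<lambda>r. h (fst r)) has_derivative (\<lambda>b. fst b *\<^sub>R D)) (at r)"
  using has_derivative_compose[OF has_derivative_fst[OF has_derivative_ident]] assms
  unfolding has_vector_derivative_def by blast

lemma has_derivative_snd_arg:
  fixes h :: "real \<Rightarrow> 'b::real_normed_vector"
  assumes "(h has_vector_derivative D) (at (snd r))"
  shows "((\<lambda>r. h (snd r)) has_derivative (\<lambda>b. snd b *\<^sub>R D)) (at r)"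
  using has_derivative_compose[OF has_derivative_snd[OF has_derivative_ident]] assms
  unfolding has_vector_derivative_def by blast

lemma orthonormal_frame_ode:
  fixes \<alpha>1 \<alpha>2 \<alpha>3 :: "real \<Rightarrow> 'a::real_inner"
  assumes J: "is_interval J" and v0: "v0 \<in> J" and v: "v \<in> J"
    and d1: "\<And>v. v \<in> J \<Longrightarrow> (\<alpha>1 has_vector_derivative a1 v *\<^sub>R \<alpha>2 v + a2 v *\<^sub>R \<alpha>3 v) (at v)"
    and d2: "\<And>v. v \<in> J \<Longrightarrow> (\<alpha>2 has_vector_derivative - a1 v *\<^sub>R \<alpha>1 v) (at v)"
    and d3: "\<And>v. v \<in> J \<Longrightarrow> (\<alpha>3 has_vector_derivative - a2 v *\<^sub>R \<alpha>1 v) (at v)"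
    and init: "norm (\<alpha>1 v0) = 1" "norm (\<alpha>2 v0) = 1" "norm (\<alpha>3 v0) = 1"
      "\<alpha>1 v0 \<bullet> \<alpha>2 v0 = 0" "\<alpha>1 v0 \<bullet> \<alpha>3 v0 = 0" "\<alpha>2 v0 \<bullet> \<alpha>3 v0 = 0"
  shows "\<alpha>1 v \<bullet> \<alpha>2 v = 0" "\<alpha>2 v \<bullet> \<alpha>2 v = 1"
proof -
  \<comment> \<open>The Gram matrix \<open>G\<close> satisfies \<open>G' = [A, G]\<close> with \<open>A\<close> skew, so \<open>tr ((G - 1)\<^sup>2)\<close> is constant.\<close>
  define E where "E = (\<lambda>v. (\<alpha>1 v \<bullet> \<alpha>1 v - 1)\<^sup>2 + (\<alpha>2 v \<bullet> \<alpha>2 v - 1)\<^sup>2 + (\<alpha>3 v \<bullet> \<alpha>3 v - 1)\<^sup>2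
    + 2 * (\<alpha>1 v \<bullet> \<alpha>2 v)\<^sup>2 + 2 * (\<alpha>1 v \<bullet> \<alpha>3 v)\<^sup>2 + 2 * (\<alpha>2 v \<bullet> \<alpha>3 v)\<^sup>2)"
  have in_d: "((\<lambda>v. A v \<bullet> B v) has_real_derivative (A v \<bullet> B' + A' \<bullet> B v)) (at v)"
    if "(A has_vector_derivative A') (at v)" "(B has_vector_derivative B') (at v)" for A B :: "real \<Rightarrow> 'a" and A' B' v
    using bounded_bilinear.has_vector_derivative[OF bounded_bilinear_inner that]
    by (simp add: has_real_derivative_iff_has_vector_derivative)
  have "(E has_real_derivative 0) (at v)" if v: "v \<in> J" for v
    unfolding E_def
    by (rule DERIV_cong, (rule derivative_eq_intros in_d[OF d1[OF v] d1[OF v]] in_d[OF d2[OF v] d2[OF v]]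
        in_d[OF d3[OF v] d3[OF v]] in_d[OF d1[OF v] d2[OF v]] in_d[OF d1[OF v] d3[OF v]] in_d[OF d2[OF v] d3[OF v]] refl)+)
       (simp add: inner_add_left inner_add_right inner_commute algebra_simps)
  then have "(E has_real_derivative 0) (at v within J)" if "v \<in> J" for v
    using that has_field_derivative_at_within by blast
  then obtain c where c: "\<And>v. v \<in> J \<Longrightarrow> E v = c"
    using has_field_derivative_zero_constant[of J E] is_interval_convex[OF J] by blast
  have "E v0 = 0" using init unfolding E_def by (simp add: dot_square_norm)
  then have "E v = 0" using c v v0 by metis
  then have "(\<alpha>1 v \<bullet> \<alpha>2 v)\<^sup>2 = 0" "(\<alpha>2 v \<bullet> \<alpha>2 v - 1)\<^sup>2 = 0"
    unfolding E_def using zero_le_power2[of "\<alpha>1 v \<bullet> \<alpha>1 v - 1"] zero_le_power2[of "\<alpha>2 v \<bullet> \<alpha>2 v - 1"]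
      zero_le_power2[of "\<alpha>3 v \<bullet> \<alpha>3 v - 1"] zero_le_power2[of "\<alpha>1 v \<bullet> \<alpha>2 v"]
      zero_le_power2[of "\<alpha>1 v \<bullet> \<alpha>3 v"] zero_le_power2[of "\<alpha>2 v \<bullet> \<alpha>3 v"] by linarith+
  then show "\<alpha>1 v \<bullet> \<alpha>2 v = 0" "\<alpha>2 v \<bullet> \<alpha>2 v = 1" by auto
qed

context rw
begin

section \<open>The warped cylinders\<close>

lemma isometry_id: "isometry_on g L id"
proof -
  have "smooth_on L (\<lambda>p. p)" by (rule smooth_on_ident)
  moreover have "smooth_on L (inv_into L id)"
    by (rule smooth_on_cong[OF opL smooth_on_ident]) (simp add: inv_into_f_eq)
  ultimately show ?thesis unfolding isometry_on_def by (simp add: id_def bij_betw_id[unfolded id_def])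
qed

text \<open>The second derivative is taken in exchanged order, so that the differentiated field is
  dy(a). In both applications a = (1, 0), and that field has a short closed form.\<close>

lemma cov_deriv_eq:
  assumes "open S" "smooth_on S y" "q \<in> S" "y q \<in> L"
  shows "cov_deriv g y q a b = dd (\<lambda>r. dd y r a) q b
     + (f (fst (y q)) * f' (fst (y q)) * (snd (dd y q a) \<bullet> snd (dd y q b)),
        \<rho> (fst (y q)) *\<^sub>R (fst (dd y q a) *\<^sub>R snd (dd y q b) + fst (dd y q b) *\<^sub>R snd (dd y q a)))"
  unfolding cov_deriv_def christoffel_rw[OF assms(4)] second_derivative_symmetric[OF assms(1-3), of b a] ..

text \<open>Here dy(1, 0) is the constant vector d/dt, so only the Christoffel term contributes. It
  is \<open>\<rho>\<close> times the spatial part of dy(b), which is a multiple of dy(0, 1).\<close>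

lemma cylinder_null_dir:
  assumes "open D" "D \<subseteq> I \<times> J" "smooth_on D y" "open J" "smooth_on J \<alpha>"
    and y: "\<And>q. q \<in> D \<Longrightarrow> y q = (\<lambda>(t, s). (t, \<alpha> s)) q" and q: "q \<in> D"
  shows "null_dir f y q (1, 0)"
proof -
  have dy: "dd y r b = (fst b, snd b *\<^sub>R dd \<alpha> (snd r) 1)" if r: "r \<in> D" for r b
  proof -
    have "snd r \<in> J" using r assms(2) by auto
    then have D: "((\<lambda>r. (fst r, \<alpha> (snd r))) has_derivative (\<lambda>b. (fst b, snd b *\<^sub>R dd \<alpha> (snd r) 1))) (at r)"
      by (intro has_derivative_Pair has_derivative_snd_arg has_derivative_fst has_derivative_ident
          smooth_on_has_vector_derivative[OF assms(5)])
    have eq: "dd y r = dd (\<lambda>r. (fst r, \<alpha> (snd r))) r"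
      by (rule dd_cong[OF assms(1) r]) (simp add: y case_prod_beta)
    show ?thesis unfolding eq by (rule dd_eqI[OF D])
  qed
  have "dd (\<lambda>r. dd y r (1, 0)) q = dd (\<lambda>r. (1, 0)) q"
    by (rule dd_cong[OF assms(1) q]) (simp add: dy)
  then have d2: "dd (\<lambda>r. dd y r (1, 0)) q b = 0" for b by simp
  have yq: "y q \<in> L" using y[OF q] q assms(2) L_iff by (auto simp: case_prod_beta)
  show ?thesis unfolding null_dir_def
  proof
    fix b
    have "cov_deriv g y q (1, 0) b = dd y q (0, \<rho> (fst (y q)) * snd b)"
      unfolding cov_deriv_eq[OF assms(1,3) q yq] d2 dy[OF q] by simp
    then show "cov_deriv g y q (1, 0) b \<in> tangent_space y q" unfolding tangent_space_def by simp
  qed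
qed

lemma cylinder_positive_nullity:
  assumes tl: "timelike_surface I f M x" and cyl: "open_part_of_warped_cylinder I M x"
  shows "positive_relative_nullity f M x"
proof (rule positive_nullity_transfer[OF tl])
  fix p assume p: "p \<in> topspace M"
  obtain J and \<alpha> :: "real \<Rightarrow> real^3" where J: "open J" "smooth_on J \<alpha>"
    "open_part_near M x p (I \<times> J) (\<lambda>(t, s). (t, \<alpha> s))"
    using cyl p unfolding open_part_of_warped_cylinder_def open_interval_def by blast
  then obtain D \<sigma> where D: "D \<subseteq> I \<times> J" "local_param M x D \<sigma>" "p \<in> \<sigma> ` D"
    "\<And>q. q \<in> D \<Longrightarrow> x (\<sigma> q) = (\<lambda>(t, s). (t, \<alpha> s)) q"
    unfolding open_part_near_def by blast
  have "open D" "smooth_on D (x \<circ> \<sigma>)" using D(2) unfolding local_param_def smooth_immersion_on_def by blast+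
  then have "null_dir f (id \<circ> x \<circ> \<sigma>) d (1, 0)" if "d \<in> D" for d
    using cylinder_null_dir[OF _ D(1) _ J(1,2) _ that, of "x \<circ> \<sigma>"] D(4) by simp
  then show "\<exists>\<Phi> D \<sigma>. isometry_on g L \<Phi> \<and> local_param M (\<Phi> \<circ> x) D \<sigma> \<and> p \<in> \<sigma> ` D \<and>
      (\<forall>d\<in>D. \<exists>a. a \<noteq> 0 \<and> null_dir f (\<Phi> \<circ> x \<circ> \<sigma>) d a)"
    using isometry_id D(2,3)
    by (intro exI[of _ id] exI[of _ D] exI[of _ \<sigma>] conjI ballI exI[of _ "(1, 0)"]) (simp_all add: zero_prod_def)
qed

section \<open>The integrand of the model surface, and the model surfaces\<close>

definition "slope a w = a / (f w * sqrt (a\<^sup>2 + (f w)\<^sup>2))"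

lemma root_pos: "a \<noteq> 0 \<Longrightarrow> a\<^sup>2 + (f w)\<^sup>2 > 0"
  by (simp add: add_pos_nonneg)

lemma smooth_slope: "a \<noteq> 0 \<Longrightarrow> smooth_on I (slope a)"
  unfolding slope_def
proof (intro smooth_on_divide smooth_on_mult smooth_on_sqrt smooth_on_add smooth_on_power smooth_on_const opI smf)
  fix w assume w: "a \<noteq> 0" "w \<in> I"
  show "a\<^sup>2 + (f w)\<^sup>2 > 0" by (rule root_pos[OF w(1)])
  show "f w * sqrt (a\<^sup>2 + (f w)\<^sup>2) \<noteq> 0" using w fnz by simp
qed

text \<open>The equation of an unparametrized geodesic: the acceleration (f f' h^2, h' + 2
  \<open>\<rho>\<close> h) of a curve with velocity (1, h) is proportional to (1, h).\<close>

lemma slope_deriv: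
  assumes "a \<noteq> 0" "w \<in> I"
  shows "(slope a has_real_derivative f w * f' w * (slope a w)^3 - 2 * \<rho> w * slope a w) (at w)"
proof -
  define R where "R = sqrt (a\<^sup>2 + (f w)\<^sup>2)"
  have R: "R > 0" "R\<^sup>2 = a\<^sup>2 + (f w)\<^sup>2" using root_pos[OF assms(1), of w] unfolding R_def by auto
  have fw: "f w \<noteq> 0" using fnz assms(2) by blast
  have "((\<lambda>w. a\<^sup>2 + (f w)\<^sup>2) has_real_derivative 2 * f w * f' w) (at w)"
    by (rule DERIV_cong, (rule derivative_eq_intros f_deriv assms(2) refl)+) simp
  from DERIV_chain2[OF DERIV_real_sqrt[OF root_pos[OF assms(1)]] this]
  have Rd: "((\<lambda>w. sqrt (a\<^sup>2 + (f w)\<^sup>2)) has_real_derivative f w * f' w / R) (at w)"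
    by (rule DERIV_cong) (simp add: R_def field_simps)
  have "(slope a has_real_derivative - (a * (f' w * R + f w * (f w * f' w / R))) / (f w * R)\<^sup>2) (at w)"
    unfolding slope_def
    by (rule DERIV_cong[OF DERIV_divide[OF DERIV_const DERIV_mult[OF f_deriv[OF assms(2)] Rd]]])
       (insert R(1) fw, simp_all only: R_def[symmetric], simp_all add: power2_eq_square)
  moreover have "- (a * (f' w * R + f w * (f w * f' w / R))) / (f w * R)\<^sup>2
    = f w * f' w * (slope a w)^3 - 2 * \<rho> w * slope a w"
  proof -
    have sl: "slope a w = a / (f w * R)" unfolding slope_def R_def ..
    have "f w * f' w * (slope a w)^3 - 2 * \<rho> w * slope a w
        = a * f' w * (a\<^sup>2 - 2 * R\<^sup>2) / ((f w)\<^sup>2 * R^3)"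
      unfolding \<rho>_def sl using R(1) fw by (simp add: field_simps power2_eq_square power3_eq_cube)
    also have "\<dots> = - (a * f' w * (R\<^sup>2 + (f w)\<^sup>2)) / ((f w)\<^sup>2 * R^3)" unfolding R(2) by (simp add: algebra_simps)
    also have "\<dots> = - (a * (f' w * R + f w * (f w * f' w / R))) / (f w * R)\<^sup>2"
      using R(1) fw by (simp add: field_simps power2_eq_square power3_eq_cube)
    finally show ?thesis by simp
  qed
  ultimately show ?thesis by simp
qed

definition "height a u0 u = (LBINT w=ereal u0..ereal u. slope a w)"

lemma height_deriv:
  assumes "a \<noteq> 0" "is_interval I" "u0 \<in> I" "u \<in> I"
  shows "(height a u0 has_vector_derivative slope a u) (at u)"
proof -
  have "min u0 u \<in> I" "max u0 u \<in> I" using assms by (auto simp: min_def max_def)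
  then obtain e1 e2 where e: "e1 > 0" "cball (min u0 u) e1 \<subseteq> I" "e2 > 0" "cball (max u0 u) e2 \<subseteq> I"
    using opI open_contains_cball by metis
  \<comment> \<open>The interval is widened beyond \<open>u0\<close> and \<open>u\<close>, so that
    \<open>u\<close> is interior and the one-sided statement of the fundamental theorem becomes a
    derivative at \<open>u\<close>.\<close>
  define l where "l = min u0 u - e1"
  define r where "r = max u0 u + e2"
  have lr: "l \<in> I" "r \<in> I" using e unfolding l_def r_def by (auto simp: subset_iff dist_real_def)
  have sub: "{l..r} \<subseteq> I" using mem_is_interval_1_I[OF assms(2) lr] by auto
  have "continuous_on {l..r} (slope a)"
    using smooth_on_continuous_on[OF smooth_slope[OF assms(1)]] sub continuous_on_subset by blast
  moreover have "l \<le> u0" "u0 \<le> r" "u \<in> {l..r}" using e(1,3) unfolding l_def r_def by auto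
  ultimately have "(height a u0 has_vector_derivative slope a u) (at u within {l..r})"
    unfolding height_def by (intro interval_integral_FTC2) auto
  moreover have "u \<in> interior {l..r}" using e(1,3) unfolding l_def r_def by auto
  ultimately show ?thesis by (metis at_within_interior)
qed

lemma height_refl: "height a u0 u0 = 0"
  unfolding height_def by simp

lemma smooth_height: "a \<noteq> 0 \<Longrightarrow> is_interval I \<Longrightarrow> u0 \<in> I \<Longrightarrow> smooth_on I (height a u0)"
  by (rule smooth_on_vector_derivativeI[OF opI height_deriv smooth_slope])

lemma model_surface_eq:
  "model_surface f a u0 \<phi>1 \<phi>2 \<phi>3 \<alpha>1 \<alpha>2 \<alpha>3 = (\<lambda>r. (fst r, \<phi>1 (snd r) *\<^sub>R \<alpha>1 (snd r)
     + (height a u0 (fst r) + \<phi>2 (snd r)) *\<^sub>R \<alpha>2 (snd r) + \<phi>3 (snd r) *\<^sub>R \<alpha>3 (snd r)))"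
  unfolding model_surface_def height_def slope_def by (simp add: case_prod_unfold)

text \<open>The equations for phi and alpha cancel the \<open>\<alpha>2\<close> and
  \<open>\<alpha>3\<close> components of dy(0, 1), leaving (0, k \<open>\<alpha>1\<close>), while
  dy(1, 0) = (1, slope \<open>\<alpha>2\<close>). The derivative of the latter stays tangent: in the
  direction u by the geodesic equation, in the direction v because \<open>\<alpha>2\<close> moves
  along \<open>\<alpha>1\<close>.\<close>

lemma model_null_dir:
  assumes I: "is_interval I"
    and md: "model_data I J a u0 v0 a1 a2 \<phi>1 \<phi>2 \<phi>3 \<alpha>1 \<alpha>2 \<alpha>3"
    and E: "open E" "E \<subseteq> I \<times> J" "timelike_patch f E (model_surface f a u0 \<phi>1 \<phi>2 \<phi>3 \<alpha>1 \<alpha>2 \<alpha>3)"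
    and q: "q \<in> E"
  shows "null_dir f (model_surface f a u0 \<phi>1 \<phi>2 \<phi>3 \<alpha>1 \<alpha>2 \<alpha>3) q (1, 0)"
proof -
  let ?y = "model_surface f a u0 \<phi>1 \<phi>2 \<phi>3 \<alpha>1 \<alpha>2 \<alpha>3"
  have a: "a \<noteq> 0" and u0: "u0 \<in> I" and J: "open J" "is_interval J"
    and sm: "smooth_on J \<phi>1" "smooth_on J \<phi>2" "smooth_on J \<phi>3"
    and d\<phi>2: "\<And>v. v \<in> J \<Longrightarrow> (\<phi>2 has_real_derivative - a1 v * \<phi>1 v) (at v)"
    and d\<phi>3: "\<And>v. v \<in> J \<Longrightarrow> (\<phi>3 has_real_derivative - a2 v * \<phi>1 v) (at v)"
    and d\<alpha>1: "\<And>v. v \<in> J \<Longrightarrow> (\<alpha>1 has_vector_derivative a1 v *\<^sub>R \<alpha>2 v + a2 v *\<^sub>R \<alpha>3 v) (at v)"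
    and d\<alpha>2: "\<And>v. v \<in> J \<Longrightarrow> (\<alpha>2 has_vector_derivative - a1 v *\<^sub>R \<alpha>1 v) (at v)"
    and d\<alpha>3: "\<And>v. v \<in> J \<Longrightarrow> (\<alpha>3 has_vector_derivative - a2 v *\<^sub>R \<alpha>1 v) (at v)"
    and v0: "v0 \<in> J" and init: "norm (\<alpha>1 v0) = 1" "norm (\<alpha>2 v0) = 1" "norm (\<alpha>3 v0) = 1"
      "\<alpha>1 v0 \<bullet> \<alpha>2 v0 = 0" "\<alpha>1 v0 \<bullet> \<alpha>3 v0 = 0" "\<alpha>2 v0 \<bullet> \<alpha>3 v0 = 0"
    using md unfolding model_data_def open_interval_def by auto
  note on = orthonormal_frame_ode[OF J(2) v0 _ d\<alpha>1 d\<alpha>2 d\<alpha>3 init]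
  \<comment> \<open>The coefficient of \<open>\<alpha>1\<close> in dy(0, 1); it is nonzero where the
    parametrization is an immersion.\<close>
  define k where "k r = dd \<phi>1 (snd r) 1 - (height a u0 (fst r) + \<phi>2 (snd r)) * a1 (snd r) - \<phi>3 (snd r) * a2 (snd r)" for r :: "real \<times> real"
  have rIJ: "fst r \<in> I" "snd r \<in> J" if "r \<in> E" for r using that E(2) by auto
  have D: "(?y has_derivative (\<lambda>b. (fst b, fst b *\<^sub>R slope a (fst r) *\<^sub>R \<alpha>2 (snd r) + snd b *\<^sub>R k r *\<^sub>R \<alpha>1 (snd r)))) (at r)"
    if r: "r \<in> E" for r
  proof -
    note rr = rIJ[OF r]
    show ?thesis unfolding model_surface_eq
      by (rule has_derivative_eq_rhs, (rule has_derivative_Pair has_derivative_fst has_derivative_ident has_derivative_add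
            has_derivative_scaleR has_derivative_snd_arg[OF smooth_on_has_vector_derivative[OF sm(1) rr(2)]]
            has_derivative_snd_arg[OF d\<alpha>1[OF rr(2)]] has_derivative_snd_arg[OF d\<alpha>2[OF rr(2)]] has_derivative_snd_arg[OF d\<alpha>3[OF rr(2)]]
            has_derivative_fst_arg[OF height_deriv[OF a I u0 rr(1)]]
            has_derivative_snd_arg[OF d\<phi>2[OF rr(2), unfolded has_real_derivative_iff_has_vector_derivative]]
            has_derivative_snd_arg[OF d\<phi>3[OF rr(2), unfolded has_real_derivative_iff_has_vector_derivative]])+)
         (simp add: k_def fun_eq_iff algebra_simps)
  qed
  note dy = dd_eqI[OF D]
  have smy: "smooth_on E ?y" and injy: "inj (dd ?y q)"
    using E(3) q unfolding timelike_patch_def smooth_immersion_on_def by blast+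
  have yq: "?y q \<in> L" and fy: "fst (?y q) = fst q" using rIJ[OF q] unfolding L_iff model_surface_eq by auto
  note qq = rIJ[OF q]
  have kq: "k q \<noteq> 0"
  proof
    assume "k q = 0"
    then have "dd ?y q (0, 1) = dd ?y q (0, 0)" unfolding dy[OF q] by simp
    then show False using injy by (auto dest: injD)
  qed
  define h where "h = slope a (fst q)"
  define h' where "h' = f (fst q) * f' (fst q) * h^3 - 2 * \<rho> (fst q) * h"
  have D2: "((\<lambda>r. (1, slope a (fst r) *\<^sub>R \<alpha>2 (snd r))) has_derivative
     (\<lambda>b. (0, h *\<^sub>R snd b *\<^sub>R (- a1 (snd q) *\<^sub>R \<alpha>1 (snd q)) + (fst b *\<^sub>R h') *\<^sub>R \<alpha>2 (snd q)))) (at q)"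
    unfolding h'_def h_def
    by (intro has_derivative_Pair has_derivative_const has_derivative_scaleR has_derivative_fst_arg
        has_derivative_snd_arg d\<alpha>2 qq slope_deriv[OF a qq(1), unfolded has_real_derivative_iff_has_vector_derivative])
  have "dd (\<lambda>r. dd ?y r (1, 0)) q = dd (\<lambda>r. (1, slope a (fst r) *\<^sub>R \<alpha>2 (snd r))) q"
    by (rule dd_cong[OF E(1) q]) (simp add: dy)
  then have d2: "dd (\<lambda>r. dd ?y r (1, 0)) q b = (0, h *\<^sub>R snd b *\<^sub>R (- a1 (snd q) *\<^sub>R \<alpha>1 (snd q)) + (fst b *\<^sub>R h') *\<^sub>R \<alpha>2 (snd q))" for b
    using dd_eqI[OF D2] by simp
  show ?thesis unfolding null_dir_def
  proof
    fix b :: "real \<times> real"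
    \<comment> \<open>The coordinates of the covariant derivative in the basis dy(1, 0), dy(0, 1):
      the time component gives the first, the \<open>\<alpha>1\<close> component the second.\<close>
    let ?c1 = "f (fst q) * f' (fst q) * h\<^sup>2 * fst b"
    let ?c2 = "(\<rho> (fst q) * snd b * k q - h * snd b * a1 (snd q)) / k q"
    have on': "\<alpha>2 (snd q) \<bullet> \<alpha>1 (snd q) = 0" "\<alpha>2 (snd q) \<bullet> \<alpha>2 (snd q) = 1"
      using on[OF qq(2)] by (simp_all add: inner_commute)
    have c1: "?c1 * h = fst b * h' + 2 * \<rho> (fst q) * fst b * h"
      by (simp add: h'_def algebra_simps power2_eq_square power3_eq_cube)
    have c2: "?c2 * k q = \<rho> (fst q) * snd b * k q - h * snd b * a1 (snd q)" using kq by simp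
    have "dd ?y q (?c1, ?c2) = (?c1, (?c1 * h) *\<^sub>R \<alpha>2 (snd q) + (?c2 * k q) *\<^sub>R \<alpha>1 (snd q))"
      unfolding dy[OF q] h_def by simp
    also have "\<dots> = cov_deriv g ?y q (1, 0) b"
      unfolding cov_deriv_eq[OF E(1) smy q yq] d2 dy[OF q] h_def[symmetric] fy c1 c2
      by (rule prod_eqI) (simp_all only: fst_conv snd_conv fst_add snd_add scaleR_one, simp_all add: vec_eq_iff algebra_simps on' power2_eq_square)
    finally have "cov_deriv g ?y q (1, 0) b = dd ?y q (?c1, ?c2)" by simp
    then show "cov_deriv g ?y q (1, 0) b \<in> tangent_space ?y q" unfolding tangent_space_def by simp
  qed
qed

lemma model_positive_nullity:
  assumes I: "is_interval I" and tl: "timelike_surface I f M x" and cyl: "locally_congruent_to_model I f M x"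
  shows "positive_relative_nullity f M x"
proof (rule positive_nullity_transfer[OF tl])
  fix p assume p: "p \<in> topspace M"
  obtain \<Phi> J a u0 v0 a1 a2 \<phi>1 \<phi>2 \<phi>3 \<alpha>1 \<alpha>2 \<alpha>3 E where iso: "isometry_on g L \<Phi>"
    and md: "model_data I J a u0 v0 a1 a2 \<phi>1 \<phi>2 \<phi>3 \<alpha>1 \<alpha>2 \<alpha>3"
    and E: "open E" "E \<subseteq> I \<times> J" "timelike_patch f E (model_surface f a u0 \<phi>1 \<phi>2 \<phi>3 \<alpha>1 \<alpha>2 \<alpha>3)"
    and near: "open_part_near M (\<Phi> \<circ> x) p E (model_surface f a u0 \<phi>1 \<phi>2 \<phi>3 \<alpha>1 \<alpha>2 \<alpha>3)"
    using cyl[unfolded locally_congruent_to_model_def, rule_format, OF p] by blast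
  obtain D \<sigma> where D: "D \<subseteq> E" "local_param M (\<Phi> \<circ> x) D \<sigma>" "p \<in> \<sigma> ` D"
    "\<And>q. q \<in> D \<Longrightarrow> (\<Phi> \<circ> x) (\<sigma> q) = model_surface f a u0 \<phi>1 \<phi>2 \<phi>3 \<alpha>1 \<alpha>2 \<alpha>3 q"
    using near unfolding open_part_near_def by blast
  have opD: "open D" using D(2) unfolding local_param_def by blast
  have "null_dir f (\<Phi> \<circ> x \<circ> \<sigma>) d (1, 0)" if "d \<in> D" for d
  proof -
    have "null_dir f (model_surface f a u0 \<phi>1 \<phi>2 \<phi>3 \<alpha>1 \<alpha>2 \<alpha>3) d (1, 0)"
      using model_null_dir[OF I md E] that D(1) by blast
    moreover have "(\<Phi> \<circ> x \<circ> \<sigma>) r = model_surface f a u0 \<phi>1 \<phi>2 \<phi>3 \<alpha>1 \<alpha>2 \<alpha>3 r" if "r \<in> D" for r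
      using D(4)[OF that] by simp
    ultimately show ?thesis using null_dir_cong[OF opD that] by blast
  qed
  then show "\<exists>\<Phi> D \<sigma>. isometry_on g L \<Phi> \<and> local_param M (\<Phi> \<circ> x) D \<sigma> \<and> p \<in> \<sigma> ` D \<and>
      (\<forall>d\<in>D. \<exists>a. a \<noteq> 0 \<and> null_dir f (\<Phi> \<circ> x \<circ> \<sigma>) d a)"
    using iso D(2,3)
    by (intro exI[of _ \<Phi>] exI[of _ D] exI[of _ \<sigma>] conjI ballI exI[of _ "(1, 0)"]) (simp_all add: zero_prod_def)
qed

end

section \<open>Surfaces of positive relative nullity\<close>

lemma dd_inner_smooth:
  assumes "smooth_on U A" "smooth_on U B" "q \<in> U"
  shows "dd (\<lambda>r. A r \<bullet> B r) q v = A q \<bullet> dd B q v + dd A q v \<bullet> B q"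
  by (rule dd_inner[OF smooth_on_differentiable[OF assms(1,3)] smooth_on_differentiable[OF assms(2,3)]])

lemma dd_mult_smooth:
  fixes A B :: "_ \<Rightarrow> real"
  assumes "smooth_on U A" "smooth_on U B" "q \<in> U"
  shows "dd (\<lambda>r. A r * B r) q v = A q * dd B q v + dd A q v * B q"
  by (rule dd_mult[OF smooth_on_differentiable[OF assms(1,3)] smooth_on_differentiable[OF assms(2,3)]])

lemma dd_scaleR_smooth:
  assumes "smooth_on U A" "smooth_on U B" "q \<in> U"
  shows "dd (\<lambda>r. A r *\<^sub>R B r) q v = A q *\<^sub>R dd B q v + dd A q v *\<^sub>R B q"
  by (rule dd_scaleR[OF smooth_on_differentiable[OF assms(1,3)] smooth_on_differentiable[OF assms(2,3)]])

lemma dd_add_smooth: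
  assumes "smooth_on U A" "smooth_on U B" "q \<in> U"
  shows "dd (\<lambda>r. A r + B r) q v = dd A q v + dd B q v"
  by (rule dd_add[OF smooth_on_differentiable[OF assms(1,3)] smooth_on_differentiable[OF assms(2,3)]])

lemma dd_fst_smooth: "smooth_on U A \<Longrightarrow> q \<in> U \<Longrightarrow> dd (\<lambda>r. fst (A r)) q v = fst (dd A q v)"
  by (rule dd_fst[OF smooth_on_differentiable])

lemma dd_snd_smooth: "smooth_on U A \<Longrightarrow> q \<in> U \<Longrightarrow> dd (\<lambda>r. snd (A r)) q v = snd (dd A q v)"
  by (rule dd_snd[OF smooth_on_differentiable])

lemma dd_eq_const:
  assumes "open U" "q \<in> U" "\<And>r. r \<in> U \<Longrightarrow> F r = c"
  shows "dd F q v = 0"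
  using dd_cong[OF assms(1,2), of F "\<lambda>r. c"] assms(3) by simp

text \<open>By the double cross product formula v is parallel to a x b, and it is also orthogonal to
  it.\<close>

lemma orthogonal_to_basis_eq_0:
  fixes v a b :: "real^3"
  assumes "v \<bullet> a = 0" "v \<bullet> b = 0" "v \<bullet> cross3 a b = 0" "cross3 a b \<noteq> 0"
  shows "v = 0"
proof -
  have "cross3 v (cross3 a b) = 0" unfolding Lagrange using assms(1,2) by simp
  then have "(norm v * norm (cross3 a b))\<^sup>2 = 0" using norm_cross_dot[of v "cross3 a b"] assms(3) by simp
  then show ?thesis using assms(4) by simp
qed

text \<open>The complement of m and n is the line of m x n. It is first shown that this vector is a
  multiple of P; then the part of u orthogonal to P is orthogonal to m, n and m x n.\<close>

lemma orthogonal_complement_line: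
  fixes u P m n :: "real^3"
  assumes "P \<noteq> 0" "m \<noteq> 0" "n \<noteq> 0" "m \<bullet> n = 0" "P \<bullet> m = 0" "P \<bullet> n = 0" "u \<bullet> m = 0" "u \<bullet> n = 0"
  obtains c where "u = c *\<^sub>R P"
proof -
  let ?K = "cross3 m n"
  have K: "?K \<noteq> 0" using norm_cross_dot[of m n] assms(2-4) by auto
  have mK: "m \<bullet> ?K = 0" "n \<bullet> ?K = 0" by (simp_all add: dot_cross_self)
  have "(P \<bullet> P) *\<^sub>R ?K - (?K \<bullet> P) *\<^sub>R P = 0"
  proof (rule orthogonal_to_basis_eq_0[OF _ _ _ K])
    have "cross3 P ?K = 0" unfolding Lagrange using assms(5,6) by simp
    then have "(P \<bullet> ?K)\<^sup>2 = (norm P * norm ?K)\<^sup>2" using norm_cross_dot[of P ?K] by simp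
    moreover have "(norm P * norm ?K)\<^sup>2 = (P \<bullet> P) * (?K \<bullet> ?K)"
      by (simp add: power_mult_distrib power2_norm_eq_inner)
    moreover have "((P \<bullet> P) *\<^sub>R ?K - (?K \<bullet> P) *\<^sub>R P) \<bullet> ?K = (P \<bullet> P) * (?K \<bullet> ?K) - (P \<bullet> ?K)\<^sup>2"
      by (simp add: inner_diff_left power2_eq_square inner_commute[of ?K P])
    ultimately show "((P \<bullet> P) *\<^sub>R ?K - (?K \<bullet> P) *\<^sub>R P) \<bullet> ?K = 0" by simp
    show "((P \<bullet> P) *\<^sub>R ?K - (?K \<bullet> P) *\<^sub>R P) \<bullet> m = 0" "((P \<bullet> P) *\<^sub>R ?K - (?K \<bullet> P) *\<^sub>R P) \<bullet> n = 0"
      using assms(5,6) mK by (simp_all add: inner_diff_left inner_commute[of ?K])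
  qed
  define c where "c = (u \<bullet> P) / (P \<bullet> P)"
  have PP: "P \<bullet> P \<noteq> 0" using assms(1) by simp
  have uP: "(u - c *\<^sub>R P) \<bullet> P = 0" unfolding c_def using PP by (simp add: inner_diff_left)
  have "u - c *\<^sub>R P = 0"
  proof (rule orthogonal_to_basis_eq_0[OF _ _ _ K])
    show "(u - c *\<^sub>R P) \<bullet> m = 0" "(u - c *\<^sub>R P) \<bullet> n = 0"
      using assms(5-8) by (simp_all add: inner_diff_left)
    have "(P \<bullet> P) * ((u - c *\<^sub>R P) \<bullet> ?K) = (u - c *\<^sub>R P) \<bullet> ((P \<bullet> P) *\<^sub>R ?K)" by simp
    also have "\<dots> = (?K \<bullet> P) * ((u - c *\<^sub>R P) \<bullet> P)"
      using \<open>(P \<bullet> P) *\<^sub>R ?K - (?K \<bullet> P) *\<^sub>R P = 0\<close> by simp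
    finally show "(u - c *\<^sub>R P) \<bullet> ?K = 0" using uP PP by simp
  qed
  then show ?thesis using that[of c] by simp
qed

abbreviation e1 :: "real \<times> real" where "e1 \<equiv> (1, 0)"
abbreviation e2 :: "real \<times> real" where "e2 \<equiv> (0, 1)"

section \<open>The gradient field on a time-like patch\<close>

locale patch = rw +
  fixes V :: "(real \<times> real) set" and y :: "real \<times> real \<Rightarrow> spacetime"
  assumes opV: "open V" and smy: "smooth_on V y" and yL: "y ` V \<subseteq> L"
    and injy: "\<And>q. q \<in> V \<Longrightarrow> inj (dd y q)"
    and lor: "\<And>q. q \<in> V \<Longrightarrow> lorentzian_plane g (y q) (tangent_space y q)"
begin

abbreviation t :: "real \<times> real \<Rightarrow> real" where "t q \<equiv> fst (y q)"
abbreviation p :: "real \<times> real \<Rightarrow> real^3" where "p q \<equiv> snd (y q)"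
abbreviation tt :: "real \<times> real \<Rightarrow> real \<times> real \<Rightarrow> real" where "tt q b \<equiv> fst (dd y q b)"
abbreviation pp :: "real \<times> real \<Rightarrow> real \<times> real \<Rightarrow> real^3" where "pp q b \<equiv> snd (dd y q b)"
abbreviation d2 :: "real \<times> real \<Rightarrow> real \<times> real \<Rightarrow> real \<times> real \<Rightarrow> spacetime" where
  "d2 q a b \<equiv> dd (\<lambda>r. dd y r b) q a"

lemma tI: "q \<in> V \<Longrightarrow> t q \<in> I" using yL L_iff by blast

lemma yqL: "q \<in> V \<Longrightarrow> y q \<in> L" using yL by blast

lemma fq: "q \<in> V \<Longrightarrow> f (t q) \<noteq> 0" using tI fnz by blast

lemma lin: "q \<in> V \<Longrightarrow> linear (dd y q)" by (rule smooth_on_linear_dd[OF smy])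

lemma dd_R2: "q \<in> V \<Longrightarrow> dd y q b = fst b *\<^sub>R dd y q e1 + snd b *\<^sub>R dd y q e2"
  by (rule linear_R2[OF lin])

lemma tt_R2: "q \<in> V \<Longrightarrow> tt q b = fst b * tt q e1 + snd b * tt q e2"
  by (subst dd_R2) simp_all

lemma pp_R2: "q \<in> V \<Longrightarrow> pp q b = fst b *\<^sub>R pp q e1 + snd b *\<^sub>R pp q e2"
  by (subst dd_R2) simp_all

lemma d2_sym: "q \<in> V \<Longrightarrow> d2 q a b = d2 q b a"
  by (rule second_derivative_symmetric[OF opV smy])

lemma sm_t: "smooth_on V t" by (rule smooth_on_fst[OF opV smy])
lemma sm_p: "smooth_on V p" by (rule smooth_on_snd[OF opV smy])
lemma sm_tt: "smooth_on V (\<lambda>r. tt r b)" by (rule smooth_on_fst[OF opV smooth_on_dd[OF smy]])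
lemma sm_pp: "smooth_on V (\<lambda>r. pp r b)" by (rule smooth_on_snd[OF opV smooth_on_dd[OF smy]])

lemma sm_of_t:
  assumes "smooth_on I h" shows "smooth_on V (\<lambda>r. h (t r))"
  by (rule smooth_on_compose[OF opV opI assms sm_t]) (use tI in auto)

lemma dd_of_t:
  assumes "(h has_real_derivative h') (at (t q))" "q \<in> V"
  shows "dd (\<lambda>r. h (t r)) q v = h' * tt q v"
proof -
  have "((\<lambda>r. h (t r)) has_derivative (\<lambda>v. h' * tt q v)) (at q)"
    using has_derivative_compose[OF has_derivative_fst[OF smooth_on_has_derivative[OF smy assms(2)]]]
      assms(1) unfolding has_field_derivative_def by blast
  then show ?thesis by (rule dd_eqI)
qed

lemma dd_tt: "q \<in> V \<Longrightarrow> dd (\<lambda>r. tt r b) q v = fst (d2 q v b)"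
  by (rule dd_fst_smooth[OF smooth_on_dd[OF smy]])

lemma dd_pp: "q \<in> V \<Longrightarrow> dd (\<lambda>r. pp r b) q v = snd (d2 q v b)"
  by (rule dd_snd_smooth[OF smooth_on_dd[OF smy]])

text \<open>\<open>X\<close> is given by Cramer's rule for \<open>gm q (X q) b = - tt q b\<close>, so that \<open>dy(X) = T\<close>; the components
  of \<open>T\<close> are \<open>s\<close> and \<open>Tb\<close>.\<close>

definition "gm q a b = - (tt q a * tt q b) + (f (t q))\<^sup>2 * (pp q a \<bullet> pp q b)"
definition "\<Delta> q = gm q e1 e1 * gm q e2 e2 - (gm q e1 e2)\<^sup>2"
definition "X q = ((tt q e2 * gm q e1 e2 - tt q e1 * gm q e2 e2) / \<Delta> q,
  (tt q e1 * gm q e1 e2 - tt q e2 * gm q e1 e1) / \<Delta> q)"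
definition "N q = cross3 (pp q e1) (pp q e2)"
definition "s q = tt q (X q)"
definition "Tb q = pp q (X q)"

lemma gm_eq: "gm q a b = g (y q) (dd y q a) (dd y q b)"
  unfolding gm_def rw_metric_def by simp

lemma gm_R2: "q \<in> V \<Longrightarrow> gm q a b = fst a * gm q e1 b + snd a * gm q e2 b"
  unfolding gm_eq by (subst dd_R2[of q a]) (simp_all add: rw_metric_simps(1,5))

lemma gm_sym: "gm q a b = gm q b a" unfolding gm_eq by (rule rw_metric_simps(7))

text \<open>In a basis of signature (-, +) the Gram determinant is minus the square of the
  determinant of the change of basis.\<close>

lemma \<Delta>_neg:
  assumes q: "q \<in> V"
  shows "\<Delta> q < 0"
proof -
  let ?g = "g (y q)"
  obtain x1 x2 where x: "tangent_space y q = span {x1, x2}" "?g x1 x1 = -1" "?g x1 x2 = 0" "?g x2 x2 = 1"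
    using lor[OF q] unfolding lorentzian_plane_def by blast
  have x21: "?g x2 x1 = 0" using x(3) rw_metric_simps(7)[of f "y q" x1 x2] by simp
  have mem: "\<exists>a b. dd y q v = a *\<^sub>R x1 + b *\<^sub>R x2" for v
  proof -
    have "dd y q v \<in> span {x1, x2}" unfolding x(1)[symmetric] tangent_space_def by blast
    then show ?thesis by (simp add: span_breakdown_eq diff_diff_eq)
  qed
  obtain a b where ab: "dd y q e1 = a *\<^sub>R x1 + b *\<^sub>R x2" using mem by blast
  obtain c d where cd: "dd y q e2 = c *\<^sub>R x1 + d *\<^sub>R x2" using mem by blast
  have inj: "v = 0" if "dd y q v = 0" for v
    using injD[OF injy[OF q], of v 0] that linear_0[OF lin[OF q]] by simp
  have "a * d - b * c \<noteq> 0"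
  proof
    assume z: "a * d - b * c = 0"
    have "dd y q (d, - b) = (a * d - b * c) *\<^sub>R x1" "dd y q (c, - a) = (b * c - a * d) *\<^sub>R x2"
      by (subst dd_R2[OF q], simp add: ab cd algebra_simps)+
    then have "(d, - b) = 0" "(c, - a) = 0" using z inj by auto
    then have "dd y q e1 = 0" using ab by (simp add: zero_prod_def)
    then show False using inj[of e1] by (simp add: zero_prod_def)
  qed
  moreover have "\<Delta> q = - (a * d - b * c)\<^sup>2"
    unfolding \<Delta>_def gm_eq ab cd
    by (simp add: rw_metric_simps(1,2,5,6) x x21 power2_eq_square algebra_simps)
  ultimately show ?thesis by simp
qed

lemma gm_X:
  assumes q: "q \<in> V"
  shows "gm q (X q) b = - tt q b"
proof -
  have "\<Delta> q \<noteq> 0" using \<Delta>_neg[OF q] by simp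
  then have "gm q (X q) e1 = - tt q e1" "gm q (X q) e2 = - tt q e2"
    unfolding gm_R2[OF q, of "X q"] gm_sym[of q e2 e1] unfolding X_def
    by (simp_all add: field_simps) (simp_all add: \<Delta>_def power2_eq_square algebra_simps)
  then show ?thesis
    unfolding gm_sym[of q "X q"] by (simp add: gm_R2[OF q, of b] tt_R2[OF q, of b])
qed

text \<open>The spatial form of \<open>gm_X\<close>. Division by s - 1 gives the vector dual to dt /
  f^2, hence the later choice of \<open>w\<close>.\<close>

lemma Tb_pp: "q \<in> V \<Longrightarrow> (f (t q))\<^sup>2 * (Tb q \<bullet> pp q b) = (s q - 1) * tt q b"
  using gm_X[of q b] unfolding gm_def s_def Tb_def by (simp add: algebra_simps)

lemma norm_N: "(norm (N q))\<^sup>2 = (pp q e1 \<bullet> pp q e1) * (pp q e2 \<bullet> pp q e2) - (pp q e1 \<bullet> pp q e2)\<^sup>2"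
  unfolding N_def using norm_cross_dot[of "pp q e1" "pp q e2"]
  by (simp add: power_mult_distrib power2_norm_eq_inner)

text \<open>Since <T, T> = -s and <d/dt, d/dt> = -1, the number s - 1 is <eta, eta>. The formula
  shows that it is nonnegative and vanishes exactly where \<open>N\<close> does, that is, where d/dt
  is tangent.\<close>

lemma s_eq:
  assumes q: "q \<in> V"
  shows "s q - 1 = (f (t q))^4 * (norm (N q))\<^sup>2 / (- \<Delta> q)"
proof -
  have d: "\<Delta> q \<noteq> 0" using \<Delta>_neg[OF q] by simp
  have "s q * \<Delta> q = tt q e1 * (tt q e2 * gm q e1 e2 - tt q e1 * gm q e2 e2)
      + tt q e2 * (tt q e1 * gm q e1 e2 - tt q e2 * gm q e1 e1)"
    unfolding s_def tt_R2[OF q, of "X q"] unfolding X_def using d by (simp add: field_simps)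
  then have "(s q - 1) * \<Delta> q = - ((f (t q))^4 * (norm (N q))\<^sup>2)"
    unfolding norm_N left_diff_distrib
    unfolding \<Delta>_def gm_def by (simp add: power4_eq_xxxx power2_eq_square algebra_simps inner_commute)
  then show ?thesis using d by (simp add: field_simps)
qed

lemma s_ge_1:
  assumes "q \<in> V" shows "s q \<ge> 1"
proof -
  have "(f (t q))^4 * (norm (N q))\<^sup>2 / (- \<Delta> q) \<ge> 0"
    using \<Delta>_neg[OF assms] by (intro divide_nonneg_pos mult_nonneg_nonneg) simp_all
  then show ?thesis using s_eq[OF assms] by simp
qed

lemma s_eq_1_iff: "q \<in> V \<Longrightarrow> s q = 1 \<longleftrightarrow> N q = 0"
  using s_eq[of q] \<Delta>_neg[of q] fq[of q] by auto

lemma sm_gm: "smooth_on V (\<lambda>q. gm q a b)"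
  unfolding gm_def
  by (intro smooth_on_add smooth_on_minus smooth_on_mult smooth_on_power smooth_on_inner sm_tt sm_pp sm_of_t smf opV)

lemma sm_X: "smooth_on V X"
proof -
  have "\<Delta> q \<noteq> 0" if "q \<in> V" for q using \<Delta>_neg[OF that] by simp
  then have "smooth_on V (\<lambda>q. X q)"
    unfolding X_def \<Delta>_def
    by (intro smooth_on_Pair smooth_on_divide smooth_on_diff smooth_on_mult smooth_on_power sm_gm sm_tt opV) auto
  then show ?thesis by simp
qed

lemma sm_field:
  assumes "open U" "U \<subseteq> V" "smooth_on U \<xi>"
  shows "smooth_on U (\<lambda>q. dd y q (\<xi> q))"
proof (rule smooth_on_cong[OF assms(1)])
  show "smooth_on U (\<lambda>q. fst (\<xi> q) *\<^sub>R dd y q e1 + snd (\<xi> q) *\<^sub>R dd y q e2)"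
    by (intro smooth_on_add smooth_on_scaleR smooth_on_fst smooth_on_snd assms(1,3)
        smooth_on_subset[OF smooth_on_dd[OF smy] assms(2)])
  show "fst (\<xi> q) *\<^sub>R dd y q e1 + snd (\<xi> q) *\<^sub>R dd y q e2 = dd y q (\<xi> q)" if "q \<in> U" for q
    using dd_R2[of q "\<xi> q"] that assms(2) by auto
qed

lemma dd_field:
  assumes "open U" "U \<subseteq> V" "smooth_on U \<xi>" "q \<in> U"
  shows "dd (\<lambda>q. dd y q (\<xi> q)) q b = d2 q b (\<xi> q) + dd y q (dd \<xi> q b)"
  using dd_dd_apply[OF opV smy assms(1) smooth_on_ident _ assms(3,4), of b] assms(2) by simp

lemma sm_s: "smooth_on V s"
  unfolding s_def by (rule smooth_on_fst[OF opV sm_field[OF opV subset_refl sm_X]])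

lemma sm_Tb: "smooth_on V Tb"
  unfolding Tb_def by (rule smooth_on_snd[OF opV sm_field[OF opV subset_refl sm_X]])

lemma sm_N: "smooth_on V N"
  unfolding N_def by (intro smooth_on_cross3 opV sm_pp)

lemma X_nz: "q \<in> V \<Longrightarrow> X q \<noteq> 0"
proof
  assume q: "q \<in> V" and "X q = 0"
  then have "s q = 0" unfolding s_def using linear_0[OF lin[OF q]] by simp
  then show False using s_ge_1[OF q] by simp
qed

lemma cov_eq:
  assumes "q \<in> V"
  shows "cov_deriv g y q a b = (fst (d2 q a b) + f (t q) * f' (t q) * (pp q a \<bullet> pp q b),
     snd (d2 q a b) + \<rho> (t q) *\<^sub>R (tt q a *\<^sub>R pp q b + tt q b *\<^sub>R pp q a))"
  unfolding cov_deriv_eq[OF opV smy assms yqL[OF assms]] using d2_sym[OF assms, of a b]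
  by (simp add: prod_eq_iff)

section \<open>Null directions and the normal frame\<close>

lemma null_dir_scale:
  assumes "q \<in> V" "null_dir f y q a"
  shows "null_dir f y q (c *\<^sub>R a)"
  unfolding null_dir_def
proof
  fix b
  have l: "linear (dd (\<lambda>r. dd y r b) q)" using smooth_on_linear_dd[OF smooth_on_dd[OF smy] assms(1)] .
  have "cov_deriv g y q (c *\<^sub>R a) b = c *\<^sub>R cov_deriv g y q a b"
    unfolding cov_eq[OF assms(1)] linear_scale[OF l] linear_scale[OF lin[OF assms(1)]]
    by (simp add: algebra_simps)
  moreover obtain v where "cov_deriv g y q a b = dd y q v"
    using assms(2) unfolding null_dir_def tangent_space_def by blast
  ultimately have "cov_deriv g y q (c *\<^sub>R a) b = dd y q (c *\<^sub>R v)" using linear_scale[OF lin[OF assms(1)]] by simp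
  then show "cov_deriv g y q (c *\<^sub>R a) b \<in> tangent_space y q" unfolding tangent_space_def by simp
qed

text \<open>The conditions on n and w say that (0, n) and (1, w) are normal to the surface. The
  conclusions say that the covariant derivative has no component along either of them.\<close>

lemma null_dir_normal:
  assumes q: "q \<in> V" and null: "null_dir f y q a"
  shows "(\<And>b. n \<bullet> pp q b = 0) \<Longrightarrow> n \<bullet> snd (d2 q a b) = 0"
    and "(\<And>b. (f (t q))\<^sup>2 * (w \<bullet> pp q b) = tt q b) \<Longrightarrow>
      fst (d2 q a b) + f (t q) * f' (t q) * (pp q a \<bullet> pp q b)
        = (f (t q))\<^sup>2 * (w \<bullet> snd (d2 q a b)) + 2 * \<rho> (t q) * tt q a * tt q b"
proof -
  obtain c where c: "cov_deriv g y q a b = dd y q c"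
    using null unfolding null_dir_def tangent_space_def by blast
  then have c1: "fst (d2 q a b) + f (t q) * f' (t q) * (pp q a \<bullet> pp q b) = tt q c"
    and c2: "snd (d2 q a b) + \<rho> (t q) *\<^sub>R (tt q a *\<^sub>R pp q b + tt q b *\<^sub>R pp q a) = pp q c"
    unfolding cov_eq[OF q] by (metis fst_conv, metis snd_conv)
  {
    assume n: "\<And>b. n \<bullet> pp q b = 0"
    have "n \<bullet> (snd (d2 q a b) + \<rho> (t q) *\<^sub>R (tt q a *\<^sub>R pp q b + tt q b *\<^sub>R pp q a)) = 0"
      unfolding c2 by (rule n)
    then show "n \<bullet> snd (d2 q a b) = 0" by (simp add: inner_add_right n)
  next
    assume w: "\<And>b. (f (t q))\<^sup>2 * (w \<bullet> pp q b) = tt q b"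
    have "(f (t q))\<^sup>2 * (w \<bullet> (snd (d2 q a b) + \<rho> (t q) *\<^sub>R (tt q a *\<^sub>R pp q b + tt q b *\<^sub>R pp q a))) = tt q c"
      unfolding c2 by (rule w)
    then have "(f (t q))\<^sup>2 * (w \<bullet> snd (d2 q a b)) + \<rho> (t q) * tt q a * ((f (t q))\<^sup>2 * (w \<bullet> pp q b))
        + \<rho> (t q) * tt q b * ((f (t q))\<^sup>2 * (w \<bullet> pp q a)) = tt q c"
      by (simp add: inner_add_right algebra_simps)
    then show "fst (d2 q a b) + f (t q) * f' (t q) * (pp q a \<bullet> pp q b)
        = (f (t q))\<^sup>2 * (w \<bullet> snd (d2 q a b)) + 2 * \<rho> (t q) * tt q a * tt q b"
      unfolding w c1[symmetric] by simp
  }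
qed

definition "n q = N q /\<^sub>R norm (N q)"
definition "w q = Tb q /\<^sub>R (s q - 1)"

lemma n_pp: "q \<in> V \<Longrightarrow> n q \<bullet> pp q b = 0"
  by (subst pp_R2) (simp_all add: n_def N_def inner_add_right dot_cross_self)

lemma w_pp:
  assumes "q \<in> V" "N q \<noteq> 0"
  shows "(f (t q))\<^sup>2 * (w q \<bullet> pp q b) = tt q b"
  using Tb_pp[OF assms(1), of b] s_eq_1_iff[OF assms(1)] assms(2) unfolding w_def by (simp add: field_simps)

lemma n_w: "q \<in> V \<Longrightarrow> n q \<bullet> w q = 0"
  unfolding w_def Tb_def by (simp add: n_pp)

lemma n_n: "N q \<noteq> 0 \<Longrightarrow> n q \<bullet> n q = 1"
  unfolding n_def by (simp add: power2_norm_eq_inner[symmetric] power2_eq_square)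

lemma normal_frame_eq_0:
  assumes "q \<in> V" "N q \<noteq> 0" "v \<bullet> pp q e1 = 0" "v \<bullet> pp q e2 = 0" "v \<bullet> n q = 0"
  shows "v = 0"
  using orthogonal_to_basis_eq_0[of v "pp q e1" "pp q e2"] assms unfolding N_def[symmetric] n_def by simp

lemma pp_inj:
  assumes "q \<in> V" "N q \<noteq> 0" "pp q a = 0"
  shows "a = 0"
proof -
  have "fst a *\<^sub>R pp q e1 + snd a *\<^sub>R pp q e2 = 0" using pp_R2[OF assms(1), of a] assms(3) by simp
  then have "cross3 (fst a *\<^sub>R pp q e1 + snd a *\<^sub>R pp q e2) (pp q e2) = 0"
    "cross3 (pp q e1) (fst a *\<^sub>R pp q e1 + snd a *\<^sub>R pp q e2) = 0" by simp_all
  then have "fst a *\<^sub>R N q = 0" "snd a *\<^sub>R N q = 0"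
    unfolding N_def by (simp_all add: cross_add_left cross_add_right cross_mult_left cross_mult_right)
  then show ?thesis using assms(2) by (simp add: prod_eq_iff)
qed

lemma
  assumes U: "open U" "U \<subseteq> V" and NU: "\<And>q. q \<in> U \<Longrightarrow> N q \<noteq> 0"
  shows sm_n: "smooth_on U n" and sm_w: "smooth_on U w"
proof -
  note sub = smooth_on_subset[OF _ U(2)]
  have "smooth_on U (\<lambda>q. inverse (norm (N q)) *\<^sub>R N q)"
    using NU by (intro smooth_on_scaleR smooth_on_inverse smooth_on_norm U(1) sub[OF sm_N]) auto
  then show "smooth_on U n" unfolding n_def .
  have "s q - 1 \<noteq> 0" if "q \<in> U" for q using NU[OF that] s_eq_1_iff[of q] that U(2) by auto
  then have "smooth_on U (\<lambda>q. inverse (s q - 1) *\<^sub>R Tb q)"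
    by (intro smooth_on_scaleR smooth_on_inverse smooth_on_diff smooth_on_const U(1) sub[OF sm_Tb] sub[OF sm_s]) auto
  then show "smooth_on U w" unfolding w_def .
qed

text \<open>\<open>(0, n)\<close> and \<open>(1, w)\<close> span the normal planes. In the direction of a relative null vector field
  \<open>\<xi>\<close> the projection \<open>p\<close> to \<open>\<real>\<^sup>3\<close> has constant unit normal, that is, \<open>p\<close> is developable.\<close>

lemma null_field_derivatives:
  assumes U: "open U" "U \<subseteq> V" and NU: "\<And>q. q \<in> U \<Longrightarrow> N q \<noteq> 0"
    and null: "null_dir f y q a" and q: "q \<in> U"
  shows "dd n q a = 0" "dd n q b \<bullet> pp q a = 0" "dd w q a = - \<rho> (t q) *\<^sub>R pp q a"
    "pp q a \<bullet> dd w q b = - \<rho> (t q) * (pp q a \<bullet> pp q b)"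
proof -
  have qV: "q \<in> V" using q U(2) by blast
  note sub = smooth_on_subset[OF _ U(2)]
  have smn: "smooth_on U n" and smw: "smooth_on U w" using sm_n[OF U] sm_w[OF U] NU by blast+
  have n_diff: "dd n q v \<bullet> pp q b + n q \<bullet> snd (d2 q v b) = 0" for v b
  proof -
    have "dd (\<lambda>r. n r \<bullet> pp r b) q v = 0"
      by (rule dd_eq_const[OF U(1) q]) (use n_pp U(2) in blast)
    moreover have "dd (\<lambda>r. n r \<bullet> pp r b) q v = n q \<bullet> dd (\<lambda>r. pp r b) q v + dd n q v \<bullet> pp q b"
      by (rule dd_inner_smooth[OF smn sub[OF sm_pp] q])
    ultimately show ?thesis unfolding dd_pp[OF qV] by simp
  qed
  have n_n_diff: "dd n q v \<bullet> n q = 0" for v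
  proof -
    have "dd (\<lambda>r. n r \<bullet> n r) q v = 0"
      by (rule dd_eq_const[OF U(1) q]) (use n_n NU in blast)
    then show ?thesis using dd_inner_smooth[OF smn smn q, of v] by (simp add: inner_commute)
  qed
  have A: "n q \<bullet> snd (d2 q a b) = 0" for b by (rule null_dir_normal(1)[OF qV null n_pp[OF qV]])
  show n0: "dd n q a = 0"
    by (rule normal_frame_eq_0[OF qV NU[OF q]])
       (use n_diff[of a e1] n_diff[of a e2] A[of e1] A[of e2] n_n_diff[of a] in simp_all)
  \<comment> \<open>By \<open>n_diff\<close> this pairing is minus n times the second derivative in
    the directions b and a; exchanging the directions reduces it to \<open>A\<close>.\<close>
  show "dd n q b \<bullet> pp q a = 0" for b
    using n_diff[of b a] A[of b] d2_sym[OF qV, of a b] by simp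
  let ?F = "f (t q)"
  have smff: "smooth_on U (\<lambda>r. (f (t r))\<^sup>2)" by (rule sub[OF smooth_on_power[OF opV sm_of_t[OF smf]]])
  have dff: "dd (\<lambda>r. (f (t r))\<^sup>2) q v = 2 * ?F * f' (t q) * tt q v" for v
  proof (rule dd_of_t[OF _ qV])
    show "((\<lambda>t. (f t)\<^sup>2) has_real_derivative 2 * ?F * f' (t q)) (at (t q))"
      by (rule DERIV_cong, (rule derivative_eq_intros f_deriv[OF tI[OF qV]] refl)+) simp
  qed
  have w_diff: "2 * ?F * f' (t q) * tt q v * (w q \<bullet> pp q b) + ?F\<^sup>2 * (dd w q v \<bullet> pp q b + w q \<bullet> snd (d2 q v b))
      = fst (d2 q v b)" for v b
  proof -
    have "dd (\<lambda>r. (f (t r))\<^sup>2 * (w r \<bullet> pp r b)) q v = dd (\<lambda>r. tt r b) q v"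
    proof -
      have "dd (\<lambda>r. (f (t r))\<^sup>2 * (w r \<bullet> pp r b)) q = dd (\<lambda>r. tt r b) q"
        by (rule dd_cong[OF U(1) q]) (use w_pp NU U(2) in blast)
      then show ?thesis by simp
    qed
    moreover have "dd (\<lambda>r. (f (t r))\<^sup>2 * (w r \<bullet> pp r b)) q v
        = ?F\<^sup>2 * dd (\<lambda>r. w r \<bullet> pp r b) q v + dd (\<lambda>r. (f (t r))\<^sup>2) q v * (w q \<bullet> pp q b)"
      by (rule dd_mult_smooth[OF smff smooth_on_inner[OF U(1) smw sub[OF sm_pp]] q])
    moreover have "dd (\<lambda>r. w r \<bullet> pp r b) q v = w q \<bullet> dd (\<lambda>r. pp r b) q v + dd w q v \<bullet> pp q b"
      by (rule dd_inner_smooth[OF smw sub[OF sm_pp] q])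
    ultimately show ?thesis
      unfolding dd_tt[OF qV] dd_pp[OF qV] dff by (simp add: algebra_simps)
  qed
  have F0: "?F \<noteq> 0" by (rule fq[OF qV])
  have W: "w q \<bullet> pp q b = tt q b / ?F\<^sup>2" for b using w_pp[OF qV NU[OF q], of b] F0 by (simp add: field_simps)
  have key: "dd w q a \<bullet> pp q b = - \<rho> (t q) * (pp q a \<bullet> pp q b)" for b
  proof -
    have "2 * ?F * f' (t q) * tt q a * (w q \<bullet> pp q b) = 2 * \<rho> (t q) * tt q a * tt q b"
      unfolding W \<rho>_def using F0 by (simp add: field_simps power2_eq_square)
    then have "?F\<^sup>2 * (dd w q a \<bullet> pp q b) = - (?F * f' (t q) * (pp q a \<bullet> pp q b))"
      using w_diff[of a b, unfolded distrib_left] null_dir_normal(2)[OF qV null w_pp[OF qV NU[OF q]], of b]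
      unfolding mult.assoc by linarith
    then have "?F * (?F * (dd w q a \<bullet> pp q b) + f' (t q) * (pp q a \<bullet> pp q b)) = 0"
      unfolding power2_eq_square distrib_left mult.assoc by linarith
    then have "?F * (dd w q a \<bullet> pp q b) = - (f' (t q) * (pp q a \<bullet> pp q b))" using F0 by simp
    then show ?thesis unfolding \<rho>_def using F0 by (simp add: field_simps)
  qed
  have "dd w q a + \<rho> (t q) *\<^sub>R pp q a = 0"
  proof (rule normal_frame_eq_0[OF qV NU[OF q]])
    have "dd (\<lambda>r. n r \<bullet> w r) q a = 0" by (rule dd_eq_const[OF U(1) q]) (use n_w U(2) in blast)
    then have "n q \<bullet> dd w q a = 0" using dd_inner_smooth[OF smn smw q, of a] n0 by simp
    then show "(dd w q a + \<rho> (t q) *\<^sub>R pp q a) \<bullet> n q = 0" using n_pp[OF qV, of a]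
      by (simp add: inner_add_left inner_add_right inner_commute)
  qed (simp_all add: key inner_add_left)
  then show "dd w q a = - \<rho> (t q) *\<^sub>R pp q a" by (simp add: eq_neg_iff_add_eq_0)
  \<comment> \<open>\<open>w_diff\<close> is symmetric in v and b apart from the term with dw, so dw
    is self-adjoint along p. This turns information on dw(a) into information on the pairing of
    dw(b) with pp a.\<close>
  have sym: "dd w q v \<bullet> pp q b = dd w q b \<bullet> pp q v" for v b
  proof -
    have "2 * ?F * f' (t q) * tt q v * (w q \<bullet> pp q b) = 2 * ?F * f' (t q) * tt q b * (w q \<bullet> pp q v)"
      unfolding W by simp
    then have "?F\<^sup>2 * (dd w q v \<bullet> pp q b) = ?F\<^sup>2 * (dd w q b \<bullet> pp q v)"
      using w_diff[of v b, unfolded distrib_left] w_diff[of b v, unfolded distrib_left d2_sym[OF qV, of v b]]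
      by linarith
    then show ?thesis using F0 by simp
  qed
  show "pp q a \<bullet> dd w q b = - \<rho> (t q) * (pp q a \<bullet> pp q b)" for b
    using key[of b] sym[of a b] by (simp add: inner_commute)
qed

text \<open>Let P = dp(xi) and omega = dw + rho dp, a vector-valued one-form. By
  \<open>null_field_derivatives\<close>, omega kills xi and is orthogonal to P. Where dn is nonzero,
  dP(xi) is a multiple of P (the rulings are straight), so dP wedge omega = 0. Since d omega = rho'
  dt wedge dp, pairing with P leaves rho' dt wedge <P, dp> = 0, and rho' is nonzero. By
  \<open>Tb_pp\<close>, dt is a multiple of <Tb, dp> and conversely, hence X and xi are
  parallel.\<close>

lemma null_field_parallel:
  assumes U: "open U" "U \<subseteq> V" and NU: "\<And>q. q \<in> U \<Longrightarrow> N q \<noteq> 0"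
    and sm: "smooth_on U \<xi>" and null: "\<And>q. q \<in> U \<Longrightarrow> null_dir f y q (\<xi> q)"
    and q: "q \<in> U" and \<xi>q: "\<xi> q \<noteq> 0" and b0: "dd n q b0 \<noteq> 0"
    and curv: "deriv f' (t q) / f (t q) - (f' (t q))\<^sup>2 / (f (t q))\<^sup>2 \<noteq> 0"
  shows "fst (X q) * snd (\<xi> q) - snd (X q) * fst (\<xi> q) = 0"
proof -
  have UV: "r \<in> V" if "r \<in> U" for r using that U(2) by blast
  have qV: "q \<in> V" by (rule UV[OF q])
  note sub = smooth_on_subset[OF _ U(2)]
  have smn: "smooth_on U n" and smw: "smooth_on U w" using sm_n[OF U] sm_w[OF U] NU by blast+
  have nd: "dd n r (\<xi> r) = 0" "dd n r b \<bullet> pp r (\<xi> r) = 0" "dd w r (\<xi> r) = - \<rho> (t r) *\<^sub>R pp r (\<xi> r)"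
    "pp r (\<xi> r) \<bullet> dd w r b = - \<rho> (t r) * (pp r (\<xi> r) \<bullet> pp r b)" if "r \<in> U" for r b
    using null_field_derivatives[OF U _ null[OF that] that] NU by blast+
  define P where "P r = pp r (\<xi> r)" for r
  have smP: "smooth_on U P" unfolding P_def by (rule smooth_on_snd[OF U(1) sm_field[OF U sm]])
  have P0: "P q \<noteq> 0" using pp_inj[OF qV NU[OF q]] \<xi>q unfolding P_def by blast
  have Pn: "P q \<bullet> n q = 0" unfolding P_def using n_pp[OF qV] by (simp add: inner_commute)
  have dPn: "dd P q (\<xi> q) \<bullet> n q = 0"
  proof -
    have "dd (\<lambda>r. P r \<bullet> n r) q (\<xi> q) = 0"
      by (rule dd_eq_const[OF U(1) q]) (simp add: P_def n_pp[OF UV] inner_commute)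
    then show ?thesis using dd_inner_smooth[OF smP smn q, of "\<xi> q"] nd(1)[OF q] by simp
  qed
  have dnP: "dd n r b \<bullet> P r = 0" if "r \<in> U" for r b unfolding P_def by (rule nd(2)[OF that])
  \<comment> \<open>Differentiates dn(xi) = 0. The derivative of xi contributes only a value of dn,
    which is orthogonal to P.\<close>
  have ddn: "dd (\<lambda>r. dd n r b) q (\<xi> q) \<bullet> P q = 0" for b
  proof -
    have "dd (\<lambda>r. dd n r (\<xi> r)) q b = 0"
      by (rule dd_eq_const[OF U(1) q]) (rule nd(1))
    moreover have "dd (\<lambda>r. dd n r (\<xi> r)) q b = dd (\<lambda>r. dd n r (\<xi> q)) q b + dd n q (dd \<xi> q b)"
      using dd_dd_apply[OF U(1) smn U(1) smooth_on_ident _ sm q, of b] by simp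
    ultimately have "dd (\<lambda>r. dd n r b) q (\<xi> q) = - dd n q (dd \<xi> q b)"
      using second_derivative_symmetric[OF U(1) smn q, of b "\<xi> q"] by (simp add: eq_neg_iff_add_eq_0)
    then show ?thesis using dnP[OF q] by simp
  qed
  have dPdn: "dd P q (\<xi> q) \<bullet> dd n q b = 0" for b
  proof -
    have "dd (\<lambda>r. dd n r b \<bullet> P r) q (\<xi> q) = 0" by (rule dd_eq_const[OF U(1) q]) (rule dnP)
    then show ?thesis using dd_inner_smooth[OF smooth_on_dd[OF smn, of b] smP q, of "\<xi> q"] ddn[of b]
      by (simp add: inner_commute)
  qed
  obtain c where c: "dd P q (\<xi> q) = c *\<^sub>R P q"
  proof (rule orthogonal_complement_line[OF P0 b0, of "n q" "dd P q (\<xi> q)"])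
    show "n q \<noteq> 0" using n_n[OF NU[OF q]] by auto
    have "dd (\<lambda>r. n r \<bullet> n r) q b0 = 0" by (rule dd_eq_const[OF U(1) q]) (use n_n NU in blast)
    then show "dd n q b0 \<bullet> n q = 0" using dd_inner_smooth[OF smn smn q, of b0] by (simp add: inner_commute)
    show "P q \<bullet> dd n q b0 = 0" using dnP[OF q] by (simp add: inner_commute)
  qed (use Pn dPn dPdn in auto)
  define \<rho>' where "\<rho>' = deriv f' (t q) / f (t q) - (f' (t q))\<^sup>2 / (f (t q))\<^sup>2"
  define \<omega> where "\<omega> b r = dd w r b + \<rho> (t r) *\<^sub>R pp r b" for b r
  have P\<omega>: "P r \<bullet> \<omega> b r = 0" if "r \<in> U" for r b
    using nd(4)[OF that, of b] unfolding \<omega>_def P_def by (simp add: inner_add_right)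
  have sm\<rho>t: "smooth_on U (\<lambda>r. \<rho> (t r))" by (rule sub[OF sm_of_t[OF sm\<rho>]])
  have sm\<rho>p: "smooth_on U (\<lambda>r. \<rho> (t r) *\<^sub>R pp r b)" for b
    by (rule smooth_on_scaleR[OF U(1) sm\<rho>t sub[OF sm_pp]])
  have sm\<omega>: "smooth_on U (\<omega> b)" for b
    unfolding \<omega>_def[abs_def] by (rule smooth_on_add[OF U(1) smooth_on_dd[OF smw] sm\<rho>p])
  have d\<omega>: "dd (\<omega> b) q a = dd (\<lambda>r. dd w r b) q a + \<rho> (t q) *\<^sub>R snd (d2 q a b) + (\<rho>' * tt q a) *\<^sub>R pp q b" for a b
  proof -
    have "dd (\<omega> b) q a = dd (\<lambda>r. dd w r b) q a + dd (\<lambda>r. \<rho> (t r) *\<^sub>R pp r b) q a"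
      unfolding \<omega>_def[abs_def] by (rule dd_add_smooth[OF smooth_on_dd[OF smw] sm\<rho>p q])
    moreover have "dd (\<lambda>r. \<rho> (t r) *\<^sub>R pp r b) q a
      = \<rho> (t q) *\<^sub>R dd (\<lambda>r. pp r b) q a + dd (\<lambda>r. \<rho> (t r)) q a *\<^sub>R pp q b"
      by (rule dd_scaleR_smooth[OF sm\<rho>t sub[OF sm_pp] q])
    moreover have "dd (\<lambda>r. \<rho> (t r)) q a = \<rho>' * tt q a"
      unfolding \<rho>'_def by (rule dd_of_t[OF \<rho>_deriv[OF tI[OF qV]] qV])
    ultimately show ?thesis using dd_pp[OF qV, of b a] by simp
  qed
  have P\<omega>': "dd P q a \<bullet> \<omega> b q + P q \<bullet> dd (\<omega> b) q a = 0" for a b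
  proof -
    have "dd (\<lambda>r. P r \<bullet> \<omega> b r) q a = 0" by (rule dd_eq_const[OF U(1) q]) (rule P\<omega>)
    then show ?thesis using dd_inner_smooth[OF smP sm\<omega> q, of b a] by simp
  qed
  have sym: "dd (\<omega> e2) q e1 - dd (\<omega> e1) q e2 = (\<rho>' * tt q e1) *\<^sub>R pp q e2 - (\<rho>' * tt q e2) *\<^sub>R pp q e1"
    unfolding d\<omega> using second_derivative_symmetric[OF U(1) smw q, of e1 e2] d2_sym[OF qV, of e1 e2] by simp
  have \<omega>\<xi>: "fst (\<xi> q) *\<^sub>R \<omega> e1 q + snd (\<xi> q) *\<^sub>R \<omega> e2 q = 0"
  proof -
    have "dd w q (\<xi> q) + \<rho> (t q) *\<^sub>R pp q (\<xi> q) = 0" using nd(3)[OF q] by simp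
    then show ?thesis
      unfolding \<omega>_def pp_R2[OF qV, of "\<xi> q"] linear_R2[OF smooth_on_linear_dd[OF smw q], of "\<xi> q"]
      by (simp add: algebra_simps)
  qed
  have dP\<xi>: "fst (\<xi> q) *\<^sub>R dd P q e1 + snd (\<xi> q) *\<^sub>R dd P q e2 = c *\<^sub>R P q"
    using linear_R2[OF smooth_on_linear_dd[OF smP q], of "\<xi> q"] c by simp
  define A where "A = dd P q e1"
  define B where "B = dd P q e2"
  \<comment> \<open>The value of dP wedge omega on (e1, e2). Multiplied by either component of xi it
    vanishes, and one of these components is nonzero.\<close>
  have AB: "A \<bullet> \<omega> e2 q - B \<bullet> \<omega> e1 q = 0"
  proof -
    have o: "(fst (\<xi> q) *\<^sub>R A + snd (\<xi> q) *\<^sub>R B) \<bullet> \<omega> b q = 0" for b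
      unfolding A_def B_def dP\<xi> using P\<omega>[OF q] by simp
    have o': "fst (\<xi> q) * (Y \<bullet> \<omega> e1 q) + snd (\<xi> q) * (Y \<bullet> \<omega> e2 q) = 0" for Y
      using arg_cong[OF \<omega>\<xi>, of "\<lambda>z. Y \<bullet> z"] by (simp add: inner_add_right)
    have "fst (\<xi> q) * (A \<bullet> \<omega> e2 q) = fst (\<xi> q) * (B \<bullet> \<omega> e1 q)"
      using o[of e2, unfolded inner_add_left inner_scaleR_left] o'[of B] by linarith
    moreover have "snd (\<xi> q) * (A \<bullet> \<omega> e2 q) = snd (\<xi> q) * (B \<bullet> \<omega> e1 q)"
      using o[of e1, unfolded inner_add_left inner_scaleR_left] o'[of A] by linarith
    moreover have "fst (\<xi> q) \<noteq> 0 \<or> snd (\<xi> q) \<noteq> 0" using \<xi>q by (simp add: prod_eq_iff)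
    ultimately show ?thesis by auto
  qed
  have "P q \<bullet> (dd (\<omega> e2) q e1 - dd (\<omega> e1) q e2) = 0"
    using P\<omega>'[of e1 e2] P\<omega>'[of e2 e1] AB unfolding A_def B_def by (simp add: inner_diff_right)
  then have "\<rho>' * (tt q e1 * (P q \<bullet> pp q e2) - tt q e2 * (P q \<bullet> pp q e1)) = 0"
    unfolding sym by (simp add: inner_diff_right algebra_simps)
  then have grad: "tt q e1 * (P q \<bullet> pp q e2) = tt q e2 * (P q \<bullet> pp q e1)"
    using curv unfolding \<rho>'_def by simp
  let ?F = "(f (t q))\<^sup>2"
  \<comment> \<open>Lagrange's identity: the determinant of X and xi times the Gram determinant of p
    is the determinant of the pairings of Tb and P with the coordinate vectors of p.\<close>
  have "?F * ((norm (N q))\<^sup>2 * (fst (X q) * snd (\<xi> q) - snd (X q) * fst (\<xi> q)))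
    = (?F * (Tb q \<bullet> pp q e1)) * (P q \<bullet> pp q e2) - (?F * (Tb q \<bullet> pp q e2)) * (P q \<bullet> pp q e1)"
    unfolding norm_N Tb_def P_def pp_R2[OF qV, of "X q"] pp_R2[OF qV, of "\<xi> q"]
    by (simp add: inner_add_left inner_commute[of "pp q e2" "pp q e1"] power2_eq_square algebra_simps)
  also have "\<dots> = 0" unfolding Tb_pp[OF qV] using grad by (simp add: algebra_simps)
  finally show ?thesis using NU[OF q] fq[OF qV] by simp
qed

section \<open>The gradient is a null direction\<close>

lemma dd_X_degenerate:
  assumes "r \<in> V" "N r = 0"
  shows "dd y r (X r) = (1, 0)"
proof -
  have s1: "s r = 1" using assms(2) s_eq_1_iff[OF assms(1)] by blast
  then have "(f (t r))\<^sup>2 * (Tb r \<bullet> Tb r) = 0" using Tb_pp[OF assms(1), of "X r"] unfolding Tb_def by simp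
  then have "Tb r = 0" using fq[OF assms(1)] by simp
  then show ?thesis using s1 unfolding s_def Tb_def by (simp add: prod_eq_iff)
qed

text \<open>On an open set where d/dt is tangent, dy(X) is the constant field d/dt. Its covariant
  derivative in the direction b is \<open>\<rho>\<close> times the spatial part of dy(b), which is
  the tangent vector dy(b - dt(b) X).\<close>

lemma null_dir_X_degenerate:
  assumes U: "open U" "U \<subseteq> V" and NU: "\<And>q. q \<in> U \<Longrightarrow> N q = 0" and q: "q \<in> U"
  shows "null_dir f y q (X q)"
proof -
  have dX: "dd y r (X r) = (1, 0)" if "r \<in> U" for r
    using dd_X_degenerate[OF _ NU[OF that]] that U(2) by blast
  have qV: "q \<in> V" using q U(2) by blast
  have tX: "tt q (X q) = 1" and pX: "pp q (X q) = 0" using dX[OF q] by simp_all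
  show ?thesis unfolding null_dir_def
  proof
    fix b
    have "dd (\<lambda>r. dd y r (X r)) q b = 0" by (rule dd_eq_const[OF U(1) q dX])
    then have "d2 q (X q) b = - dd y q (dd X q b)"
      using dd_field[OF opV subset_refl sm_X qV, of b] d2_sym[OF qV, of b "X q"]
      by (simp add: eq_neg_iff_add_eq_0)
    then have "cov_deriv g y q (X q) b = dd y q (- dd X q b + \<rho> (t q) *\<^sub>R (b - tt q b *\<^sub>R X q))"
      unfolding cov_eq[OF qV] linear_add[OF lin[OF qV]] linear_scale[OF lin[OF qV]]
        linear_diff[OF lin[OF qV]] linear_neg[OF lin[OF qV]] using tX pX
      by (simp add: prod_eq_iff)
    then show "cov_deriv g y q (X q) b \<in> tangent_space y q" unfolding tangent_space_def by simp
  qed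
qed

text \<open>The exceptional cases N = 0 and dn = 0 give information only on open sets, so the
  argument takes the open set where X and xi are independent and shows it empty. If N vanishes on
  it, X is itself null and thus a multiple of xi. Otherwise \<open>null_field_parallel\<close>
  forces dn = 0 near some point with N nonzero, so the unit normal is locally constant and p lies in
  a plane.\<close>

lemma null_dir_X:
  assumes curv: "\<And>u. u \<in> I \<Longrightarrow> deriv f' u / f u - (f' u)\<^sup>2 / (f u)\<^sup>2 \<noteq> 0"
    and nonplanar: "\<And>B m c. open B \<Longrightarrow> B \<subseteq> V \<Longrightarrow> B \<noteq> {} \<Longrightarrow> m \<noteq> 0 \<Longrightarrow> (\<And>q. q \<in> B \<Longrightarrow> m \<bullet> p q = c) \<Longrightarrow> False"
    and W: "open W" "W \<subseteq> V" and sm: "smooth_on W \<xi>"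
    and \<xi>: "\<And>q. q \<in> W \<Longrightarrow> \<xi> q \<noteq> 0" "\<And>q. q \<in> W \<Longrightarrow> null_dir f y q (\<xi> q)"
    and line: "\<And>q a. q \<in> W \<Longrightarrow> null_dir f y q a \<Longrightarrow> \<exists>c. a = c *\<^sub>R \<xi> q"
    and q: "q \<in> W"
  shows "null_dir f y q (X q)"
proof -
  define Z where "Z r = fst (X r) * snd (\<xi> r) - snd (X r) * fst (\<xi> r)" for r
  have "smooth_on W (\<lambda>r. Z r)" unfolding Z_def
    by (intro smooth_on_diff smooth_on_mult smooth_on_fst smooth_on_snd W(1) sm smooth_on_subset[OF sm_X W(2)])
  then have cZ: "continuous_on W Z" using smooth_on_continuous_on by auto
  have "Z q = 0"
  proof (rule ccontr)
    assume Zq: "Z q \<noteq> 0"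
    define U where "U = {r \<in> W. Z r \<noteq> 0}"
    have "U = W \<inter> Z -` (- {0})" unfolding U_def by auto
    then have U: "open U" "U \<subseteq> W" using continuous_open_preimage[OF cZ W(1), of "- {0}"] by auto
    have UV: "U \<subseteq> V" using U(2) W(2) by blast
    have qU: "q \<in> U" using q Zq unfolding U_def by simp
    show False
    proof (cases "\<forall>r\<in>U. N r = 0")
      case True
      then have "null_dir f y q (X q)" using null_dir_X_degenerate[OF U(1) UV _ qU] by blast
      then obtain c where "X q = c *\<^sub>R \<xi> q" using line[OF q] by blast
      then show False using Zq unfolding Z_def by simp
    next
      case False
      then obtain r0 where r0: "r0 \<in> U" "N r0 \<noteq> 0" by blast
      define U' where "U' = {r \<in> U. N r \<noteq> 0}"
      have "continuous_on U N" using smooth_on_continuous_on[OF smooth_on_subset[OF sm_N UV]] .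
      moreover have "U' = U \<inter> N -` (- {0})" unfolding U'_def by auto
      ultimately have U': "open U'" using continuous_open_preimage[OF _ U(1), of N "- {0}"] by auto
      have U'V: "U' \<subseteq> V" and U'W: "U' \<subseteq> W" and NU': "\<And>r. r \<in> U' \<Longrightarrow> N r \<noteq> 0" and r0U': "r0 \<in> U'"
        using UV U(2) r0 unfolding U'_def by auto
      have smn: "smooth_on U' n" using sm_n[OF U' U'V] NU' by blast
      have dn0: "dd n r b = 0" if r: "r \<in> U'" for r b
      proof (rule ccontr)
        assume "dd n r b \<noteq> 0"
        moreover have "r \<in> W" "r \<in> V" using r U'W U'V by auto
        ultimately have "Z r = 0" unfolding Z_def
          using null_field_parallel[OF U' U'V NU' smooth_on_subset[OF sm U'W] _ r] \<xi> U'W curv[OF tI] by blast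
        then show False using r unfolding U'_def U_def by simp
      qed
      obtain e where e: "e > 0" "ball r0 e \<subseteq> U'" using U' r0U' open_contains_ball by blast
      have inU: "r \<in> U'" if "r \<in> ball r0 e" for r using e(2) that by blast
      have const: "n r = n r0" if "r \<in> ball r0 e" for r
      proof -
        have "\<exists>c. \<forall>r\<in>ball r0 e. n r = c"
        proof (rule has_derivative_zero_constant[OF convex_ball])
          fix r assume r: "r \<in> ball r0 e"
          have "dd n r = (\<lambda>b. 0)" using dn0[OF inU[OF r]] by blast
          then have "(n has_derivative (\<lambda>b. 0)) (at r)"
            using smooth_on_has_derivative[OF smn inU[OF r]] by simp
          then show "(n has_derivative (\<lambda>b. 0)) (at r within ball r0 e)" by (rule has_derivative_at_withinI)
        qed
        then show ?thesis using that e(1) by (metis centre_in_ball)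
      qed
      have "\<exists>c. \<forall>r\<in>ball r0 e. n r0 \<bullet> p r = c"
      proof (rule has_derivative_zero_constant[OF convex_ball])
        fix r assume r: "r \<in> ball r0 e"
        have rV: "r \<in> V" using inU[OF r] U'V by blast
        have "((\<lambda>r. n r0 \<bullet> p r) has_derivative (\<lambda>b. n r0 \<bullet> pp r b)) (at r)"
          by (rule has_derivative_inner_right[OF has_derivative_snd[OF smooth_on_has_derivative[OF smy rV]]])
        moreover have "(\<lambda>b. n r0 \<bullet> pp r b) = (\<lambda>b. 0)" using n_pp[OF rV] const[OF r] by auto
        ultimately have "((\<lambda>r. n r0 \<bullet> p r) has_derivative (\<lambda>b. 0)) (at r)" by simp
        then show "((\<lambda>r. n r0 \<bullet> p r) has_derivative (\<lambda>b. 0)) (at r within ball r0 e)" by (rule has_derivative_at_withinI)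
      qed
      then obtain c where c: "\<And>r. r\<in>ball r0 e \<Longrightarrow> n r0 \<bullet> p r = c" by blast
      have "n r0 \<noteq> 0" using n_n[OF NU'[OF r0U']] by auto
      moreover have "ball r0 e \<subseteq> V" "ball r0 e \<noteq> {}" using e U'V by auto
      ultimately show False using nonplanar[of "ball r0 e" "n r0" c] c by blast
    qed
  qed
  have "\<xi> q \<noteq> 0" by (rule \<xi>(1)[OF q])
  \<comment> \<open>The ratio is read off from a component in which xi does not vanish.\<close>
  define c where "c = (if fst (\<xi> q) \<noteq> 0 then fst (X q) / fst (\<xi> q) else snd (X q) / snd (\<xi> q))"
  have "X q = c *\<^sub>R \<xi> q"
    using \<open>Z q = 0\<close> \<open>\<xi> q \<noteq> 0\<close> unfolding c_def Z_def by (auto simp: prod_eq_iff field_simps)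
  then show ?thesis using null_dir_scale[OF _ \<xi>(2)[OF q]] q W(2) by auto
qed

text \<open>The conformal argument in components. Tangency of the covariant derivative of T gives
  \<open>e1\<close>; differentiating <T, T> = -s gives \<open>iii\<close>. Eliminating the
  derivative of Tb leaves ds = -2 \<open>\<rho>\<close> (s - 1) dt, which cancels the derivative of
  f^2.\<close>

lemma s_deriv:
  assumes q: "q \<in> V" and null: "null_dir f y q (X q)"
  shows "dd (\<lambda>r. (f (t r))\<^sup>2 * (s r - 1)) q b = 0"
proof -
  let ?F = "f (t q)" and ?T = "Tb q" and ?s = "s q" and ?r = "\<rho> (t q)"
  let ?ds = "dd s q b" and ?dT = "dd Tb q b"
  have F0: "?F \<noteq> 0" by (rule fq[OF q])
  have ff': "?F * f' (t q) = ?F\<^sup>2 * ?r" unfolding \<rho>_def using F0 by (simp add: power2_eq_square)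
  have d: "dd (\<lambda>r. dd y r (X r)) q b = d2 q b (X q) + dd y q (dd X q b)" by (rule dd_field[OF opV subset_refl sm_X q])
  note smyX = sm_field[OF opV subset_refl sm_X]
  have ds: "?ds = fst (dd (\<lambda>r. dd y r (X r)) q b)" and dT: "?dT = snd (dd (\<lambda>r. dd y r (X r)) q b)"
    unfolding s_def[abs_def] Tb_def[abs_def] by (rule dd_fst_smooth[OF smyX q], rule dd_snd_smooth[OF smyX q])
  obtain v where v: "cov_deriv g y q (X q) b = dd y q v"
    using null unfolding null_dir_def tangent_space_def by blast
  \<comment> \<open>dy(c) is the covariant derivative of T in the direction b: the derivative of the
    coefficients X adds a tangent vector to \<open>cov_deriv\<close>.\<close>
  define c where "c = v + dd X q b"
  have c: "dd y q c = cov_deriv g y q (X q) b + dd y q (dd X q b)"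
    unfolding c_def linear_add[OF lin[OF q]] v ..
  have c1: "?ds + ?F * f' (t q) * (?T \<bullet> pp q b) = tt q c"
    unfolding c cov_eq[OF q] ds d using d2_sym[OF q, of b "X q"] by (simp add: Tb_def)
  have c2: "?dT + ?r *\<^sub>R (?s *\<^sub>R pp q b + tt q b *\<^sub>R ?T) = pp q c"
    unfolding c cov_eq[OF q] dT d using d2_sym[OF q, of b "X q"] by (simp add: Tb_def s_def)
  have normal: "(?s - 1) * tt q c = ?F\<^sup>2 * (?T \<bullet> pp q c)" using Tb_pp[OF q, of c] by simp
  have i: "?F\<^sup>2 * (?T \<bullet> pp q b) = (?s - 1) * tt q b" by (rule Tb_pp[OF q])
  have ii: "(f (t r))\<^sup>2 * (Tb r \<bullet> Tb r) = s r * s r - s r" if "r \<in> V" for r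
    using Tb_pp[OF that, of "X r"] unfolding Tb_def[symmetric] s_def[symmetric] by (simp add: algebra_simps)
  have smff: "smooth_on V (\<lambda>r. (f (t r))\<^sup>2)" by (rule smooth_on_power[OF opV sm_of_t[OF smf]])
  have dff: "dd (\<lambda>r. (f (t r))\<^sup>2) q b = 2 * (?F\<^sup>2 * ?r) * tt q b"
  proof -
    have "((\<lambda>t. (f t)\<^sup>2) has_real_derivative 2 * (?F\<^sup>2 * ?r)) (at (t q))"
      by (rule DERIV_cong, (rule derivative_eq_intros f_deriv[OF tI[OF q]] refl)+) (simp flip: ff')
    then show ?thesis by (rule dd_of_t[OF _ q])
  qed
  have iii: "2 * ?r * tt q b * (?F\<^sup>2 * (?T \<bullet> ?T)) + 2 * (?F\<^sup>2 * (?T \<bullet> ?dT)) = 2 * ?s * ?ds - ?ds"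
  proof -
    have "dd (\<lambda>r. (f (t r))\<^sup>2 * (Tb r \<bullet> Tb r)) q = dd (\<lambda>r. s r * s r + - 1 * s r) q"
      by (rule dd_cong[OF opV q]) (simp add: ii)
    moreover have "dd (\<lambda>r. (f (t r))\<^sup>2 * (Tb r \<bullet> Tb r)) q b
      = ?F\<^sup>2 * dd (\<lambda>r. Tb r \<bullet> Tb r) q b + dd (\<lambda>r. (f (t r))\<^sup>2) q b * (?T \<bullet> ?T)"
      by (rule dd_mult_smooth[OF smff smooth_on_inner[OF opV sm_Tb sm_Tb] q])
    moreover have "dd (\<lambda>r. Tb r \<bullet> Tb r) q b = ?T \<bullet> ?dT + ?dT \<bullet> ?T"
      by (rule dd_inner_smooth[OF sm_Tb sm_Tb q])
    moreover have "dd (\<lambda>r. s r * s r + - 1 * s r) q b = dd (\<lambda>r. s r * s r) q b + dd (\<lambda>r. - 1 * s r) q b"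
      by (rule dd_add_smooth[OF smooth_on_mult[OF opV sm_s sm_s] smooth_on_mult[OF opV smooth_on_const sm_s] q])
    moreover have "dd (\<lambda>r. s r * s r) q b = ?s * ?ds + ?ds * ?s" by (rule dd_mult_smooth[OF sm_s sm_s q])
    moreover have "dd (\<lambda>r. - 1 * s r) q b = - 1 * ?ds"
      using dd_mult_smooth[OF smooth_on_const sm_s q, of "-1" b] by simp
    ultimately show ?thesis unfolding dff by (simp add: inner_commute algebra_simps)
  qed
  have e1: "(?s - 1) * (?ds + ?r * (?F\<^sup>2 * (?T \<bullet> pp q b)))
    = ?F\<^sup>2 * (?T \<bullet> ?dT) + ?r * (?s * (?F\<^sup>2 * (?T \<bullet> pp q b)) + tt q b * (?F\<^sup>2 * (?T \<bullet> ?T)))"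
    using normal unfolding c1[symmetric] c2[symmetric] ff' by (simp add: inner_add_right algebra_simps)
  have f1: "?ds = - 2 * ?r * (?s - 1) * tt q b"
    using e1 iii unfolding i ii[OF q] by (simp add: algebra_simps)
  have f2: "dd (\<lambda>r. (f (t r))\<^sup>2 * (s r + - 1)) q b
     = ?F\<^sup>2 * dd (\<lambda>r. s r + - 1) q b + dd (\<lambda>r. (f (t r))\<^sup>2) q b * (?s + - 1)"
    by (rule dd_mult_smooth[OF smff smooth_on_add[OF opV sm_s smooth_on_const] q])
  have f3: "dd (\<lambda>r. s r + - 1) q b = ?ds"
    using dd_add_smooth[OF sm_s smooth_on_const q, of "-1" b] by simp
  have "?F\<^sup>2 * (- 2 * ?r * (?s - 1) * tt q b) + 2 * (?F\<^sup>2 * ?r) * tt q b * (?s + - 1) = 0"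
    by (simp add: algebra_simps)
  then have "dd (\<lambda>r. (f (t r))\<^sup>2 * (s r + - 1)) q b = 0" unfolding f2 f3 f1 dff .
  then show ?thesis by simp
qed

end

section \<open>Adapted coordinates\<close>

lemma homeomorphism_inj_dd:
  fixes F :: "'a::euclidean_space \<Rightarrow> 'a"
  assumes "homeomorphism U D F G" "open D" "smooth_on D G" "smooth_on U F" "z \<in> D"
  shows "dd F (G z) (dd G z v) = v" "inj (dd G z)"
proof -
  have Gz: "G z \<in> U" using assms(1,5) unfolding homeomorphism_def by blast
  have "dd F (G z) (dd G z v) = v" for v
  proof -
    have "dd (\<lambda>r. F (G r)) z v = dd F (G z) (dd G z v)"
      by (rule dd_compose[OF smooth_on_differentiable[OF assms(3,5)] smooth_on_differentiable[OF assms(4) Gz]])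
    moreover have "dd (\<lambda>r. F (G r)) z = dd (\<lambda>r. r) z"
      by (rule dd_cong[OF assms(2,5)]) (use assms(1) in \<open>auto simp: homeomorphism_def\<close>)
    ultimately show ?thesis by simp
  qed
  then show "dd F (G z) (dd G z v) = v" "inj (dd G z)" by (auto simp: inj_def) metis
qed

lemma local_param_open_image:
  assumes "local_param M x V \<psi>" "open U" "U \<subseteq> V"
  shows "openin M (\<psi> ` U)"
proof -
  have h: "homeomorphic_map (top_of_set V) (subtopology M (\<psi> ` V)) \<psi>" and o: "openin M (\<psi> ` V)"
    using assms(1) unfolding local_param_def embedding_map_def by simp_all
  have "openin (top_of_set V) U" using openin_open_Int[OF assms(2), of V] assms(3) by (simp add: Int_absorb1)
  then have "openin (subtopology M (\<psi> ` V)) (\<psi> ` U)"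
    using homeomorphic_map_openness_eq[OF h, of U] by simp
  then show ?thesis using openin_trans_full o by blast
qed

lemma local_param_compose:
  fixes \<psi> :: "real \<times> real \<Rightarrow> 'm" and x :: "'m \<Rightarrow> 'e::euclidean_space"
  assumes V: "local_param M x V \<psi>" and U: "open U" "U \<subseteq> V" and D: "open D"
    and hom: "homeomorphism U D F G" and G: "smooth_on D G" "\<And>z. z \<in> D \<Longrightarrow> inj (dd G z)"
  shows "local_param M x D (\<psi> \<circ> G)"
  unfolding local_param_def smooth_immersion_on_def
proof (intro conjI ballI)
  have GD: "G ` D = U" using hom unfolding homeomorphism_def by blast
  have GV: "G ` D \<subseteq> V" using GD U(2) by simp
  have sm: "smooth_on V (x \<circ> \<psi>)" and inj: "\<And>q. q \<in> V \<Longrightarrow> inj (dd (x \<circ> \<psi>) q)" and opV: "open V"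
    using V unfolding local_param_def smooth_immersion_on_def by blast+
  show "open D" by (rule D)
  have "homeomorphic_maps (top_of_set D) (top_of_set U) G F"
    using hom unfolding homeomorphic_maps_def homeomorphism_def by auto
  then have "homeomorphic_map (top_of_set D) (top_of_set U) G" using homeomorphic_map_maps by blast
  moreover have "subtopology (top_of_set V) U = top_of_set U"
    using U(2) by (simp add: subtopology_subtopology Int_absorb1)
  ultimately have "embedding_map (top_of_set D) (top_of_set V) G"
    unfolding embedding_map_def by (simp add: GD)
  then show "embedding_map (top_of_set D) M (\<psi> \<circ> G)"
    using embedding_map_compose V unfolding local_param_def by blast
  show "openin M ((\<psi> \<circ> G) ` D)" unfolding image_comp[symmetric] GD by (rule local_param_open_image[OF V U])
  have eq: "x \<circ> (\<psi> \<circ> G) = (\<lambda>z. (x \<circ> \<psi>) (G z))" by auto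
  show "smooth_on D (x \<circ> (\<psi> \<circ> G))"
    unfolding eq by (rule smooth_on_compose[OF D opV sm G(1) GV])
  fix z assume z: "z \<in> D"
  have Gz: "G z \<in> V" using GV z by blast
  have "dd (x \<circ> (\<psi> \<circ> G)) z v = dd (x \<circ> \<psi>) (G z) (dd G z v)" for v
    unfolding eq by (rule dd_compose[OF smooth_on_differentiable[OF G(1) z] smooth_on_differentiable[OF sm Gz]])
  then show "inj (dd (x \<circ> (\<psi> \<circ> G)) z)" using inj[OF Gz] G(2)[OF z] unfolding inj_def by metis
qed

text \<open>A product of intervals, so that slices in the first variable are connected and meet the
  line over c, and the second factor can serve as the parameter interval of the curves.\<close>

definition square :: "real \<Rightarrow> real \<Rightarrow> real \<Rightarrow> (real \<times> real) set" where
  "square c d \<epsilon> = {c - \<epsilon> <..< c + \<epsilon>} \<times> {d - \<epsilon> <..< d + \<epsilon>}"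

lemma open_square: "open (square c d \<epsilon>)"
  unfolding square_def by (intro open_Times) auto

lemma square_mem: "z \<in> square c d \<epsilon> \<longleftrightarrow> c - \<epsilon> < fst z \<and> fst z < c + \<epsilon> \<and> d - \<epsilon> < snd z \<and> snd z < d + \<epsilon>"
  unfolding square_def by (cases z) auto

lemma square_neighbourhood:
  assumes "open S" "z \<in> S"
  obtains \<epsilon> where "\<epsilon> > 0" "square (fst z) (snd z) \<epsilon> \<subseteq> S"
proof -
  obtain e where e: "e > 0" "ball z e \<subseteq> S" using assms open_contains_ball by blast
  have "square (fst z) (snd z) (e / 2) \<subseteq> ball z e"
  proof
    fix r assume "r \<in> square (fst z) (snd z) (e / 2)"
    then have "\<bar>fst z - fst r\<bar> < e / 2" "\<bar>snd z - snd r\<bar> < e / 2" unfolding square_mem abs_less_iff by linarith+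
    then have "dist z r < e"
      using sqrt_sum_squares_le_sum_abs[of "fst z - fst r" "snd z - snd r"]
      by (simp add: dist_prod_def dist_real_def)
    then show "r \<in> ball z e" by simp
  qed
  then show ?thesis using that[of "e / 2"] e by auto
qed

lemma const_along_first:
  fixes K :: "real \<times> real \<Rightarrow> 'b::real_normed_vector"
  assumes "\<And>z. z \<in> square c d \<epsilon> \<Longrightarrow> (K has_derivative D z) (at z)" "\<And>z. z \<in> square c d \<epsilon> \<Longrightarrow> D z e1 = 0"
    "z \<in> square c d \<epsilon>"
  shows "K z = K (c, snd z)"
proof -
  have "\<exists>k. \<forall>u\<in>{c - \<epsilon> <..< c + \<epsilon>}. K (u, snd z) = k"
  proof (rule has_derivative_zero_constant)
    fix u assume u: "u \<in> {c - \<epsilon> <..< c + \<epsilon>}"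
    then have m: "(u, snd z) \<in> square c d \<epsilon>" using assms(3) unfolding square_mem by auto
    have "((\<lambda>u. (u, snd z)) has_derivative (\<lambda>v. (v, 0))) (at u)"
      by (auto intro!: derivative_eq_intros)
    from has_derivative_compose[OF this assms(1)[OF m]]
    have "((\<lambda>u. K (u, snd z)) has_derivative (\<lambda>v. D (u, snd z) (v, 0))) (at u)" .
    moreover have "D (u, snd z) (v, 0) = 0" for v
    proof -
      have "linear (D (u, snd z))" using assms(1)[OF m] has_derivative_linear by blast
      then have "D (u, snd z) (v *\<^sub>R e1) = 0" using assms(2)[OF m] by (simp only: linear_scale) simp
      then show ?thesis by simp
    qed
    ultimately show "((\<lambda>u. K (u, snd z)) has_derivative (\<lambda>h. 0)) (at u within {c - \<epsilon> <..< c + \<epsilon>})"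
      using has_derivative_at_withinI by auto
  qed simp
  moreover have "fst z \<in> {c - \<epsilon> <..< c + \<epsilon>}" "c \<in> {c - \<epsilon> <..< c + \<epsilon>}" using assms(3) unfolding square_mem by auto
  ultimately show ?thesis by (metis prod.collapse)
qed

section \<open>Frames along curves\<close>

lemma orthonormal_expansion:
  fixes a b u :: "real^3"
  assumes "a \<bullet> a = 1" "b \<bullet> b = 1" "a \<bullet> b = 0"
  shows "u = (u \<bullet> a) *\<^sub>R a + (u \<bullet> b) *\<^sub>R b + (u \<bullet> cross3 a b) *\<^sub>R cross3 a b"
    and "cross3 a b \<bullet> cross3 a b = 1"
proof -
  show c: "cross3 a b \<bullet> cross3 a b = 1"
    using norm_cross_dot[of a b] assms by (simp add: power_mult_distrib power2_norm_eq_inner)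
  have "u - ((u \<bullet> a) *\<^sub>R a + (u \<bullet> b) *\<^sub>R b + (u \<bullet> cross3 a b) *\<^sub>R cross3 a b) = 0"
    by (rule orthogonal_to_basis_eq_0[of _ a b])
       (use assms c in \<open>auto simp: inner_diff_left inner_add_left dot_cross_self inner_commute[of b a]\<close>)
  then show "u = (u \<bullet> a) *\<^sub>R a + (u \<bullet> b) *\<^sub>R b + (u \<bullet> cross3 a b) *\<^sub>R cross3 a b" by simp
qed

text \<open>Take \<open>\<alpha>1\<close> in the direction of c' and \<open>\<alpha>3\<close> as the
  cross product. As \<open>\<alpha>2\<close> moves along c', the frame has no rotation between
  \<open>\<alpha>2\<close> and \<open>\<alpha>3\<close>, which gives the required frame equations.
  The phi_i are the coordinates of c in this frame; their equations hold because c' has only an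
  \<open>\<alpha>1\<close> component.\<close>

lemma frame_of_curves:
  fixes c \<alpha>2 :: "real \<Rightarrow> real^3"
  assumes J: "open_interval J" "v0 \<in> J" and a: "a \<noteq> 0" "u0 \<in> I" and c: "smooth_on J c" and \<alpha>2: "smooth_on J \<alpha>2"
    and unit: "\<And>v. v \<in> J \<Longrightarrow> \<alpha>2 v \<bullet> \<alpha>2 v = 1"
    and orth: "\<And>v. v \<in> J \<Longrightarrow> \<alpha>2 v \<bullet> dd c v 1 = 0" and nz: "\<And>v. v \<in> J \<Longrightarrow> dd c v 1 \<noteq> 0"
    and par: "\<And>v. v \<in> J \<Longrightarrow> dd \<alpha>2 v 1 = \<mu> v *\<^sub>R dd c v 1"
  obtains a1 a2 \<phi>1 \<phi>2 \<phi>3 \<alpha>1 \<alpha>3 where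
    "model_data I J a u0 v0 a1 a2 \<phi>1 \<phi>2 \<phi>3 \<alpha>1 \<alpha>2 \<alpha>3"
    "\<And>v. v \<in> J \<Longrightarrow> c v = \<phi>1 v *\<^sub>R \<alpha>1 v + \<phi>2 v *\<^sub>R \<alpha>2 v + \<phi>3 v *\<^sub>R \<alpha>3 v"
proof -
  have opJ: "open J" using J(1) unfolding open_interval_def by blast
  define \<alpha>1 where "\<alpha>1 v = inverse (norm (dd c v 1)) *\<^sub>R dd c v 1" for v
  define \<alpha>3 where "\<alpha>3 v = cross3 (\<alpha>1 v) (\<alpha>2 v)" for v
  define a1 where "a1 v = - (dd \<alpha>2 v 1 \<bullet> \<alpha>1 v)" for v
  define a2 where "a2 v = dd \<alpha>1 v 1 \<bullet> \<alpha>3 v" for v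
  have sm1: "smooth_on J \<alpha>1" unfolding \<alpha>1_def[abs_def]
    using nz by (intro smooth_on_scaleR smooth_on_inverse smooth_on_norm smooth_on_dd opJ c) auto
  have sm3: "smooth_on J \<alpha>3" unfolding \<alpha>3_def[abs_def] by (intro smooth_on_cross3 opJ sm1 \<alpha>2)
  have sma1: "smooth_on J a1" unfolding a1_def[abs_def]
    by (intro smooth_on_minus smooth_on_inner smooth_on_dd opJ sm1 \<alpha>2)
  have sma2: "smooth_on J a2" unfolding a2_def[abs_def] by (intro smooth_on_inner smooth_on_dd opJ sm1 sm3)
  have u1: "\<alpha>1 v \<bullet> \<alpha>1 v = 1" if "v \<in> J" for v unfolding \<alpha>1_def using nz[OF that]
    by (simp add: power2_norm_eq_inner[symmetric] power2_eq_square)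
  have o12: "\<alpha>1 v \<bullet> \<alpha>2 v = 0" if "v \<in> J" for v unfolding \<alpha>1_def using orth[OF that] by (simp add: inner_commute)
  have o13: "\<alpha>1 v \<bullet> \<alpha>3 v = 0" "\<alpha>2 v \<bullet> \<alpha>3 v = 0" for v unfolding \<alpha>3_def by (simp_all add: dot_cross_self)
  note ex = orthonormal_expansion[OF u1 unit o12, folded \<alpha>3_def]
  have dc: "dd c v 1 = norm (dd c v 1) *\<^sub>R \<alpha>1 v" if "v \<in> J" for v unfolding \<alpha>1_def using nz[OF that] by simp
  have d0: "F v \<bullet> dd G v 1 + dd F v 1 \<bullet> G v = 0"
    if v: "v \<in> J" and F: "smooth_on J F" and G: "smooth_on J G" and k: "\<And>v. v \<in> J \<Longrightarrow> F v \<bullet> G v = k"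
    for F G :: "real \<Rightarrow> real^3" and k v
    using dd_eq_const[OF opJ v, of "\<lambda>v. F v \<bullet> G v" k 1] k dd_inner_smooth[OF F G v, of 1] by simp
  have d2: "dd \<alpha>2 v 1 = - a1 v *\<^sub>R \<alpha>1 v" if v: "v \<in> J" for v
  proof -
    have "dd \<alpha>2 v 1 = (\<mu> v * norm (dd c v 1)) *\<^sub>R \<alpha>1 v" using par[OF v] dc[OF v] by (metis scaleR_scaleR)
    then show ?thesis unfolding a1_def using u1[OF v] by simp
  qed
  have d1: "dd \<alpha>1 v 1 = a1 v *\<^sub>R \<alpha>2 v + a2 v *\<^sub>R \<alpha>3 v" if v: "v \<in> J" for v
  proof -
    have "dd \<alpha>1 v 1 \<bullet> \<alpha>1 v = 0" using d0[OF v sm1 sm1 u1] by (simp add: inner_commute)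
    moreover have "dd \<alpha>1 v 1 \<bullet> \<alpha>2 v = a1 v"
      using d0[OF v sm1 \<alpha>2 o12] d2[OF v] u1[OF v] by simp
    moreover have "dd \<alpha>1 v 1 \<bullet> \<alpha>3 v = a2 v" unfolding a2_def ..
    ultimately show ?thesis using ex(1)[OF v v v, of "dd \<alpha>1 v 1"] by simp
  qed
  have d3: "dd \<alpha>3 v 1 = - a2 v *\<^sub>R \<alpha>1 v" if v: "v \<in> J" for v
  proof -
    have "dd \<alpha>3 v 1 \<bullet> \<alpha>1 v = - a2 v" using d0[OF v sm1 sm3 o13(1)] unfolding a2_def by (simp add: inner_commute)
    moreover have "dd \<alpha>3 v 1 \<bullet> \<alpha>2 v = 0" using d0[OF v \<alpha>2 sm3 o13(2)] d2[OF v] o13(1)[of v] by (simp add: inner_commute)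
    moreover have "dd \<alpha>3 v 1 \<bullet> \<alpha>3 v = 0" using d0[OF v sm3 sm3, of 1] ex(2) by (simp add: inner_commute)
    ultimately show ?thesis using ex(1)[OF v v v, of "dd \<alpha>3 v 1"] by simp
  qed
  define \<phi>1 where "\<phi>1 v = c v \<bullet> \<alpha>1 v" for v
  define \<phi>2 where "\<phi>2 v = c v \<bullet> \<alpha>2 v" for v
  define \<phi>3 where "\<phi>3 v = c v \<bullet> \<alpha>3 v" for v
  have sm\<phi>: "smooth_on J \<phi>1" "smooth_on J \<phi>2" "smooth_on J \<phi>3"
    unfolding \<phi>1_def[abs_def] \<phi>2_def[abs_def] \<phi>3_def[abs_def] by (intro smooth_on_inner opJ c sm1 \<alpha>2 sm3)+
  have dreal: "(F has_real_derivative dd F v 1) (at v)" if "smooth_on J F" "v \<in> J" for F :: "real \<Rightarrow> real" and v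
    using smooth_on_has_vector_derivative[OF that] by (simp add: has_real_derivative_iff_has_vector_derivative)
  have d\<phi>2: "dd \<phi>2 v 1 = - a1 v * \<phi>1 v" if v: "v \<in> J" for v
    unfolding \<phi>2_def[abs_def] using dd_inner_smooth[OF c \<alpha>2 v, of 1] d2[OF v] orth[OF v]
    by (simp add: \<phi>1_def inner_commute)
  have d\<phi>3: "dd \<phi>3 v 1 = - a2 v * \<phi>1 v" if v: "v \<in> J" for v
  proof -
    have "dd c v 1 \<bullet> \<alpha>3 v = 0" using dc[OF v] o13(1)[of v] by (metis inner_scaleR_left mult_zero_right)
    then show ?thesis unfolding \<phi>3_def[abs_def] using dd_inner_smooth[OF c sm3 v, of 1] d3[OF v] by (simp add: \<phi>1_def)
  qed
  have nrm: "norm (\<alpha>1 v0) = 1" "norm (\<alpha>2 v0) = 1" "norm (\<alpha>3 v0) = 1"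
    unfolding norm_eq_sqrt_inner using u1[OF J(2)] unit[OF J(2)] ex(2)[OF J(2) J(2) J(2)] by simp_all
  show ?thesis
  proof (rule that[of a1 a2 \<phi>1 \<phi>2 \<phi>3 \<alpha>1 \<alpha>3])
    show "model_data I J a u0 v0 a1 a2 \<phi>1 \<phi>2 \<phi>3 \<alpha>1 \<alpha>2 \<alpha>3"
      unfolding model_data_def
    proof (intro conjI ballI)
      show "\<exists>C1 C2 C3. \<alpha>1 v0 = C1 \<and> \<alpha>2 v0 = C2 \<and> \<alpha>3 v0 = C3 \<and> norm C1 = 1 \<and> norm C2 = 1 \<and> norm C3 = 1 \<and>
          C1 \<bullet> C2 = 0 \<and> C1 \<bullet> C3 = 0 \<and> C2 \<bullet> C3 = 0"
        using nrm o12[OF J(2)] o13 by blast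
      fix v assume v: "v \<in> J"
      show "(\<phi>2 has_real_derivative - a1 v * \<phi>1 v) (at v)" using dreal[OF sm\<phi>(2) v] d\<phi>2[OF v] by simp
      show "(\<phi>3 has_real_derivative - a2 v * \<phi>1 v) (at v)" using dreal[OF sm\<phi>(3) v] d\<phi>3[OF v] by simp
      show "(\<alpha>1 has_vector_derivative a1 v *\<^sub>R \<alpha>2 v + a2 v *\<^sub>R \<alpha>3 v) (at v)"
        using smooth_on_has_vector_derivative[OF sm1 v] d1[OF v] by simp
      show "(\<alpha>2 has_vector_derivative - a1 v *\<^sub>R \<alpha>1 v) (at v)"
        using smooth_on_has_vector_derivative[OF \<alpha>2 v] d2[OF v] by simp
      show "(\<alpha>3 has_vector_derivative - a2 v *\<^sub>R \<alpha>1 v) (at v)"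
        using smooth_on_has_vector_derivative[OF sm3 v] d3[OF v] by simp
    qed (use a J sma1 sma2 sm\<phi> sm1 sm3 \<alpha>2 in simp_all)
    show "c v = \<phi>1 v *\<^sub>R \<alpha>1 v + \<phi>2 v *\<^sub>R \<alpha>2 v + \<phi>3 v *\<^sub>R \<alpha>3 v" if "v \<in> J" for v
      unfolding \<phi>1_def \<phi>2_def \<phi>3_def by (rule ex(1)[OF that that that])
  qed
qed

section \<open>Coordinates whose first direction is T\<close>

context patch
begin

text \<open>The map (t, kappa) is a local diffeomorphism: the kernel of d kappa is spanned by X, and
  dt(X) = s >= 1. In the inverse chart the first coordinate direction is X / s and the second is
  tangent to a slice of constant t.\<close>

lemma adapted_coordinates:
  assumes U: "open U" "U \<subseteq> V" and q: "q \<in> U" and \<kappa>: "smooth_on U \<kappa>"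
    and \<kappa>X: "\<And>r. r \<in> U \<Longrightarrow> dd \<kappa> r (X r) = 0" and b: "dd \<kappa> q b \<noteq> (0::real)"
  obtains \<epsilon> U1 G where "\<epsilon> > 0" "open U1" "q \<in> U1" "U1 \<subseteq> U"
    "homeomorphism U1 (square (t q) (\<kappa> q) \<epsilon>) (\<lambda>r. (t r, \<kappa> r)) G" "smooth_on (square (t q) (\<kappa> q) \<epsilon>) G"
    "\<And>z. z \<in> square (t q) (\<kappa> q) \<epsilon> \<Longrightarrow> inj (dd G z)"
    "\<And>z. z \<in> square (t q) (\<kappa> q) \<epsilon> \<Longrightarrow> s (G z) *\<^sub>R dd G z e1 = X (G z)"
    "\<And>z. z \<in> square (t q) (\<kappa> q) \<epsilon> \<Longrightarrow> tt (G z) (dd G z e2) = 0"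
proof -
  define F where "F r = (t r, \<kappa> r)" for r
  note sub = smooth_on_subset[OF _ U(2)]
  have smF: "smooth_on U F" unfolding F_def[abs_def] by (rule smooth_on_Pair[OF U(1) sub[OF sm_t] \<kappa>])
  have dF: "dd F r v = (tt r v, dd \<kappa> r v)" if "r \<in> U" for r v
  proof -
    have "(F has_derivative (\<lambda>v. (tt r v, dd \<kappa> r v))) (at r)" unfolding F_def[abs_def]
      by (rule has_derivative_Pair[OF has_derivative_fst[OF smooth_on_has_derivative[OF sub[OF smy] that]]
            smooth_on_has_derivative[OF \<kappa> that]])
    then show ?thesis by (rule dd_eqI)
  qed
  have qV: "q \<in> V" using q U(2) by blast
  have lF: "linear (dd F q)" by (rule smooth_on_linear_dd[OF smF q])
  have "v = 0" if v: "dd F q v = 0" for v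
  proof -
    let ?k1 = "dd \<kappa> q e1" and ?k2 = "dd \<kappa> q e2"
    have kR2: "dd \<kappa> q v = fst v * ?k1 + snd v * ?k2" for v
      using linear_R2[OF smooth_on_linear_dd[OF \<kappa> q], of v] by simp
    have k: "?k1 \<noteq> 0 \<or> ?k2 \<noteq> 0" using b kR2[of b] by auto
    have X0: "fst (X q) * ?k1 + snd (X q) * ?k2 = 0" using \<kappa>X[OF q] kR2[of "X q"] by simp
    have v0: "fst v * ?k1 + snd v * ?k2 = 0" "tt q v = 0" using v dF[OF q, of v] kR2[of v] by (auto simp: zero_prod_def)
    \<comment> \<open>Both v and X lie in the kernel of the nonzero form d kappa, so their
      determinant vanishes.\<close>
    have "?k1 * (fst v * snd (X q) - snd v * fst (X q)) = (fst v * ?k1 + snd v * ?k2) * snd (X q) - (fst (X q) * ?k1 + snd (X q) * ?k2) * snd v"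
      "?k2 * (fst v * snd (X q) - snd v * fst (X q)) = (fst (X q) * ?k1 + snd (X q) * ?k2) * fst v - (fst v * ?k1 + snd v * ?k2) * fst (X q)"
      by (simp_all add: algebra_simps)
    then have par: "fst v * snd (X q) = snd v * fst (X q)" using k X0 v0 by auto
    define c where "c = (if fst (X q) \<noteq> 0 then fst v / fst (X q) else snd v / snd (X q))"
    have "v = c *\<^sub>R X q" using par X_nz[OF qV] unfolding c_def by (auto simp: prod_eq_iff field_simps)
    moreover from this have "tt q v = c * s q" unfolding s_def using linear_scale[OF lin[OF qV]] by simp
    ultimately show ?thesis using v0(2) s_ge_1[OF qV] by simp
  qed
  then have injF: "inj (dd F q)" using linear_injective_0[OF lF] by blast
  obtain U' V' G where G: "open U'" "q \<in> U'" "U' \<subseteq> U" "open V'" "homeomorphism U' V' F G" "smooth_on V' G"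
    "\<And>r. r \<in> U' \<Longrightarrow> inj (dd F r)"
    using smooth_inverse_function[OF U(1) smF q injF] by metis
  have FqV: "F q \<in> V'" using G(2,5) unfolding homeomorphism_def by blast
  obtain \<epsilon> where \<epsilon>: "\<epsilon> > 0" "square (t q) (\<kappa> q) \<epsilon> \<subseteq> V'"
    using square_neighbourhood[OF G(4) FqV] unfolding F_def by auto
  let ?D = "square (t q) (\<kappa> q) \<epsilon>"
  define U1 where "U1 = U' \<inter> F -` ?D"
  have cF: "continuous_on U' F" using G(5) unfolding homeomorphism_def by blast
  have opU1: "open U1" unfolding U1_def by (rule continuous_open_preimage[OF cF G(1) open_square])
  have FU1: "F ` U1 = ?D"
  proof
    show "F ` U1 \<subseteq> ?D" unfolding U1_def by blast
    show "?D \<subseteq> F ` U1"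
    proof
      fix z assume z: "z \<in> ?D"
      then have "z \<in> V'" using \<epsilon>(2) by blast
      then have "G z \<in> U'" "F (G z) = z" using G(5) unfolding homeomorphism_def by blast+
      then show "z \<in> F ` U1" using z unfolding U1_def by (metis IntI imageI vimageI)
    qed
  qed
  have hom: "homeomorphism U1 ?D F G"
    by (rule homeomorphism_of_subsets[OF G(5) _ \<epsilon>(2) FU1]) (simp add: U1_def)
  have smG: "smooth_on ?D G" by (rule smooth_on_subset[OF G(6) \<epsilon>(2)])
  have U1U: "U1 \<subseteq> U" using G(3) unfolding U1_def by blast
  note inv = homeomorphism_inj_dd[OF hom open_square smG smooth_on_subset[OF smF U1U]]
  have GU1: "G z \<in> U1" if "z \<in> ?D" for z using hom that unfolding homeomorphism_def by blast
  show ?thesis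
  proof (rule that[OF \<epsilon>(1) opU1 _ U1U _ smG inv(2)])
    show "q \<in> U1" unfolding U1_def using G(2) \<epsilon>(1) by (auto simp: F_def square_mem)
    show "homeomorphism U1 ?D (\<lambda>r. (t r, \<kappa> r)) G" using hom unfolding F_def[abs_def] .
    fix z assume z: "z \<in> ?D"
    have Gz: "G z \<in> U'" "G z \<in> U" "G z \<in> V" using GU1[OF z] U1U U(2) unfolding U1_def by auto
    have l: "linear (dd F (G z))" by (rule smooth_on_linear_dd[OF smF Gz(2)])
    show "tt (G z) (dd G z e2) = 0" using inv(1)[OF z, of e2] dF[OF Gz(2)] by simp
    have "dd F (G z) (s (G z) *\<^sub>R dd G z e1) = s (G z) *\<^sub>R e1"
      unfolding linear_scale[OF l] inv(1)[OF z] ..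
    also have "\<dots> = dd F (G z) (X (G z))" using dF[OF Gz(2), of "X (G z)"] \<kappa>X[OF Gz(2)] by (simp add: s_def)
    finally show "s (G z) *\<^sub>R dd G z e1 = X (G z)" using G(7)[OF Gz(1)] by (auto dest: injD)
  qed
qed

text \<open>First integrals of X depend only on the second coordinate, since the first coordinate
  direction is X / s.\<close>

lemma const_in_adapted_coordinates:
  assumes U: "open U" "U \<subseteq> V" "U1 \<subseteq> U" and hom: "homeomorphism U1 (square c d \<epsilon>) F G" and G: "smooth_on (square c d \<epsilon>) G"
    and GX: "\<And>z. z \<in> square c d \<epsilon> \<Longrightarrow> s (G z) *\<^sub>R dd G z e1 = X (G z)"
    and K: "smooth_on U K" "\<And>r. r \<in> U \<Longrightarrow> dd K r (X r) = 0" and z: "z \<in> square c d \<epsilon>"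
  shows "K (G z) = K (G (c, snd z))"
proof -
  have GU: "G z \<in> U" if "z \<in> square c d \<epsilon>" for z using hom that U(3) unfolding homeomorphism_def by blast
  show ?thesis
  proof (rule const_along_first[of c d \<epsilon> "\<lambda>z. K (G z)" "\<lambda>z v. dd K (G z) (dd G z v)", OF _ _ z])
    fix z assume z: "z \<in> square c d \<epsilon>"
    show "((\<lambda>z. K (G z)) has_derivative (\<lambda>v. dd K (G z) (dd G z v))) (at z)"
      by (rule has_derivative_compose[OF smooth_on_has_derivative[OF G z] smooth_on_has_derivative[OF K(1) GU[OF z]]])
    have l: "linear (dd K (G z))" by (rule smooth_on_linear_dd[OF K(1) GU[OF z]])
    have "s (G z) *\<^sub>R dd K (G z) (dd G z e1) = 0"
      using K(2)[OF GU[OF z]] unfolding GX[OF z, symmetric] linear_scale[OF l] .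
    moreover have "s (G z) \<noteq> 0" using s_ge_1[of "G z"] GU[OF z] U(2) by auto
    ultimately show "dd K (G z) (dd G z e1) = 0" by simp
  qed
qed

lemma dd_component:
  assumes "smooth_on U K" "r \<in> U"
  shows "dd (\<lambda>r. K r $ i) r v = dd K r v $ i"
  by (rule dd_bounded_linear[OF bounded_linear_vec_nth smooth_on_differentiable[OF assms]])

lemma smooth_component: "open U \<Longrightarrow> smooth_on U K \<Longrightarrow> smooth_on U (\<lambda>r. K r $ i)"
  by (rule smooth_on_linear[OF _ bounded_linear_vec_nth])

lemma smooth_slice:
  fixes K :: "real \<times> real \<Rightarrow> 'b::real_normed_vector" and G :: "real \<times> real \<Rightarrow> real \<times> real"
  assumes "open U" "smooth_on U K" "smooth_on (square c d \<epsilon>) G" "\<And>z. z \<in> square c d \<epsilon> \<Longrightarrow> G z \<in> U" "\<epsilon> > 0"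
  shows "smooth_on {d - \<epsilon> <..< d + \<epsilon>} (\<lambda>v. K (G (c, v)))"
    and "v \<in> {d - \<epsilon> <..< d + \<epsilon>} \<Longrightarrow> dd (\<lambda>v. K (G (c, v))) v 1 = dd K (G (c, v)) (dd G (c, v) e2)"
proof -
  let ?J = "{d - \<epsilon> <..< d + \<epsilon>}"
  have m: "(c, v) \<in> square c d \<epsilon>" if "v \<in> ?J" for v using that assms(5) unfolding square_mem by simp
  have sm1: "smooth_on ?J (\<lambda>v. (c, v))" by (intro smooth_on_Pair smooth_on_const smooth_on_ident) simp
  have sm2: "smooth_on ?J (\<lambda>v. G (c, v))"
    by (rule smooth_on_compose[OF _ open_square assms(3) sm1]) (use m in auto)
  show "smooth_on ?J (\<lambda>v. K (G (c, v)))"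
    by (rule smooth_on_compose[OF _ assms(1,2) sm2]) (use m assms(4) in auto)
  assume v: "v \<in> ?J"
  have "((\<lambda>v. (c, v)) has_derivative (\<lambda>h. (0, h))) (at v)" by (auto intro!: derivative_eq_intros)
  from has_derivative_compose[OF has_derivative_compose[OF this smooth_on_has_derivative[OF assms(3) m[OF v]]]
      smooth_on_has_derivative[OF assms(2) assms(4)[OF m[OF v]]]]
  show "dd (\<lambda>v. K (G (c, v))) v 1 = dd K (G (c, v)) (dd G (c, v) e2)" by (rule dd_eqI)
qed

text \<open>With N = 0 the vector T is d/dt, so p is constant along X, and a component of p with
  nonzero differential can serve as kappa. The base curve is p on a slice of constant t.\<close>

lemma cylinder_coordinates:
  assumes NV: "\<And>r. r \<in> V \<Longrightarrow> N r = 0" and q: "q \<in> V"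
  obtains \<epsilon> U1 c d F G \<beta> where "\<epsilon> > 0" "open U1" "q \<in> U1" "U1 \<subseteq> V" "homeomorphism U1 (square c d \<epsilon>) F G"
    "G (c, d) = q"
    "smooth_on (square c d \<epsilon>) G" "\<And>z. z \<in> square c d \<epsilon> \<Longrightarrow> inj (dd G z)"
    "smooth_on {d - \<epsilon> <..< d + \<epsilon>} \<beta>" "\<And>v. v \<in> {d - \<epsilon> <..< d + \<epsilon>} \<Longrightarrow> dd \<beta> v 1 \<noteq> 0"
    "\<And>z. z \<in> square c d \<epsilon> \<Longrightarrow> y (G z) = (fst z, \<beta> (snd z))"
proof -
  have ppX: "pp r (X r) = 0" if "r \<in> V" for r using dd_X_degenerate[OF that NV[OF that]] by simp
  have "\<exists>b. pp q b \<noteq> 0"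
  proof (rule ccontr)
    assume no: "\<not> ?thesis"
    \<comment> \<open>If p had zero differential, dy would have rank at most one, and this vector
      would be in its kernel.\<close>
    then have "dd y q (tt q e2, - tt q e1) = 0"
      by (subst dd_R2[OF q]) (simp add: prod_eq_iff)
    then have "dd y q (tt q e2, - tt q e1) = dd y q 0" using linear_0[OF lin[OF q]] by simp
    then have "(tt q e2, - tt q e1) = 0" by (rule injD[OF injy[OF q]])
    then have "dd y q e1 = dd y q 0" using no linear_0[OF lin[OF q]] by (simp add: prod_eq_iff)
    then show False using injD[OF injy[OF q], of e1 0] by (simp add: zero_prod_def)
  qed
  then obtain b i where bi: "pp q b $ i \<noteq> 0" by (auto simp: vec_eq_iff)
  define \<kappa> where "\<kappa> r = p r $ i" for r
  have sm\<kappa>: "smooth_on V \<kappa>" unfolding \<kappa>_def[abs_def] by (rule smooth_component[OF opV sm_p])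
  have dp: "dd p r v = pp r v" if "r \<in> V" for r v by (rule dd_snd_smooth[OF smy that])
  have d\<kappa>: "dd \<kappa> r v = pp r v $ i" if "r \<in> V" for r v
    unfolding \<kappa>_def[abs_def] using dd_component[OF sm_p that] dp[OF that] by simp
  have \<kappa>X: "dd \<kappa> r (X r) = 0" if "r \<in> V" for r using d\<kappa>[OF that] ppX[OF that] by simp
  have \<kappa>b: "dd \<kappa> q b \<noteq> 0" using d\<kappa>[OF q] bi by simp
  obtain \<epsilon> U1 G where G: "\<epsilon> > 0" "open U1" "q \<in> U1" "U1 \<subseteq> V"
    "homeomorphism U1 (square (t q) (\<kappa> q) \<epsilon>) (\<lambda>r. (t r, \<kappa> r)) G" "smooth_on (square (t q) (\<kappa> q) \<epsilon>) G"
    "\<And>z. z \<in> square (t q) (\<kappa> q) \<epsilon> \<Longrightarrow> inj (dd G z)"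
    "\<And>z. z \<in> square (t q) (\<kappa> q) \<epsilon> \<Longrightarrow> s (G z) *\<^sub>R dd G z e1 = X (G z)"
    "\<And>z. z \<in> square (t q) (\<kappa> q) \<epsilon> \<Longrightarrow> tt (G z) (dd G z e2) = 0"
    by (rule adapted_coordinates[OF opV subset_refl q sm\<kappa> _ \<kappa>b], rule \<kappa>X, assumption, rule that)
  let ?D = "square (t q) (\<kappa> q) \<epsilon>" and ?J = "{\<kappa> q - \<epsilon> <..< \<kappa> q + \<epsilon>}"
  have GV: "G z \<in> V" if "z \<in> ?D" for z using G(4,5) that unfolding homeomorphism_def by blast
  define \<beta> where "\<beta> v = p (G (t q, v))" for v
  have sl: "smooth_on ?J (\<lambda>v. p (G (t q, v)))"
    "v \<in> ?J \<Longrightarrow> dd (\<lambda>v. p (G (t q, v))) v 1 = dd p (G (t q, v)) (dd G (t q, v) e2)" for v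
    using smooth_slice[OF opV sm_p G(6) _ G(1)] GV by blast+
  have Gq: "G (t q, \<kappa> q) = q" using G(3,5) unfolding homeomorphism_def by blast
  show ?thesis
  proof (rule that[OF G(1-5) Gq G(6,7)])
    show "smooth_on ?J \<beta>" unfolding \<beta>_def[abs_def] by (rule sl(1))
    show "dd \<beta> v 1 \<noteq> 0" if v: "v \<in> ?J" for v
    proof
      have m: "(t q, v) \<in> ?D" using v G(1) unfolding square_mem by simp
      assume "dd \<beta> v 1 = 0"
      then have "pp (G (t q, v)) (dd G (t q, v) e2) = 0"
        unfolding \<beta>_def[abs_def] using sl(2)[OF v] dp[OF GV[OF m]] by simp
      then have "dd y (G (t q, v)) (dd G (t q, v) e2) = dd y (G (t q, v)) 0"
        using G(9)[OF m] linear_0[OF lin[OF GV[OF m]]] by (simp add: prod_eq_iff)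
      then have "dd G (t q, v) e2 = 0" by (rule injD[OF injy[OF GV[OF m]]])
      then have "dd G (t q, v) e2 = dd G (t q, v) 0" using linear_0[OF smooth_on_linear_dd[OF G(6) m]] by simp
      then show False using injD[OF G(7)[OF m], of e2 0] by (simp add: zero_prod_def)
    qed
    show "y (G z) = (fst z, \<beta> (snd z))" if z: "z \<in> ?D" for z
    proof -
      have "p (G z) = p (G (t q, snd z))"
        by (rule const_in_adapted_coordinates[OF opV subset_refl G(4,5,6,8) sm_p _ z]) (use dp ppX in simp_all)
      moreover have "t (G z) = fst z" using G(5) z unfolding homeomorphism_def by (metis fst_conv)
      ultimately show ?thesis unfolding \<beta>_def by (simp add: prod_eq_iff)
    qed
  qed
qed

text \<open>Applying \<open>w_pp\<close> to X gives f^2 (s - 1) |w|^2 = s, and f^2 s = a^2 + f^2.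
  This fixes the factor that makes w a unit vector.\<close>

lemma norm_w:
  assumes q: "q \<in> V" and Nq: "N q \<noteq> 0" and a: "(f (t q))\<^sup>2 * (s q - 1) = a\<^sup>2"
  shows "a\<^sup>2 * (f (t q))\<^sup>2 * (w q \<bullet> w q) = a\<^sup>2 + (f (t q))\<^sup>2"
proof -
  have s1: "s q - 1 \<noteq> 0" using s_eq_1_iff[OF q] Nq by simp
  then have Tb: "Tb q = (s q - 1) *\<^sub>R w q" unfolding w_def by simp
  have "(f (t q))\<^sup>2 * (w q \<bullet> Tb q) = s q" using w_pp[OF q Nq, of "X q"] unfolding Tb_def s_def .
  then have "(f (t q))\<^sup>2 * (s q - 1) * (w q \<bullet> w q) = s q" unfolding Tb by simp
  then have "a\<^sup>2 * (w q \<bullet> w q) = s q" unfolding a .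
  then have "a\<^sup>2 * (f (t q))\<^sup>2 * (w q \<bullet> w q) = (f (t q))\<^sup>2 * s q" by (simp add: mult_ac)
  also have "\<dots> = a\<^sup>2 + (f (t q))\<^sup>2" using a by (simp add: algebra_simps)
  finally show ?thesis .
qed

text \<open>The unit vector \<open>A\<close> along w and the base point \<open>H\<close> of the
  ruling are constant along X. They provide the coordinate kappa, and on the slice where t equals
  its value at q they become \<open>\<alpha>2\<close> and the curve c from which
  \<open>frame_of_curves\<close> builds the data.\<close>

lemma model_coordinates:
  assumes I: "is_interval I" and NV: "\<And>r. r \<in> V \<Longrightarrow> N r \<noteq> 0" and null: "\<And>r. r \<in> V \<Longrightarrow> null_dir f y r (X r)"
    and a: "a > 0" "\<And>r. r \<in> V \<Longrightarrow> (f (t r))\<^sup>2 * (s r - 1) = a\<^sup>2" and q: "q \<in> V"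
  obtains \<epsilon> U1 d F G a1 a2 \<phi>1 \<phi>2 \<phi>3 \<alpha>1 \<alpha>2 \<alpha>3 where
    "\<epsilon> > 0" "open U1" "q \<in> U1" "U1 \<subseteq> V" "homeomorphism U1 (square (t q) d \<epsilon>) F G"
    "smooth_on (square (t q) d \<epsilon>) G" "\<And>z. z \<in> square (t q) d \<epsilon> \<Longrightarrow> inj (dd G z)"
    "model_data I {d - \<epsilon> <..< d + \<epsilon>} a (t q) d a1 a2 \<phi>1 \<phi>2 \<phi>3 \<alpha>1 \<alpha>2 \<alpha>3"
    "\<And>z. z \<in> square (t q) d \<epsilon> \<Longrightarrow> y (G z) = model_surface f a (t q) \<phi>1 \<phi>2 \<phi>3 \<alpha>1 \<alpha>2 \<alpha>3 z"
proof -
  have an: "a \<noteq> 0" using a(1) by simp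
  \<comment> \<open>The reciprocal of |w| up to sign, by \<open>norm_w\<close>.\<close>
  define C where "C u = a * f u / sqrt (a\<^sup>2 + (f u)\<^sup>2)" for u
  have smC: "smooth_on I C" unfolding C_def[abs_def]
  proof (intro smooth_on_divide smooth_on_mult smooth_on_sqrt smooth_on_add smooth_on_power smooth_on_const opI smf)
    fix u show "a\<^sup>2 + (f u)\<^sup>2 > 0" by (rule root_pos[OF an])
    then show "sqrt (a\<^sup>2 + (f u)\<^sup>2) \<noteq> 0" using an by simp
  qed
  have smw: "smooth_on V w" and smn: "smooth_on V n" using sm_w[OF opV subset_refl] sm_n[OF opV subset_refl] NV by blast+
  define A where "A r = C (t r) *\<^sub>R w r" for r
  have smA: "smooth_on V A" unfolding A_def[abs_def] by (rule smooth_on_scaleR[OF opV sm_of_t[OF smC] smw])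
  have C0: "C (t r) \<noteq> 0" if "r \<in> V" for r unfolding C_def using an fq[OF that] by simp
  have AA: "A r \<bullet> A r = 1" if r: "r \<in> V" for r
  proof -
    let ?R = "a\<^sup>2 + (f (t r))\<^sup>2"
    have R: "?R > 0" by (rule root_pos[OF an])
    have "(C (t r))\<^sup>2 = a\<^sup>2 * (f (t r))\<^sup>2 / ?R" unfolding C_def using less_imp_le[OF R] by (simp add: power_divide power_mult_distrib)
    moreover have "A r \<bullet> A r = (C (t r))\<^sup>2 * (w r \<bullet> w r)" unfolding A_def by (simp add: power2_eq_square)
    ultimately have "A r \<bullet> A r = a\<^sup>2 * (f (t r))\<^sup>2 * (w r \<bullet> w r) / ?R" by simp
    also have "\<dots> = 1" unfolding norm_w[OF r NV[OF r] a(2)[OF r]] by (rule divide_self) (use R in linarith)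
    finally show ?thesis .
  qed
  have Tbw: "Tb r = (s r - 1) *\<^sub>R w r" if "r \<in> V" for r
    unfolding w_def using s_eq_1_iff[OF that] NV[OF that] by simp
  have TbA: "Tb r = ((s r - 1) / C (t r)) *\<^sub>R A r" if "r \<in> V" for r
    unfolding A_def Tbw[OF that] using C0[OF that] by simp
  have AdA: "A r \<bullet> dd A r v = 0" if r: "r \<in> V" for r v
  proof -
    have "dd (\<lambda>r. A r \<bullet> A r) r v = 0" by (rule dd_eq_const[OF opV r AA])
    then show ?thesis using dd_inner_smooth[OF smA smA r, of v] by (simp add: inner_commute)
  qed
  note nfd = null_field_derivatives[OF opV subset_refl _ null]
  \<comment> \<open>Since dw(X) = -\<open>\<rho>\<close> Tb is parallel to w, dA(X) is a multiple of
    w; being a unit field, A allows only the multiple 0.\<close>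
  have dAX: "dd A r (X r) = 0" if r: "r \<in> V" for r
  proof -
    have "dd A r (X r) = C (t r) *\<^sub>R dd w r (X r) + dd (\<lambda>r. C (t r)) r (X r) *\<^sub>R w r"
      unfolding A_def[abs_def] by (rule dd_scaleR_smooth[OF sm_of_t[OF smC] smw r])
    moreover have "dd w r (X r) = - \<rho> (t r) *\<^sub>R Tb r"
      unfolding Tb_def using nfd(3)[OF _ r r] NV by blast
    ultimately have "dd A r (X r) = (C (t r) * - \<rho> (t r) * (s r - 1) + dd (\<lambda>r. C (t r)) r (X r)) *\<^sub>R w r"
      unfolding Tbw[OF r] by (simp add: algebra_simps)
    then obtain l where l: "dd A r (X r) = l *\<^sub>R w r" by blast
    then have "l * (A r \<bullet> w r) = 0" using AdA[OF r, of "X r"] by simp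
    moreover have "A r \<bullet> w r \<noteq> 0"
    proof
      assume "A r \<bullet> w r = 0"
      then have "A r \<bullet> A r = 0" by (subst (2) A_def) simp
      then show False using AA[OF r] by simp
    qed
    ultimately show ?thesis using l by simp
  qed
  define h where "h = height a (t q)"
  have tqI: "t q \<in> I" by (rule tI[OF q])
  have smh: "smooth_on I h" unfolding h_def by (rule smooth_height[OF an I tqI])
  have hA: "smooth_on V (\<lambda>r. h (t r) *\<^sub>R A r)" by (rule smooth_on_scaleR[OF opV sm_of_t[OF smh] smA])
  have dhA: "dd (\<lambda>r. h (t r) *\<^sub>R A r) r v = h (t r) *\<^sub>R dd A r v + (slope a (t r) * tt r v) *\<^sub>R A r" if r: "r \<in> V" for r v
  proof -
    have "(h has_real_derivative slope a (t r)) (at (t r))"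
      unfolding h_def using height_deriv[OF an I tqI tI[OF r]] by (simp add: has_real_derivative_iff_has_vector_derivative)
    then have "dd (\<lambda>r. h (t r)) r v = slope a (t r) * tt r v" by (rule dd_of_t[OF _ r])
    then show ?thesis using dd_scaleR_smooth[OF sm_of_t[OF smh] smA r, of v] by simp
  qed
  \<comment> \<open>The height removes the motion of p along X: dp(X) = Tb, and the slope is exactly
    what makes slope times s times A equal to Tb.\<close>
  define H where "H r = p r + - 1 *\<^sub>R (h (t r) *\<^sub>R A r)" for r
  have smH1: "smooth_on V (\<lambda>r. - 1 *\<^sub>R (h (t r) *\<^sub>R A r))" by (rule smooth_on_scaleR[OF opV smooth_on_const hA])
  have smH: "smooth_on V H" unfolding H_def[abs_def] by (rule smooth_on_add[OF opV sm_p smH1])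
  have dp: "dd p r v = pp r v" if "r \<in> V" for r v by (rule dd_snd_smooth[OF smy that])
  have dH: "dd H r v = pp r v - (h (t r) *\<^sub>R dd A r v + (slope a (t r) * tt r v) *\<^sub>R A r)" if r: "r \<in> V" for r v
  proof -
    have "dd H r v = dd p r v + dd (\<lambda>r. - 1 *\<^sub>R (h (t r) *\<^sub>R A r)) r v"
      unfolding H_def[abs_def] by (rule dd_add_smooth[OF sm_p smH1 r])
    moreover have "dd (\<lambda>r. - 1 *\<^sub>R (h (t r) *\<^sub>R A r)) r v = - 1 *\<^sub>R dd (\<lambda>r. h (t r) *\<^sub>R A r) r v"
      using dd_scaleR_smooth[OF smooth_on_const hA r, of "-1" v] by simp
    ultimately show ?thesis unfolding dp[OF r] dhA[OF r] by simp
  qed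
  have dHX: "dd H r (X r) = 0" if r: "r \<in> V" for r
  proof -
    let ?R = "a\<^sup>2 + (f (t r))\<^sup>2"
    have R: "?R > 0" by (rule root_pos[OF an])
    have F0: "f (t r) \<noteq> 0" by (rule fq[OF r])
    have sC: "slope a (t r) * C (t r) = a\<^sup>2 / ?R"
      unfolding slope_def C_def using R F0 by (simp add: power2_eq_square)
    have "s r * (f (t r))\<^sup>2 = ?R" using a(2)[OF r] by (simp add: algebra_simps)
    then have sr: "s r = ?R / (f (t r))\<^sup>2" using F0 by (simp add: field_simps)
    have "slope a (t r) * C (t r) * s r = (a\<^sup>2 / ?R) * (?R / (f (t r))\<^sup>2)" unfolding sC sr ..
    also have "\<dots> = a\<^sup>2 / (f (t r))\<^sup>2" using less_imp_neq[OF R] by simp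
    also have "\<dots> = s r - 1" using a(2)[OF r] F0 by (simp add: field_simps)
    finally have "(slope a (t r) * s r) *\<^sub>R A r = Tb r" unfolding A_def Tbw[OF r] by (simp add: mult_ac)
    then show ?thesis unfolding dH[OF r] dAX[OF r] using s_def Tb_def by simp
  qed
  \<comment> \<open>If both differentials vanished, dp would take values in the line of A,
    contradicting N q nonzero. So one component of A or H can serve as kappa.\<close>
  have "\<exists>b. dd A q b \<noteq> 0 \<or> dd H q b \<noteq> 0"
  proof (rule ccontr)
    assume "\<not> ?thesis"
    then have "dd A q b = 0" "dd H q b = 0" for b by blast+
    then have "pp q b = (slope a (t q) * tt q b) *\<^sub>R A q" for b using dH[OF q, of b] by simp
    then have "N q = 0" unfolding N_def by (simp add: cross_mult_left cross_mult_right)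
    then show False using NV[OF q] by simp
  qed
  then obtain b K where K: "K = A \<or> K = H" "dd K q b \<noteq> 0" by blast
  then obtain i where i: "dd K q b $ i \<noteq> 0" by (auto simp: vec_eq_iff)
  have smK: "smooth_on V K" using K(1) smA smH by blast
  define \<kappa> where "\<kappa> r = K r $ i" for r
  have sm\<kappa>: "smooth_on V \<kappa>" unfolding \<kappa>_def[abs_def] by (rule smooth_component[OF opV smK])
  have d\<kappa>: "dd \<kappa> r v = dd K r v $ i" if "r \<in> V" for r v
    unfolding \<kappa>_def[abs_def] by (rule dd_component[OF smK that])
  have \<kappa>X: "dd \<kappa> r (X r) = 0" if "r \<in> V" for r using d\<kappa>[OF that] dAX[OF that] dHX[OF that] K(1) by auto
  have \<kappa>b: "dd \<kappa> q b \<noteq> 0" using d\<kappa>[OF q] i by simp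
  obtain \<epsilon> U1 G where G: "\<epsilon> > 0" "open U1" "q \<in> U1" "U1 \<subseteq> V"
    "homeomorphism U1 (square (t q) (\<kappa> q) \<epsilon>) (\<lambda>r. (t r, \<kappa> r)) G" "smooth_on (square (t q) (\<kappa> q) \<epsilon>) G"
    "\<And>z. z \<in> square (t q) (\<kappa> q) \<epsilon> \<Longrightarrow> inj (dd G z)"
    "\<And>z. z \<in> square (t q) (\<kappa> q) \<epsilon> \<Longrightarrow> s (G z) *\<^sub>R dd G z e1 = X (G z)"
    "\<And>z. z \<in> square (t q) (\<kappa> q) \<epsilon> \<Longrightarrow> tt (G z) (dd G z e2) = 0"
    by (rule adapted_coordinates[OF opV subset_refl q sm\<kappa> _ \<kappa>b], rule \<kappa>X, assumption, rule that)
  let ?D = "square (t q) (\<kappa> q) \<epsilon>" and ?J = "{\<kappa> q - \<epsilon> <..< \<kappa> q + \<epsilon>}"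
  have GV: "G z \<in> V" if "z \<in> ?D" for z using G(4,5) that unfolding homeomorphism_def by blast
  have tG: "t (G z) = fst z" if "z \<in> ?D" for z using G(5) that unfolding homeomorphism_def by (metis fst_conv)
  define \<alpha>2 where "\<alpha>2 v = A (G (t q, v))" for v
  define c where "c v = H (G (t q, v))" for v
  have slA: "smooth_on ?J \<alpha>2" "v \<in> ?J \<Longrightarrow> dd \<alpha>2 v 1 = dd A (G (t q, v)) (dd G (t q, v) e2)" for v
    unfolding \<alpha>2_def[abs_def] using smooth_slice[OF opV smA G(6) _ G(1)] GV by blast+
  have slH: "smooth_on ?J c" "v \<in> ?J \<Longrightarrow> dd c v 1 = dd H (G (t q, v)) (dd G (t q, v) e2)" for v
    unfolding c_def[abs_def] using smooth_slice[OF opV smH G(6) _ G(1)] GV by blast+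
  have mD: "(t q, v) \<in> ?D" if "v \<in> ?J" for v using that G(1) unfolding square_mem by simp
  \<comment> \<open>On the chosen slice the height is 0 and dt vanishes along e2, so the corrections
    in dH disappear.\<close>
  have dc: "dd c v 1 = pp (G (t q, v)) (dd G (t q, v) e2)" if v: "v \<in> ?J" for v
  proof -
    have "h (t (G (t q, v))) = 0" unfolding tG[OF mD[OF v]] h_def by (simp add: height_refl)
    then show ?thesis using slH(2)[OF v] dH[OF GV[OF mD[OF v]]] G(9)[OF mD[OF v]] by simp
  qed
  have dcn: "dd c v 1 \<noteq> 0" if v: "v \<in> ?J" for v
  proof
    let ?z = "(t q, v)"
    note m = mD[OF v]
    assume "dd c v 1 = 0"
    then have "dd G ?z e2 = 0" using dc[OF v] pp_inj[OF GV[OF m] NV[OF GV[OF m]]] by simp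
    then have "dd G ?z e2 = dd G ?z 0" using linear_0[OF smooth_on_linear_dd[OF G(6) m]] by simp
    then show False using injD[OF G(7)[OF m], of e2 0] by (simp add: zero_prod_def)
  qed
  have orth: "\<alpha>2 v \<bullet> dd c v 1 = 0" if v: "v \<in> ?J" for v
  proof -
    note m = GV[OF mD[OF v]]
    have "w (G (t q, v)) \<bullet> pp (G (t q, v)) (dd G (t q, v) e2) = 0"
      using w_pp[OF m NV[OF m], of "dd G (t q, v) e2"] G(9)[OF mD[OF v]] fq[OF m] by simp
    then show ?thesis unfolding dc[OF v] \<alpha>2_def A_def by simp
  qed
  \<comment> \<open>Both derivatives are orthogonal to n and to \<open>\<alpha>2\<close>. For
    \<open>\<alpha>2\<close> the orthogonality to n holds because A is parallel to Tb = dp(X) and dn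
    is orthogonal to the image of a null direction.\<close>
  have "\<exists>\<mu>. dd \<alpha>2 v 1 = \<mu> *\<^sub>R dd c v 1" if v: "v \<in> ?J" for v
  proof -
    let ?r = "G (t q, v)" and ?b = "dd G (t q, v) e2"
    note m = GV[OF mD[OF v]]
    have nn: "n ?r \<noteq> 0" using n_n[OF NV[OF m]] by auto
    have "n ?r \<bullet> dd A ?r ?b = 0"
    proof -
      have "dd (\<lambda>r. n r \<bullet> A r) ?r ?b = 0"
        by (rule dd_eq_const[OF opV m, of _ 0]) (simp add: A_def n_w)
      then have "n ?r \<bullet> dd A ?r ?b = - (dd n ?r ?b \<bullet> A ?r)" using dd_inner_smooth[OF smn smA m, of ?b] by simp
      moreover have "dd n ?r ?b \<bullet> Tb ?r = 0" unfolding Tb_def using nfd(2)[OF _ m m] NV by blast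
      then have "dd n ?r ?b \<bullet> A ?r = 0"
        unfolding TbA[OF m] using C0[OF m] s_eq_1_iff[OF m] NV[OF m] by simp
      ultimately show ?thesis by simp
    qed
    then have u: "dd \<alpha>2 v 1 \<bullet> n ?r = 0" "dd \<alpha>2 v 1 \<bullet> \<alpha>2 v = 0"
      using slA(2)[OF v] AdA[OF m] unfolding \<alpha>2_def[of v] by (simp_all add: inner_commute)
    have A0: "\<alpha>2 v \<noteq> 0" using AA[OF m] unfolding \<alpha>2_def by auto
    have nA: "n ?r \<bullet> \<alpha>2 v = 0" unfolding \<alpha>2_def A_def by (simp add: n_w[OF m])
    have cn: "dd c v 1 \<bullet> n ?r = 0" unfolding dc[OF v] using n_pp[OF m] by (simp add: inner_commute)
    have cA: "dd c v 1 \<bullet> \<alpha>2 v = 0" using orth[OF v] by (simp add: inner_commute)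
    show ?thesis
      by (rule orthogonal_complement_line[OF dcn[OF v] nn A0 nA cn cA u]) blast
  qed
  then obtain \<mu> where \<mu>: "\<And>v. v \<in> ?J \<Longrightarrow> dd \<alpha>2 v 1 = \<mu> v *\<^sub>R dd c v 1" by metis
  have J: "open_interval ?J" "\<kappa> q \<in> ?J" using G(1) unfolding open_interval_def by (auto simp: is_interval_1)
  have unit: "\<alpha>2 v \<bullet> \<alpha>2 v = 1" if "v \<in> ?J" for v unfolding \<alpha>2_def by (rule AA[OF GV[OF mD[OF that]]])
  obtain a1 a2 \<phi>1 \<phi>2 \<phi>3 \<alpha>1 \<alpha>3 where M: "model_data I ?J a (t q) (\<kappa> q) a1 a2 \<phi>1 \<phi>2 \<phi>3 \<alpha>1 \<alpha>2 \<alpha>3"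
    "\<And>v. v \<in> ?J \<Longrightarrow> c v = \<phi>1 v *\<^sub>R \<alpha>1 v + \<phi>2 v *\<^sub>R \<alpha>2 v + \<phi>3 v *\<^sub>R \<alpha>3 v"
    by (rule frame_of_curves[OF J an tqI slH(1) slA(1)], (rule unit orth dcn \<mu>, assumption)+, rule that)
  show ?thesis
  proof (rule that[OF G(1-7) M(1)])
    fix z assume z: "z \<in> ?D"
    have sJ: "snd z \<in> ?J" using z unfolding square_mem by simp
    have "A (G z) = A (G (t q, snd z))"
      by (rule const_in_adapted_coordinates[OF opV subset_refl G(4,5,6,8) smA dAX z])
    then have Az: "A (G z) = \<alpha>2 (snd z)" unfolding \<alpha>2_def .
    have "H (G z) = H (G (t q, snd z))"
      by (rule const_in_adapted_coordinates[OF opV subset_refl G(4,5,6,8) smH dHX z])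
    then have Hz: "H (G z) = c (snd z)" unfolding c_def .
    have "p (G z) = H (G z) + h (t (G z)) *\<^sub>R A (G z)" unfolding H_def by simp
    then have "p (G z) = c (snd z) + h (fst z) *\<^sub>R \<alpha>2 (snd z)" unfolding Hz Az tG[OF z] .
    then show "y (G z) = model_surface f a (t q) \<phi>1 \<phi>2 \<phi>3 \<alpha>1 \<alpha>2 \<alpha>3 z"
      unfolding model_surface_eq M(2)[OF sJ] h_def using tG[OF z] by (simp add: prod_eq_iff algebra_simps)
  qed
qed

end

section \<open>Joining regular curves\<close>

definition flat :: "real \<Rightarrow> real" where
  "flat s = (if s > 0 then exp (- (1 / s)) else 0)"

lemma flat_nonneg: "flat s \<ge> 0" and flat_pos: "flat s > 0 \<longleftrightarrow> s > 0"
  unfolding flat_def by auto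

text \<open>The derivatives of \<^term>\<open>flat\<close> are linear combinations of these functions.\<close>

definition flat_poly :: "nat \<Rightarrow> real \<Rightarrow> real" where
  "flat_poly n s = (if s > 0 then (1 / s) ^ n * exp (- (1 / s)) else 0)"

lemma flat_poly_tendsto: "((\<lambda>s. (1 / s) ^ n * exp (- (1 / s))) \<longlongrightarrow> 0) (at_right (0::real))"
proof -
  have "((\<lambda>x::real. x ^ n / exp x) \<longlongrightarrow> 0) at_top" by (rule tendsto_power_div_exp_0)
  then have "((\<lambda>s. inverse s ^ n / exp (inverse s)) \<longlongrightarrow> 0) (at_right (0::real))"
    using filterlim_compose filterlim_inverse_at_top_right by blast
  then show ?thesis by (simp add: divide_inverse exp_minus)
qed

lemma flat_poly_deriv:
  "(flat_poly n has_real_derivative flat_poly (n + 2) s - real n * flat_poly (n + 1) s) (at s)"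
proof (cases s "0::real" rule: linorder_cases)
  case greater
  have "((\<lambda>s. (1 / s) ^ n * exp (- (1 / s))) has_real_derivative
      flat_poly (n + 2) s - real n * flat_poly (n + 1) s) (at s)"
    using greater unfolding flat_poly_def
    by (auto intro!: derivative_eq_intros simp: field_simps power2_eq_square simp flip: power_Suc)
       (cases n; auto simp: field_simps)
  then show ?thesis
    by (rule has_field_derivative_transform_within_open[of _ _ _ "{0<..}"]) (use greater in \<open>auto simp: flat_poly_def\<close>)
next
  case less
  have "((\<lambda>s. 0) has_real_derivative flat_poly (n + 2) s - real n * flat_poly (n + 1) s) (at s)"
    using less unfolding flat_poly_def by simp
  then show ?thesis
    by (rule has_field_derivative_transform_within_open[of _ _ _ "{..<0}"]) (use less in \<open>auto simp: flat_poly_def\<close>)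
next
  case equal
  have "((\<lambda>h. flat_poly n h / h) \<longlongrightarrow> 0) (at 0)"
  proof (rule filterlim_split_at)
    have "\<forall>\<^sub>F h in at_left (0::real). 0 = flat_poly n h / h"
      unfolding eventually_at_filter by (rule eventuallyI) (auto simp: flat_poly_def)
    then show "((\<lambda>h. flat_poly n h / h) \<longlongrightarrow> 0) (at_left 0)" by (rule Lim_transform_eventually[OF tendsto_const])
    \<comment> \<open>Dividing by h raises the power of 1 / h by one, so the difference quotient at
      0 is again of the type handled by \<open>flat_poly_tendsto\<close>.\<close>
    have "\<forall>\<^sub>F h in at_right (0::real). (1 / h) ^ Suc n * exp (- (1 / h)) = flat_poly n h / h"
      unfolding eventually_at_filter by (rule eventuallyI) (auto simp: flat_poly_def)
    then show "((\<lambda>h. flat_poly n h / h) \<longlongrightarrow> 0) (at_right 0)"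
      by (rule Lim_transform_eventually[OF flat_poly_tendsto])
  qed
  then show ?thesis using equal unfolding DERIV_def by (simp add: flat_poly_def)
qed

lemma Ck_flat_poly: "Ck_on k UNIV (flat_poly n)"
proof (induction k arbitrary: n)
  case 0
  then show ?case
    using flat_poly_deriv by (auto intro!: continuous_at_imp_continuous_on DERIV_isCont)
next
  case (Suc k)
  have D: "(flat_poly n has_derivative (\<lambda>v. v * (flat_poly (n + 2) s - real n * flat_poly (n + 1) s))) (at s)" for s
    using flat_poly_deriv[of n s] unfolding has_field_derivative_def
    by (rule has_derivative_eq_rhs) (simp add: fun_eq_iff)
  have "Ck_on k UNIV (\<lambda>s. dd (flat_poly n) s v)" for v
  proof (rule Ck_on_cong[OF open_UNIV])
    show "Ck_on k UNIV (\<lambda>s. v * (flat_poly (n + 2) s + (- real n) * flat_poly (n + 1) s))"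
      by (intro Ck_on_bilinear[OF open_UNIV bounded_bilinear_mult] Ck_on_add Ck_on_const open_UNIV Suc)
    show "v * (flat_poly (n + 2) s + (- real n) * flat_poly (n + 1) s) = dd (flat_poly n) s v" for s
      using dd_eqI[OF D, of s v] by simp
  qed
  then show ?case using differentiableI[OF D] by simp
qed

lemma smooth_flat: "smooth_on UNIV flat"
proof -
  have "flat = flat_poly 0" by (simp add: fun_eq_iff flat_def flat_poly_def)
  then show ?thesis unfolding smooth_on_def using Ck_flat_poly by metis
qed

lemma flat_deriv: "(flat has_real_derivative flat_poly 2 s) (at s)"
proof -
  have "flat = flat_poly 0" by (simp add: fun_eq_iff flat_def flat_poly_def)
  then show ?thesis using flat_poly_deriv[of 0 s] by (simp add: numeral_2_eq_2)
qed

lemma smooth_flat_of: "open S \<Longrightarrow> smooth_on S h \<Longrightarrow> smooth_on S (\<lambda>s. flat (h s))"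
  by (rule smooth_on_compose[OF _ open_UNIV smooth_flat]) auto

text \<open>Positive exactly on (1/4, 3/4), with 1/2 as its only critical point there, because the
  inner quadratic has derivative 1 - 2 s.\<close>

definition bump :: "real \<Rightarrow> real" where
  "bump s = flat ((s - 1/4) * (3/4 - s))"

definition step :: "real \<Rightarrow> real" where
  "step s = flat (s - 1/4) / (flat (s - 1/4) + flat (3/4 - s))"

lemma smooth_bump: "open S \<Longrightarrow> smooth_on S bump"
  unfolding bump_def[abs_def]
  by (intro smooth_flat_of smooth_on_mult smooth_on_diff smooth_on_const smooth_on_ident)

lemma step_denominator: "flat (s - 1/4) + flat (3/4 - s) \<noteq> 0"
proof -
  have "s - 1/4 > 0 \<or> 3/4 - s > 0" by linarith
  then have "flat (s - 1/4) > 0 \<or> flat (3/4 - s) > 0" using flat_pos by blast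
  then show ?thesis using flat_nonneg[of "s - 1/4"] flat_nonneg[of "3/4 - s"] by linarith
qed

lemma smooth_step: "open S \<Longrightarrow> smooth_on S step"
  unfolding step_def[abs_def] using step_denominator
  by (intro smooth_on_divide smooth_on_add smooth_flat_of smooth_on_diff smooth_on_const smooth_on_ident) auto

lemma bump_outside: "s \<le> 1/4 \<or> 3/4 \<le> s \<Longrightarrow> bump s = 0"
  unfolding bump_def flat_def by (auto simp: zero_less_mult_iff)

lemma step_outside: "s \<le> 1/4 \<Longrightarrow> step s = 0" "3/4 \<le> s \<Longrightarrow> step s = 1"
  using step_denominator[of s] unfolding step_def flat_def by auto

lemma bump_deriv: "(bump has_real_derivative flat_poly 2 ((s - 1/4) * (3/4 - s)) * (1 - 2 * s)) (at s)"
proof -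
  have "((\<lambda>s. (s - 1/4) * (3/4 - s)) has_real_derivative 1 - 2 * s) (at s)"
    by (auto intro!: derivative_eq_intros)
  from DERIV_chain2[OF flat_deriv this] show ?thesis unfolding bump_def[abs_def] .
qed

lemma bump_deriv_nonzero:
  assumes "1/4 < s" "s < 3/4" "s \<noteq> 1/2"
  shows "flat_poly 2 ((s - 1/4) * (3/4 - s)) * (1 - 2 * s) \<noteq> 0"
  using assms unfolding flat_poly_def by auto

text \<open>Where the bump has non-zero derivative a generic multiple \<open>w\<close> of it makes the curve regular,
  because curves in \<open>\<real>\<^sup>3\<close> have measure zero. The summand with the factor \<open>s - 1/2\<close> takes care of
  the critical point of the bump.\<close>

lemma join_two_curves:
  fixes B0 B1 :: "real \<Rightarrow> real^3"
  assumes "smooth_on {-1<..<1} B0" "smooth_on {0<..<2} B1"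
    and r0: "\<And>s. s \<in> {-1<..<1} \<Longrightarrow> dd B0 s 1 \<noteq> 0" and r1: "\<And>s. s \<in> {0<..<2} \<Longrightarrow> dd B1 s 1 \<noteq> 0"
  obtains A where "smooth_on {-1<..<2} A" "\<And>s. s \<in> {-1<..<2} \<Longrightarrow> dd A s 1 \<noteq> 0"
    "\<And>s. s \<le> 1/4 \<Longrightarrow> A s = B0 s" "\<And>s. 3/4 \<le> s \<Longrightarrow> A s = B1 s"
proof -
  define B where "B s = (if s \<le> 1/4 then B0 s else if 3/4 \<le> s then B1 s
    else (1 - step s) *\<^sub>R B0 s + step s *\<^sub>R B1 s)" for s
  have Bmid: "B s = (1 - step s) *\<^sub>R B0 s + step s *\<^sub>R B1 s" for s
    unfolding B_def using step_outside[of s] by auto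
  have smB: "smooth_on {-1<..<2} B"
  proof (rule smooth_on_local)
    fix s :: real assume s: "s \<in> {-1<..<2}"
    consider "s < 1/4" | "3/4 < s" | "1/4 \<le> s" "s \<le> 3/4" by linarith
    then show "\<exists>U. open U \<and> s \<in> U \<and> smooth_on U B"
    proof cases
      case 1
      have "smooth_on {-1<..<1/4} B"
        by (rule smooth_on_cong[OF _ smooth_on_subset[OF assms(1)]]) (auto simp: B_def)
      then show ?thesis using 1 s by (intro exI[of _ "{-1<..<1/4}"]) auto
    next
      case 2
      have "smooth_on {3/4<..<2} B"
        by (rule smooth_on_cong[OF _ smooth_on_subset[OF assms(2)]]) (auto simp: B_def)
      then show ?thesis using 2 s by (intro exI[of _ "{3/4<..<2}"]) auto
    next
      case 3
      have "smooth_on {0<..<1} B" unfolding Bmid[abs_def]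
        by (intro smooth_on_add smooth_on_scaleR smooth_on_diff smooth_on_const smooth_step
            smooth_on_subset[OF assms(1)] smooth_on_subset[OF assms(2)]) auto
      then show ?thesis using 3 by (intro exI[of _ "{0<..<1}"]) auto
    qed
  qed
  define \<kappa> where "\<kappa> s = bump s * (s - 1/2)" for s
  have sm\<kappa>: "smooth_on S \<kappa>" if "open S" for S
    unfolding \<kappa>_def[abs_def] by (intro smooth_on_mult smooth_bump smooth_on_diff smooth_on_const smooth_on_ident that)
  have "bump (1/2) \<noteq> 0" unfolding bump_def flat_def by simp
  have d\<kappa>: "dd \<kappa> (1/2) 1 \<noteq> 0"
  proof -
    have "(\<kappa> has_real_derivative (flat_poly 2 ((1/2 - 1/4) * (3/4 - 1/2)) * (1 - 2 * (1/2))) * (1/2 - 1/2) + 1 * bump (1/2)) (at (1/2))"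
      unfolding \<kappa>_def[abs_def] by (intro DERIV_mult bump_deriv) (auto intro!: derivative_eq_intros)
    then have "(\<kappa> has_vector_derivative bump (1/2)) (at (1/2))"
      by (simp add: has_real_derivative_iff_has_vector_derivative)
    then show ?thesis using dd_real_eq[of \<kappa> "bump (1/2)" "1/2" 1] \<open>bump (1/2) \<noteq> 0\<close> by simp
  qed
  \<comment> \<open>Only a vanishing velocity at 1/2 has to be repaired; any nonzero vector does,
    since \<open>\<kappa>\<close> has nonzero derivative there.\<close>
  define e where "e = (if dd B (1/2) 1 = 0 then axis 1 1 else (0 :: real^3))"
  define B' where "B' s = B s + \<kappa> s *\<^sub>R e" for s
  have smB': "smooth_on {-1<..<2} B'" unfolding B'_def[abs_def]
    by (intro smooth_on_add smooth_on_scaleR smB sm\<kappa> smooth_on_const) auto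
  have dB': "dd B' (1/2) 1 \<noteq> 0"
  proof -
    have "dd B' (1/2) 1 = dd B (1/2) 1 + dd \<kappa> (1/2) 1 *\<^sub>R e"
    proof -
      have diff: "B differentiable at (1/2)" "\<kappa> differentiable at (1/2)"
        using smooth_on_differentiable[OF smB] smooth_on_differentiable[OF sm\<kappa>[OF open_UNIV]] by auto
      have "dd (\<lambda>s. \<kappa> s *\<^sub>R e) (1/2) 1 = dd \<kappa> (1/2) 1 *\<^sub>R e"
        using dd_scaleR[OF diff(2), of "\<lambda>s. e" 1] by simp
      moreover have "(\<lambda>s. \<kappa> s *\<^sub>R e) differentiable at (1/2)"
        using differentiable_scaleR[OF diff(2) differentiable_const[of e]] .
      ultimately show ?thesis unfolding B'_def[abs_def] using dd_add[OF diff(1), of "\<lambda>s. \<kappa> s *\<^sub>R e" 1] by simp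
    qed
    moreover have "axis 1 1 \<noteq> (0 :: real^3)" by (simp add: axis_eq_0_iff)
    ultimately show ?thesis using d\<kappa> unfolding e_def by (auto split: if_splits)
  qed
  define \<theta>' where "\<theta>' s = flat_poly 2 ((s - 1/4) * (3/4 - s)) * (1 - 2 * s)" for s
  have d\<theta>: "dd bump s 1 = \<theta>' s" for s
    using dd_real_eq[of bump "\<theta>' s" s 1] bump_deriv[of s] unfolding \<theta>'_def
    by (simp add: has_real_derivative_iff_has_vector_derivative)
  let ?S = "{1/4<..<1/2} \<union> {1/2<..<3/4::real}"
  \<comment> \<open>\<open>Q s\<close> is the only choice of w for which the velocity vanishes at
    s.\<close>
  define Q where "Q s = - inverse (dd bump s 1) *\<^sub>R dd B' s 1" for s
  have "smooth_on ?S Q" unfolding Q_def[abs_def]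
  proof (intro smooth_on_scaleR smooth_on_minus smooth_on_inverse smooth_on_dd smooth_bump)
    show "smooth_on ?S B'" by (rule smooth_on_subset[OF smB']) auto
    show "dd bump s 1 \<noteq> 0" if "s \<in> ?S" for s
      unfolding d\<theta> \<theta>'_def by (rule bump_deriv_nonzero) (use that in auto)
  qed auto
  then have "Q differentiable_on ?S"
    unfolding differentiable_on_def using smooth_on_differentiable differentiable_at_withinI by blast
  then have "negligible (Q ` ?S)" by (intro negligible_differentiable_image_lowdim) auto
  then obtain w where w: "w \<notin> Q ` ?S" using non_negligible_UNIV by (metis UNIV_eq_I)
  define A where "A s = B' s + bump s *\<^sub>R w" for s
  have smA: "smooth_on {-1<..<2} A" unfolding A_def[abs_def]
    by (intro smooth_on_add smooth_on_scaleR smB' smooth_bump smooth_on_const) auto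
  have A0: "A s = B0 s" if "s \<le> 1/4" for s
    unfolding A_def B'_def \<kappa>_def B_def using that bump_outside[of s] by simp
  have A1: "A s = B1 s" if "3/4 \<le> s" for s
    unfolding A_def B'_def \<kappa>_def B_def using that bump_outside[of s] by simp
  have dA: "dd A s 1 = dd B' s 1 + \<theta>' s *\<^sub>R w" if "s \<in> {-1<..<2}" for s
  proof -
    have diff: "B' differentiable at s" "bump differentiable at s"
      using smooth_on_differentiable[OF smB' that] smooth_on_differentiable[OF smooth_bump[OF open_UNIV]] by auto
    have "dd (\<lambda>s. bump s *\<^sub>R w) s 1 = \<theta>' s *\<^sub>R w"
      using dd_scaleR[OF diff(2), of "\<lambda>s. w" 1] d\<theta> by simp
    moreover have "(\<lambda>s. bump s *\<^sub>R w) differentiable at s"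
      using differentiable_scaleR[OF diff(2) differentiable_const[of w]] .
    ultimately show ?thesis unfolding A_def[abs_def] using dd_add[OF diff(1), of "\<lambda>s. bump s *\<^sub>R w" 1] by simp
  qed
  \<comment> \<open>At 1/4 and 3/4 the new curve agrees with a given one only on one side; a
    derivative is determined already by such a one-sided interval.\<close>
  have one_sided: "dd A s 1 = dd B s 1"
    if "(A has_vector_derivative dd A s 1) (at s)" "(B has_vector_derivative dd B s 1) (at s)"
      "a < b" "s \<in> {a..b}" "\<And>r. r \<in> {a..b} \<Longrightarrow> A r = B r" for A B :: "real \<Rightarrow> real^3" and s a b
  proof -
    have "(A has_vector_derivative dd A s 1) (at s within {a..b})" "(B has_vector_derivative dd B s 1) (at s within {a..b})"
      using that(1,2) has_vector_derivative_at_within by blast+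
    moreover have "(A has_vector_derivative dd B s 1) (at s within {a..b})"
      by (rule has_vector_derivative_transform[OF that(4) _ calculation(2)]) (use that(5) in simp)
    ultimately show ?thesis
      using vector_derivative_unique_within_closed_interval[OF that(3)] that(4) by (metis cbox_interval)
  qed
  have regular: "dd A s 1 \<noteq> 0" if s: "s \<in> {-1<..<2}" for s
  proof -
    consider "s \<le> 1/4" | "3/4 \<le> s" | "s = 1/2" | "s \<in> ?S" by force
    then show ?thesis
    proof cases
      case 1
      have "dd A s 1 = dd B0 s 1"
        by (rule one_sided[of A s B0 "s - 1" s])
           (use 1 s A0 in \<open>auto intro!: smooth_on_has_vector_derivative[OF smA] smooth_on_has_vector_derivative[OF assms(1)]\<close>)
      then show ?thesis using r0 1 s by auto
    next
      case 2
      have "dd A s 1 = dd B1 s 1"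
        by (rule one_sided[of A s B1 s "s + 1"])
           (use 2 s A1 in \<open>auto intro!: smooth_on_has_vector_derivative[OF smA] smooth_on_has_vector_derivative[OF assms(2)]\<close>)
      then show ?thesis using r1 2 s by auto
    next
      case 3
      have "\<theta>' (1/2) = 0" unfolding \<theta>'_def by simp
      then show ?thesis using dA[OF s] dB' unfolding 3 by simp
    next
      case 4
      have nz: "\<theta>' s \<noteq> 0" unfolding \<theta>'_def by (rule bump_deriv_nonzero) (use 4 in auto)
      show ?thesis
      proof
        assume "dd A s 1 = 0"
        then have "dd B' s 1 + \<theta>' s *\<^sub>R w = 0" using dA[OF s] by simp
        then have "inverse (\<theta>' s) *\<^sub>R (dd B' s 1 + \<theta>' s *\<^sub>R w) = 0" by simp
        then have "w = Q s" unfolding Q_def d\<theta> using nz by (simp add: scaleR_add_right eq_neg_iff_add_eq_0 add.commute)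
        then show False using w 4 by blast
      qed
    qed
  qed
  show ?thesis by (rule that[OF smA regular A0 A1])
qed

section \<open>Joining a sequence of curves\<close>

lemma smooth_shift:
  fixes B :: "real \<Rightarrow> real^3"
  assumes "smooth_on {a<..<b} B"
  shows "smooth_on {a + c<..<b + c} (\<lambda>s. B (s - c))"
    and "s \<in> {a + c<..<b + c} \<Longrightarrow> dd (\<lambda>s. B (s - c)) s 1 = dd B (s - c) 1"
proof -
  show "smooth_on {a + c<..<b + c} (\<lambda>s. B (s - c))"
    by (rule smooth_on_compose[OF _ _ assms]) (auto intro!: smooth_on_diff smooth_on_ident smooth_on_const)
  assume s: "s \<in> {a + c<..<b + c}"
  then have m: "s - c \<in> {a<..<b}" by auto
  have "((\<lambda>s. s - c) has_derivative (\<lambda>h. h)) (at s)" by (auto intro!: derivative_eq_intros)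
  from has_derivative_compose[OF this smooth_on_has_derivative[OF assms m]]
  show "dd (\<lambda>s. B (s - c)) s 1 = dd B (s - c) 1" by (rule dd_eqI)
qed

text \<open>Piece n leads from \<open>\<beta> n\<close> near 0 to \<open>\<beta> (Suc n)\<close>
  near 1. Shifted by their indices, pieces n and n + 1 agree on [n + 3/4, n + 5/4], both being
  \<open>\<beta> (Suc n)\<close> there. So the curve equals the shifted piece on the overlapping
  windows (n - 1/4, n + 5/4), where smoothness and regularity are local.\<close>

lemma join_curves:
  fixes \<beta> :: "nat \<Rightarrow> real \<Rightarrow> real^3"
  assumes sm: "\<And>n. smooth_on {-1<..<1} (\<beta> n)" and reg: "\<And>n s. s \<in> {-1<..<1} \<Longrightarrow> dd (\<beta> n) s 1 \<noteq> 0"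
  obtains \<alpha> where "smooth_on {-1/4<..} \<alpha>" "\<And>s. s \<in> {-1/4<..} \<Longrightarrow> dd \<alpha> s 1 \<noteq> 0"
    "\<And>n s. \<bar>s\<bar> < 1/4 \<Longrightarrow> \<alpha> (s + real n) = \<beta> n s"
proof -
  have "\<exists>A. smooth_on {-1<..<2} A \<and> (\<forall>s\<in>{-1<..<2}. dd A s 1 \<noteq> 0) \<and> (\<forall>s. s \<le> 1/4 \<longrightarrow> A s = \<beta> n s) \<and>
      (\<forall>s. 3/4 \<le> s \<longrightarrow> A s = \<beta> (Suc n) (s - 1))" for n
  proof -
    have 1: "smooth_on {0<..<2} (\<lambda>s. \<beta> (Suc n) (s - 1))"
      using smooth_shift(1)[OF sm[of "Suc n"], of 1] by simp
    have 2: "dd (\<lambda>s. \<beta> (Suc n) (s - 1)) s 1 \<noteq> 0" if "s \<in> {0<..<2}" for s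
      using smooth_shift(2)[OF sm[of "Suc n"], of s 1] reg[of "s - 1" "Suc n"] that by simp
    obtain A where "smooth_on {-1<..<2} A" "\<And>s. s \<in> {-1<..<2} \<Longrightarrow> dd A s 1 \<noteq> 0"
      "\<And>s. s \<le> 1/4 \<Longrightarrow> A s = \<beta> n s" "\<And>s. 3/4 \<le> s \<Longrightarrow> A s = \<beta> (Suc n) (s - 1)"
      by (rule join_two_curves[OF sm[of n] 1], rule reg, assumption, rule 2, assumption, rule that)
    then show ?thesis by blast
  qed
  then obtain A where A: "\<And>n. smooth_on {-1<..<2} (A n)" "\<And>n s. s\<in>{-1<..<2} \<Longrightarrow> dd (A n) s 1 \<noteq> 0"
    "\<And>n s. s \<le> 1/4 \<Longrightarrow> A n s = \<beta> n s" "\<And>n s. 3/4 \<le> s \<Longrightarrow> A n s = \<beta> (Suc n) (s - 1)"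
    by metis
  \<comment> \<open>\<open>nat\<close> sends the floor -1 to 0, so piece 0 also covers (-1/4,
    0).\<close>
  define \<alpha> where "\<alpha> s = A (nat \<lfloor>s\<rfloor>) (s - real (nat \<lfloor>s\<rfloor>))" for s
  have \<alpha>A: "\<alpha> s = A n (s - real n)" if s: "real n - 1/4 < s" "s < real n + 5/4" "s > -1/4" for n s
  proof -
    consider "real n \<le> s" "s < real n + 1" | "s < real n" "n = 0" | "s < real n" "n \<noteq> 0" | "real n + 1 \<le> s" by linarith
    then show ?thesis
    proof cases
      case 1
      then have "\<lfloor>s\<rfloor> = int n" by linarith
      then show ?thesis unfolding \<alpha>_def by simp
    next
      case 2
      then have "\<lfloor>s\<rfloor> = -1" using s by linarith
      then show ?thesis unfolding \<alpha>_def using 2 by simp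
    next
      case 3
      then obtain m where m: "n = Suc m" using not0_implies_Suc by blast
      have "\<lfloor>s\<rfloor> = int m" using 3 s m by linarith
      then have "\<alpha> s = A m (s - real m)" unfolding \<alpha>_def by simp
      also have "\<dots> = \<beta> n (s - real m - 1)" using A(4)[of "s - real m" m] s 3 m by simp
      also have "\<dots> = A n (s - real n)" using A(3)[of "s - real n" n] s 3 m by (simp add: algebra_simps)
      finally show ?thesis .
    next
      case 4
      then have "\<lfloor>s\<rfloor> = int (Suc n)" using s by linarith
      then have "\<alpha> s = A (Suc n) (s - real (Suc n))" unfolding \<alpha>_def by (simp only: nat_int)
      also have "\<dots> = \<beta> (Suc n) (s - real n - 1)" using A(3)[of "s - real (Suc n)" "Suc n"] s by (simp add: algebra_simps)
      also have "\<dots> = A n (s - real n)" using A(4)[of "s - real n" n] 4 by simp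
      finally show ?thesis .
    qed
  qed
  have local: "\<exists>n. s \<in> {real n - 1/4<..<real n + 5/4}" if "s > -1/4" for s
  proof (cases "s < 0")
    case True
    then show ?thesis using that by (intro exI[of _ 0]) simp
  next
    case False
    then show ?thesis by (intro exI[of _ "nat \<lfloor>s\<rfloor>"]) (auto, linarith+)
  qed
  let ?U = "\<lambda>n. {max (-1/4) (real n - 1/4)<..<real n + 5/4}"
  have shift: "smooth_on (?U n) (\<lambda>s. A n (s - real n))" "s \<in> ?U n \<Longrightarrow> dd (\<lambda>s. A n (s - real n)) s 1 = dd (A n) (s - real n) 1" for n s
  proof -
    have sub: "?U n \<subseteq> {-1 + real n<..<2 + real n}" by auto
    show "smooth_on (?U n) (\<lambda>s. A n (s - real n))"
      by (rule smooth_on_subset[OF smooth_shift(1)[OF A(1)] sub])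
    show "s \<in> ?U n \<Longrightarrow> dd (\<lambda>s. A n (s - real n)) s 1 = dd (A n) (s - real n) 1"
      by (rule smooth_shift(2)[OF A(1)]) (use sub in blast)
  qed
  have eqU: "A n (s - real n) = \<alpha> s" if "s \<in> ?U n" for n s using \<alpha>A[of n s] that by simp
  show ?thesis
  proof (rule that[of \<alpha>])
    show "smooth_on {-1/4<..} \<alpha>"
    proof (rule smooth_on_local)
      fix s :: real assume s: "s \<in> {-1/4<..}"
      then obtain n where n: "s \<in> {real n - 1/4<..<real n + 5/4}" using local by auto
      have "smooth_on (?U n) \<alpha>" by (rule smooth_on_cong[OF _ shift(1) eqU]) auto
      then show "\<exists>U. open U \<and> s \<in> U \<and> smooth_on U \<alpha>" using n s by (intro exI[of _ "?U n"]) auto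
    qed
    show "dd \<alpha> s 1 \<noteq> 0" if s: "s \<in> {-1/4<..}" for s
    proof -
      obtain n where n: "s \<in> {real n - 1/4<..<real n + 5/4}" using local s by auto
      then have sU: "s \<in> ?U n" using s by auto
      have "dd (\<lambda>s. A n (s - real n)) s = dd \<alpha> s" by (rule dd_cong[OF _ sU eqU]) auto
      then have "dd \<alpha> s 1 = dd (A n) (s - real n) 1" using shift(2)[OF sU] by simp
      then show ?thesis using A(2)[of "s - real n" n] n by auto
    qed
    show "\<alpha> (s + real n) = \<beta> n s" if "\<bar>s\<bar> < 1/4" for n s
      using \<alpha>A[of n "s + real n"] A(3)[of s n] that by auto
  qed
qed

section \<open>Totally geodesic planes and the global argument\<close>

lemma orthogonal_vector_exists:
  fixes m :: "real^3"
  obtains e where "e \<noteq> 0" "e \<bullet> m = 0"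
proof (cases "m $ 1 = 0")
  case True
  then have "axis 1 1 \<bullet> m = 0" by (simp add: inner_axis')
  then show ?thesis using that[of "axis 1 1"] by (simp add: axis_eq_0_iff)
next
  case False
  define e :: "real^3" where "e = vector [m $ 2, - (m $ 1), 0]"
  have "e \<bullet> m = 0" unfolding e_def by (simp add: inner_vec_def sum_3)
  moreover have "e $ 2 \<noteq> 0" unfolding e_def using False by simp
  then have "e \<noteq> 0" by auto
  ultimately show ?thesis using that by blast
qed

context rw
begin

text \<open>The vector m annihilates the spatial parts of all tangent vectors, hence those of the
  derivatives of tangent fields, and also the Christoffel term, whose spatial part is a combination
  of the spatial parts of its arguments.\<close>

lemma plane_totally_geodesic:
  assumes m: "m \<noteq> 0"
  shows "totally_geodesic_hypersurface g L {q. fst q \<in> I \<and> m \<bullet> snd q = c}"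
    (is "totally_geodesic_hypersurface g L ?S")
  unfolding totally_geodesic_hypersurface_def
proof (intro conjI ballI allI impI)
  show "?S \<subseteq> L" using L_iff by auto
next
  fix x assume x: "x \<in> ?S"
  obtain e where e: "e \<noteq> 0" "e \<bullet> m = 0" by (rule orthogonal_vector_exists)
  define e' where "e' = cross3 m e"
  have e': "e' \<bullet> e = 0" "e' \<bullet> m = 0" "e' \<noteq> 0"
    unfolding e'_def using e m norm_cross_dot[of m e]
    by (auto simp: dot_cross_self inner_commute)
  define p0 where "p0 = (c / (m \<bullet> m)) *\<^sub>R m"
  have p0: "m \<bullet> p0 = c" unfolding p0_def using m by simp
  define W :: "(real^3) set" where "W = {w. w $ 1 \<in> I}"
  define z :: "real^3 \<Rightarrow> spacetime" where "z w = (w $ 1, p0 + w $ 2 *\<^sub>R e + w $ 3 *\<^sub>R e')" for w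
  define k :: "spacetime \<Rightarrow> real^3" where
    "k q = fst q *\<^sub>R axis 1 1 + (((snd q - p0) \<bullet> e) / (e \<bullet> e)) *\<^sub>R axis 2 1 + (((snd q - p0) \<bullet> e') / (e' \<bullet> e')) *\<^sub>R axis 3 1" for q
  have opW: "open W" unfolding W_def
    using open_vimage[OF opI, of "\<lambda>w::real^3. w $ 1"] by (simp add: vimage_def continuous_on_component)
  have zS: "z w \<in> ?S" if "w \<in> W" for w
    using that p0 e(2) e'(2) unfolding z_def W_def by (simp add: inner_add_right inner_commute)
  have kz: "k (z w) = w" for w
  proof -
    have zw: "snd (z w) - p0 = w $ 2 *\<^sub>R e + w $ 3 *\<^sub>R e'" "fst (z w) = w $ 1" by (simp_all add: z_def)
    have "(w $ 2 *\<^sub>R e + w $ 3 *\<^sub>R e') \<bullet> e = w $ 2 * (e \<bullet> e)"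
      using e'(1) by (simp add: inner_add_left)
    moreover have "(w $ 2 *\<^sub>R e + w $ 3 *\<^sub>R e') \<bullet> e' = w $ 3 * (e' \<bullet> e')"
      using e'(1) by (simp add: inner_add_left inner_commute[of e e'])
    ultimately show ?thesis unfolding k_def zw using e(1) e'(3) by (simp add: vec_eq_iff[of _ w] forall_3 axis_def)
  qed
  have zk: "z (k q) = q" "k q \<in> W" if q: "q \<in> ?S" for q
  proof -
    let ?u = "snd q - p0"
    have "?u - ((?u \<bullet> e) / (e \<bullet> e)) *\<^sub>R e - ((?u \<bullet> e') / (e' \<bullet> e')) *\<^sub>R e' = 0"
    proof (rule orthogonal_to_basis_eq_0[of _ m e])
      show "(?u - ((?u \<bullet> e) / (e \<bullet> e)) *\<^sub>R e - ((?u \<bullet> e') / (e' \<bullet> e')) *\<^sub>R e') \<bullet> m = 0"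
        using q p0 e(2) e'(2) by (simp add: inner_diff_left inner_commute[of "snd q"] inner_commute[of p0])
      show "(?u - ((?u \<bullet> e) / (e \<bullet> e)) *\<^sub>R e - ((?u \<bullet> e') / (e' \<bullet> e')) *\<^sub>R e') \<bullet> e = 0"
        using e(1) e'(1) by (simp add: inner_diff_left)
      show "(?u - ((?u \<bullet> e) / (e \<bullet> e)) *\<^sub>R e - ((?u \<bullet> e') / (e' \<bullet> e')) *\<^sub>R e') \<bullet> cross3 m e = 0"
        unfolding e'_def[symmetric] using e'(1,3) by (simp add: inner_diff_left inner_commute[of e e'])
      show "cross3 m e \<noteq> 0" using e'(3) unfolding e'_def .
    qed
    then have "snd q = p0 + ((?u \<bullet> e) / (e \<bullet> e)) *\<^sub>R e + ((?u \<bullet> e') / (e' \<bullet> e')) *\<^sub>R e'"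
      by (simp add: algebra_simps)
    then show "z (k q) = q" unfolding z_def k_def by (simp add: prod_eq_iff axis_def)
    show "k q \<in> W" using q unfolding k_def W_def by (simp add: axis_def)
  qed
  have zW: "z ` W = ?S"
  proof
    show "z ` W \<subseteq> ?S" using zS by blast
    show "?S \<subseteq> z ` W"
    proof
      fix q assume q: "q \<in> ?S"
      show "q \<in> z ` W" by (rule image_eqI[of q z "k q"]) (use zk[OF q] in simp_all)
    qed
  qed
  have dz: "(z has_derivative (\<lambda>v. (v $ 1, v $ 2 *\<^sub>R e + v $ 3 *\<^sub>R e'))) (at w)" for w
    unfolding z_def[abs_def]
    by (rule has_derivative_eq_rhs, (rule has_derivative_Pair has_derivative_add has_derivative_const
          has_derivative_scaleR bounded_linear_imp_has_derivative bounded_linear_vec_nth)+) (simp add: fun_eq_iff)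
  have smz: "smooth_on W z" unfolding z_def[abs_def]
    by (intro smooth_on_Pair smooth_on_add smooth_on_scaleR smooth_on_const opW
        smooth_on_bounded_linear bounded_linear_vec_nth)
  have ck: "continuous_on ?S k"
    unfolding k_def[abs_def] using e(1) e'(3) by (intro continuous_intros) auto
  have "homeomorphic_maps (top_of_set W) (top_of_set ?S) z k"
    unfolding homeomorphic_maps_def
    using smooth_on_continuous_on[OF smz] ck zS zk kz by (auto simp: continuous_map_in_subtopology)
  then have "homeomorphic_map (top_of_set W) (top_of_set ?S) z" using homeomorphic_map_maps by blast
  then have emb: "embedding_map (top_of_set W) (top_of_set ?S) z"
    unfolding embedding_map_def by (simp add: zW subtopology_subtopology)
  have "local_param (top_of_set ?S) id W z"
    unfolding local_param_def smooth_immersion_on_def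
  proof (intro conjI ballI opW emb)
    show "openin (top_of_set ?S) (z ` W)" unfolding zW by simp
    show "smooth_on W (id \<circ> z)" using smz by simp
    fix w
    have "v = 0" if "dd z w v = 0" for v
    proof -
      have "v $ 1 = 0" and 2: "v $ 2 *\<^sub>R e + v $ 3 *\<^sub>R e' = 0" using that dd_eqI[OF dz, of w v] by (simp_all add: zero_prod_def)
      have "(v $ 2 *\<^sub>R e + v $ 3 *\<^sub>R e') \<bullet> e = 0" "(v $ 2 *\<^sub>R e + v $ 3 *\<^sub>R e') \<bullet> e' = 0" unfolding 2 by simp_all
      then have "v $ 2 = 0" "v $ 3 = 0" using e(1) e' by (simp_all add: inner_add_left inner_commute[of e e'])
      then show ?thesis using \<open>v $ 1 = 0\<close> by (simp add: vec_eq_iff forall_3)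
    qed
    then have "inj (dd z w)"
      unfolding linear_injective_0[OF linear_frechet_derivative[OF differentiableI[OF dz]]] by blast
    then show "inj (dd (id \<circ> z) w)" unfolding id_comp .
  qed
  moreover have "x \<in> z ` W" using x zW by blast
  ultimately show "\<exists>(W :: (real^3) set) z. local_param (top_of_set ?S) id W z \<and> x \<in> z ` W" by blast
next
  fix W :: "(real^3) set" and z w a b
  assume lp: "local_param (top_of_set ?S) id W z" and w: "w \<in> W"
  have opW: "open W" and smz: "smooth_on W z" and inj: "inj (dd z w)" and "openin (top_of_set ?S) (z ` W)"
    using lp w unfolding local_param_def smooth_immersion_on_def by simp_all
  then have zS: "z r \<in> ?S" if "r \<in> W" for r using that openin_imp_subset by blast
  have lin: "linear (dd z w)" by (rule smooth_on_linear_dd[OF smz w])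
  have dz: "m \<bullet> snd (dd z r v) = 0" if r: "r \<in> W" for r v
  proof -
    have "((\<lambda>r. m \<bullet> snd (z r)) has_derivative (\<lambda>v. m \<bullet> snd (dd z r v))) (at r)"
      by (rule has_derivative_inner_right[OF has_derivative_snd[OF smooth_on_has_derivative[OF smz r]]])
    then have "dd (\<lambda>r. m \<bullet> snd (z r)) r v = m \<bullet> snd (dd z r v)" by (rule dd_eqI)
    moreover have "dd (\<lambda>r. m \<bullet> snd (z r)) r v = 0" by (rule dd_eq_const[OF opW r, of _ c]) (use zS in simp)
    ultimately show ?thesis by simp
  qed
  have d2: "m \<bullet> snd (dd (\<lambda>r. dd z r b) w a) = 0"
  proof -
    have "((\<lambda>r. m \<bullet> snd (dd z r b)) has_derivative (\<lambda>v. m \<bullet> snd (dd (\<lambda>r. dd z r b) w v))) (at w)"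
      by (rule has_derivative_inner_right[OF has_derivative_snd[OF smooth_on_has_derivative[OF smooth_on_dd[OF smz] w]]])
    then have "dd (\<lambda>r. m \<bullet> snd (dd z r b)) w a = m \<bullet> snd (dd (\<lambda>r. dd z r b) w a)" by (rule dd_eqI)
    moreover have "dd (\<lambda>r. m \<bullet> snd (dd z r b)) w a = 0" by (rule dd_eq_const[OF opW w]) (rule dz)
    ultimately show ?thesis by simp
  qed
  let ?H = "{x. (0, m) \<bullet> x = (0::real)} :: spacetime set"
  \<comment> \<open>One inclusion together with equality of dimensions: the differential of a chart
    is injective on a three-dimensional space.\<close>
  have "tangent_space z w = ?H"
  proof (rule subspace_dim_equal)
    show "subspace (tangent_space z w)"
      unfolding tangent_space_def by (rule linear_subspace_image[OF lin]) simp
    show "subspace ?H" by (rule subspace_hyperplane)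
    show "tangent_space z w \<subseteq> ?H" unfolding tangent_space_def using dz[OF w] by (auto simp: inner_prod_def)
    have "(0, m) \<noteq> (0 :: spacetime)" using m by (simp add: zero_prod_def)
    then have "dim ?H = DIM(spacetime) - 1" by (rule dim_hyperplane)
    moreover have "dim (tangent_space z w) = dim (UNIV :: (real^3) set)"
      unfolding tangent_space_def using dim_image_eq[OF lin, of UNIV] inj by simp
    ultimately show "dim ?H \<le> dim (tangent_space z w)" by simp
  qed
  moreover have "cov_deriv g z w a b \<in> ?H"
  proof -
    have "z w \<in> L" using zS[OF w] L_iff by auto
    then show ?thesis unfolding cov_deriv_def christoffel_rw[OF \<open>z w \<in> L\<close>]
      using d2 dz[OF w] by (simp add: inner_prod_def inner_add_right)
  qed
  ultimately show "cov_deriv g z w a b \<in> tangent_space z w" by simp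
qed

end

section \<open>Restriction and change of local parametrizations\<close>

lemma local_param_restrict:
  fixes \<psi> :: "real \<times> real \<Rightarrow> 'm" and x :: "'m \<Rightarrow> 'e::euclidean_space"
  assumes "local_param M x V \<psi>" "open U" "U \<subseteq> V"
  shows "local_param M x U \<psi>"
proof -
  have "local_param M x U (\<psi> \<circ> (\<lambda>z. z))"
    by (rule local_param_compose[OF assms assms(2), of "\<lambda>z. z"])
       (auto simp: homeomorphism_def smooth_on_ident)
  then show ?thesis by (simp add: comp_def)
qed

lemma local_param_affine:
  fixes \<sigma> :: "real \<times> real \<Rightarrow> 'm" and x :: "'m \<Rightarrow> 'e::euclidean_space"
  assumes D: "local_param M x D \<sigma>" and k: "k \<noteq> 0"
  shows "local_param M x {z. (fst z, a + k * snd z) \<in> D} (\<lambda>z. \<sigma> (fst z, a + k * snd z))"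
proof -
  let ?G = "\<lambda>z::real \<times> real. (fst z, a + k * snd z)" and ?F = "\<lambda>z::real \<times> real. (fst z, (snd z - a) / k)"
  have opD: "open D" using D unfolding local_param_def by blast
  have op: "open (?G -` D)" by (intro open_vimage opD continuous_intros)
  have smG: "smooth_on S ?G" if "open S" for S
    by (intro smooth_on_Pair smooth_on_add smooth_on_mult smooth_on_fst smooth_on_snd smooth_on_const smooth_on_ident that)
  have hom: "homeomorphism D (?G -` D) ?F ?G"
    by (rule homeomorphismI) (use k in \<open>auto intro!: continuous_intros\<close>)
  have "local_param M x (?G -` D) (\<sigma> \<circ> ?G)"
  proof (rule local_param_compose[OF D opD subset_refl op hom smG[OF op]])
    fix z
    have "(?G has_derivative (\<lambda>v. (fst v, k * snd v))) (at z)"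
      by (rule has_derivative_eq_rhs, (rule derivative_eq_intros refl)+) auto
    then have "dd ?G z = (\<lambda>v. (fst v, k * snd v))" using dd_eqI by (intro ext) blast
    then show "inj (dd ?G z)" using k by (auto simp: inj_def prod_eq_iff)
  qed
  then show ?thesis by (simp add: comp_def vimage_def)
qed

lemma tangent_space_param_eq:
  fixes \<psi> \<sigma> :: "real \<times> real \<Rightarrow> 'm" and x :: "'m \<Rightarrow> 'e::euclidean_space"
  assumes V: "local_param M x V \<psi>" and D: "local_param M x D \<sigma>" and "q \<in> V" "d \<in> D" "\<psi> q = \<sigma> d"
  shows "tangent_space (x \<circ> \<psi>) q = tangent_space (x \<circ> \<sigma>) d"
proof -
  have smV: "smooth_on V (x \<circ> \<psi>)" and injV: "inj (dd (x \<circ> \<psi>) q)" and smD: "smooth_on D (x \<circ> \<sigma>)"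
    using V D assms(3) unfolding local_param_def smooth_immersion_on_def by blast+
  obtain U \<tau> where U: "open U" "q \<in> U" "U \<subseteq> V" "smooth_on U \<tau>" "\<tau> ` U \<subseteq> D" "\<tau> q = d"
    "\<And>r. r \<in> U \<Longrightarrow> \<psi> r = \<sigma> (\<tau> r)"
    by (rule local_param_transition[OF V D assms(3-5) smV], rule that)
  have eq: "(x \<circ> \<psi>) r = (x \<circ> \<sigma>) (\<tau> r)" if "r \<in> U" for r using U(7)[OF that] by simp
  have "\<tau> q \<in> D" using U(6) assms(4) by simp
  then have "tangent_space (x \<circ> \<psi>) q = tangent_space (x \<circ> \<sigma>) (\<tau> q)"
    by (intro tangent_space_compose(1)[OF U(1,2) eq smooth_on_differentiable[OF U(4,2)] smooth_on_differentiable[OF smD] injV])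
  then show ?thesis unfolding U(6) .
qed

lemma timelike_patch_cong:
  assumes "open S" "timelike_patch f S y" "\<And>r. r \<in> S \<Longrightarrow> y r = y' r"
  shows "timelike_patch f S y'"
proof -
  have *: "dd y r = dd y' r" if "r \<in> S" for r by (rule dd_cong[OF assms(1) that assms(3)])
  have "smooth_on S y'" using smooth_on_cong[of S y y', OF assms(1)] assms(2,3)
    unfolding timelike_patch_def smooth_immersion_on_def by blast
  then show ?thesis using assms(2,3) * unfolding timelike_patch_def smooth_immersion_on_def tangent_space_def by simp
qed

section \<open>From patches to the whole surface\<close>

context rw
begin

lemma patch_local_param:
  assumes tl: "timelike_surface I f M x" and V: "local_param M x V \<psi>"
  shows "patch I f V (x \<circ> \<psi>)"
proof -
  have tp: "timelike_patch f V (x \<circ> \<psi>)" and M: "immersed_surface L M x"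
    using tl V unfolding timelike_surface_def by blast+
  have sub: "\<psi> ` V \<subseteq> topspace M" using V openin_subset unfolding local_param_def by blast
  have opV: "open V" using V unfolding local_param_def by blast
  have smV: "smooth_on V (x \<circ> \<psi>)" using V unfolding local_param_def smooth_immersion_on_def by blast
  have xL: "(x \<circ> \<psi>) ` V \<subseteq> L" using M sub unfolding immersed_surface_def by auto
  show ?thesis
  proof (unfold_locales)
    show "open V" "smooth_on V (x \<circ> \<psi>)" "(x \<circ> \<psi>) ` V \<subseteq> L" by (fact opV smV xL)+
    show "inj (dd (x \<circ> \<psi>) q)" "lorentzian_plane g ((x \<circ> \<psi>) q) (tangent_space (x \<circ> \<psi>) q)" if "q \<in> V" for q
      using tp that unfolding timelike_patch_def smooth_immersion_on_def by blast+
  qed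
qed

text \<open>Feeds \<open>null_dir_X\<close>: the injective differential pulls the line distribution
  back to a field spanning the null directions, and a patch with p in a plane would put an open part
  of M into a totally geodesic hypersurface.\<close>

lemma null_dir_gradient:
  assumes tl: "timelike_surface I f M x"
    and curv: "\<And>u. u \<in> I \<Longrightarrow> deriv f' u / f u - (f' u)\<^sup>2 / (f u)\<^sup>2 \<noteq> 0"
    and dist: "null_spaces_smooth_line_distribution f M x"
    and nogeo: "\<not> (\<exists>U S. openin M U \<and> U \<noteq> {} \<and> x ` U \<subseteq> S \<and> totally_geodesic_hypersurface g L S)"
    and V: "local_param M x V \<psi>" and q: "q \<in> V"
  shows "null_dir f (x \<circ> \<psi>) q (patch.X f (x \<circ> \<psi>) q)"
proof -
  interpret patch I f V "x \<circ> \<psi>" by (rule patch_local_param[OF tl V])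
  have "\<exists>W \<xi>. open W \<and> q \<in> W \<and> W \<subseteq> V \<and> smooth_on W \<xi> \<and>
      (\<forall>r\<in>W. \<xi> r \<noteq> 0 \<and> relative_null_space g (x \<circ> \<psi>) r = span {dd (x \<circ> \<psi>) r (\<xi> r)})"
    by (rule dist[unfolded null_spaces_smooth_line_distribution_def, rule_format, OF V q])
  then obtain W \<xi> where W: "open W" "q \<in> W" "W \<subseteq> V" "smooth_on W \<xi>"
    "\<forall>r\<in>W. \<xi> r \<noteq> 0 \<and> relative_null_space g (x \<circ> \<psi>) r = span {dd (x \<circ> \<psi>) r (\<xi> r)}"
    by (elim exE conjE)
  have rns: "{dd (x \<circ> \<psi>) r a | a. null_dir f (x \<circ> \<psi>) r a} = span {dd (x \<circ> \<psi>) r (\<xi> r)}" if "r \<in> W" for r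
  proof -
    have "r \<in> V" using that W(3) by blast
    then show ?thesis
      using relative_null_space_eq[of f "x \<circ> \<psi>" r, OF lor] conjunct2[OF bspec[OF W(5) that]] by metis
  qed
  show ?thesis
  proof (rule null_dir_X[OF curv _ W(1,3,4)])
    show "\<xi> r \<noteq> 0" if "r \<in> W" for r using bspec[OF W(5) that] by blast
    show "null_dir f (x \<circ> \<psi>) r (\<xi> r)" if r: "r \<in> W" for r
    proof -
      have "dd (x \<circ> \<psi>) r (\<xi> r) \<in> span {dd (x \<circ> \<psi>) r (\<xi> r)}" by (simp add: span_base)
      then obtain a where a: "dd (x \<circ> \<psi>) r (\<xi> r) = dd (x \<circ> \<psi>) r a" "null_dir f (x \<circ> \<psi>) r a"
        unfolding rns[OF r, symmetric] by blast
      have "\<xi> r = a" by (rule injD[OF injy a(1)]) (use r W(3) in blast)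
      then show ?thesis using a(2) by simp
    qed
    show "\<exists>c. a = c *\<^sub>R \<xi> r" if r: "r \<in> W" and a: "null_dir f (x \<circ> \<psi>) r a" for r a
    proof -
      have rV: "r \<in> V" using r W(3) by blast
      have "dd (x \<circ> \<psi>) r a \<in> span {dd (x \<circ> \<psi>) r (\<xi> r)}" unfolding rns[OF r, symmetric] using a by blast
      then obtain c where "dd (x \<circ> \<psi>) r a = c *\<^sub>R dd (x \<circ> \<psi>) r (\<xi> r)" unfolding span_singleton by blast
      then have "dd (x \<circ> \<psi>) r a = dd (x \<circ> \<psi>) r (c *\<^sub>R \<xi> r)" unfolding linear_scale[OF lin[OF rV]] .
      then have "a = c *\<^sub>R \<xi> r" by (rule injD[OF injy[OF rV]])
      then show ?thesis by blast
    qed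
    show False if B: "open B" "B \<subseteq> V" "B \<noteq> {}" "m \<noteq> 0" "\<And>q. q \<in> B \<Longrightarrow> m \<bullet> snd ((x \<circ> \<psi>) q) = c" for B m c
    proof -
      have "openin M (\<psi> ` B)" by (rule local_param_open_image[OF V B(1,2)])
      moreover have "x ` (\<psi> ` B) \<subseteq> {q. fst q \<in> I \<and> m \<bullet> snd q = c}"
      proof
        fix z assume "z \<in> x ` (\<psi> ` B)"
        then obtain r where r: "r \<in> B" "z = (x \<circ> \<psi>) r" by auto
        have "r \<in> V" using r(1) B(2) by blast
        then show "z \<in> {q. fst q \<in> I \<and> m \<bullet> snd q = c}" using tI B(5)[OF r(1)] unfolding r(2) by simp
      qed
      ultimately show False using nogeo plane_totally_geodesic[OF B(4), of c] B(3) by blast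
    qed
  qed (use W(2) in auto)
qed

text \<open>The vector \<open>N\<close> depends on the parametrization, but tangency of d/dt does
  not. So the zero set of \<open>N\<close> is a subset of M.\<close>

lemma vertical_iff:
  assumes tl: "timelike_surface I f M x" and V: "local_param M x V \<psi>" and q: "q \<in> V"
  shows "(1, 0) \<in> tangent_space (x \<circ> \<psi>) q \<longleftrightarrow> patch.N (x \<circ> \<psi>) q = 0"
proof -
  interpret patch I f V "x \<circ> \<psi>" by (rule patch_local_param[OF tl V])
  show ?thesis
  proof
    assume "(1, 0) \<in> tangent_space (x \<circ> \<psi>) q"
    then obtain a where a: "dd (x \<circ> \<psi>) q a = (1, 0)" unfolding tangent_space_def by auto
    then have "a \<noteq> 0" using linear_0[OF lin[OF q]] by (auto simp: zero_prod_def)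
    then show "N q = 0" using pp_inj[OF q, of a] a by auto
  next
    assume "N q = 0"
    then show "(1, 0) \<in> tangent_space (x \<circ> \<psi>) q"
      using dd_X_degenerate[OF q] unfolding tangent_space_def by (metis rangeI)
  qed
qed

lemma gradient_length_const:
  assumes tl: "timelike_surface I f M x"
    and null: "\<And>q. q \<in> V \<Longrightarrow> null_dir f (x \<circ> \<psi>) q (patch.X f (x \<circ> \<psi>) q)"
    and V: "local_param M x V \<psi>" and B: "convex B" "B \<subseteq> V" "r \<in> B" "r' \<in> B"
  shows "(f (fst ((x \<circ> \<psi>) r)))\<^sup>2 * (patch.s f (x \<circ> \<psi>) r - 1) = (f (fst ((x \<circ> \<psi>) r')))\<^sup>2 * (patch.s f (x \<circ> \<psi>) r' - 1)"
proof -
  interpret patch I f V "x \<circ> \<psi>" by (rule patch_local_param[OF tl V])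
  let ?Q = "\<lambda>r. (f (t r))\<^sup>2 * (s r - 1)"
  have sm: "smooth_on V ?Q"
    by (intro smooth_on_mult smooth_on_power smooth_on_diff smooth_on_const opV sm_s sm_of_t smf)
  have "\<exists>c. \<forall>r\<in>B. ?Q r = c"
  proof (rule has_derivative_zero_constant[OF B(1)])
    fix r assume "r \<in> B"
    then have r: "r \<in> V" using B(2) by blast
    have "dd ?Q r = (\<lambda>b. 0)" using s_deriv[OF r null[OF r]] by blast
    then have "(?Q has_derivative (\<lambda>b. 0)) (at r)" using smooth_on_has_derivative[OF sm r] by simp
    then show "(?Q has_derivative (\<lambda>b. 0)) (at r within B)" by (rule has_derivative_at_withinI)
  qed
  then show ?thesis using B(3,4) by metis
qed

text \<open>f^2 (s - 1) is locally constant and vanishes exactly with \<open>N\<close>, so the set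
  where d/dt is tangent and its complement are both open.\<close>

lemma vertical_dichotomy:
  assumes tl: "timelike_surface I f M x" and conn: "connected_space M"
    and null: "\<And>V \<psi> q. local_param M x V \<psi> \<Longrightarrow> q \<in> V \<Longrightarrow> null_dir f (x \<circ> \<psi>) q (patch.X f (x \<circ> \<psi>) q)"
  shows "(\<forall>V \<psi>. local_param M x V \<psi> \<longrightarrow> (\<forall>q\<in>V. patch.N (x \<circ> \<psi>) q = 0)) \<or>
    (\<forall>V \<psi>. local_param M x V \<psi> \<longrightarrow> (\<forall>q\<in>V. patch.N (x \<circ> \<psi>) q \<noteq> 0))"
proof -
  define vert where "vert m \<longleftrightarrow> (\<exists>(V :: (real \<times> real) set) \<psi> q. local_param M x V \<psi> \<and> q \<in> V \<and> \<psi> q = m \<and> (1, 0) \<in> tangent_space (x \<circ> \<psi>) q)" for m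
  have vert: "vert (\<psi> q) \<longleftrightarrow> patch.N (x \<circ> \<psi>) q = 0" if V: "local_param M x V \<psi>" "q \<in> V" for V \<psi> q
  proof
    assume "vert (\<psi> q)"
    then obtain V' :: "(real \<times> real) set" and \<psi>' q' where V': "local_param M x V' \<psi>'" "q' \<in> V'" "\<psi>' q' = \<psi> q" "(1, 0) \<in> tangent_space (x \<circ> \<psi>') q'"
      unfolding vert_def by blast
    have "tangent_space (x \<circ> \<psi>) q = tangent_space (x \<circ> \<psi>') q'"
      by (rule tangent_space_param_eq[OF V(1) V'(1) V(2) V'(2) V'(3)[symmetric]])
    then show "patch.N (x \<circ> \<psi>) q = 0" using vertical_iff[OF tl V] V'(4) by simp
  next
    assume "patch.N (x \<circ> \<psi>) q = 0"
    then show "vert (\<psi> q)" using vertical_iff[OF tl V] V unfolding vert_def by blast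
  qed
  have near: "\<exists>T. openin M T \<and> m \<in> T \<and> (\<forall>m'\<in>T. vert m' \<longleftrightarrow> vert m)" if m: "m \<in> topspace M" for m
  proof -
    have "\<exists>(V :: (real \<times> real) set) \<psi>. local_param M x V \<psi> \<and> m \<in> \<psi> ` V"
      using tl m unfolding timelike_surface_def immersed_surface_def by blast
    then obtain V :: "(real \<times> real) set" and \<psi> q where V: "local_param M x V \<psi>" "q \<in> V" "m = \<psi> q"
      by blast
    interpret patch I f V "x \<circ> \<psi>" by (rule patch_local_param[OF tl V(1)])
    obtain e where e: "e > 0" "ball q e \<subseteq> V" using opV V(2) open_contains_ball by blast
    have N: "N r = 0 \<longleftrightarrow> N q = 0" if r: "r \<in> ball q e" for r
    proof -
      have rV: "r \<in> V" using r e(2) by blast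
      have "(f (t r))\<^sup>2 * (s r - 1) = (f (t q))\<^sup>2 * (s q - 1)"
        by (rule gradient_length_const[OF tl null[OF V(1)] V(1) convex_ball e(2) r]) (use e(1) in auto)
      then have "s r - 1 = 0 \<longleftrightarrow> s q - 1 = 0" using fq[OF rV] fq[OF V(2)] by auto
      then show ?thesis using s_eq_1_iff[OF rV] s_eq_1_iff[OF V(2)] by simp
    qed
    show ?thesis
    proof (intro exI[of _ "\<psi> ` ball q e"] conjI ballI)
      show "openin M (\<psi> ` ball q e)" by (rule local_param_open_image[OF V(1) open_ball e(2)])
      show "m \<in> \<psi> ` ball q e" using V(3) e(1) by simp
      fix m' assume "m' \<in> \<psi> ` ball q e"
      then obtain r where r: "r \<in> ball q e" "m' = \<psi> r" by blast
      have rV: "r \<in> V" using r(1) e(2) by blast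
      show "vert m' \<longleftrightarrow> vert m" unfolding r(2) V(3) vert[OF V(1) rV] vert[OF V(1,2)] by (rule N[OF r(1)])
    qed
  qed
  define A where "A = {m \<in> topspace M. vert m}"
  define B where "B = {m \<in> topspace M. \<not> vert m}"
  have "openin M A"
  proof (subst openin_subopen, intro ballI)
    fix m assume m: "m \<in> A"
    then obtain T where T: "openin M T" "m \<in> T" "\<forall>m'\<in>T. vert m' \<longleftrightarrow> vert m" using near unfolding A_def by blast
    then have "T \<subseteq> A" using m openin_subset[OF T(1)] unfolding A_def by blast
    then show "\<exists>T. openin M T \<and> m \<in> T \<and> T \<subseteq> A" using T by blast
  qed
  moreover have "openin M B"
  proof (subst openin_subopen, intro ballI)
    fix m assume m: "m \<in> B"
    then obtain T where T: "openin M T" "m \<in> T" "\<forall>m'\<in>T. vert m' \<longleftrightarrow> vert m" using near unfolding B_def by blast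
    then have "T \<subseteq> B" using m openin_subset[OF T(1)] unfolding B_def by blast
    then show "\<exists>T. openin M T \<and> m \<in> T \<and> T \<subseteq> B" using T by blast
  qed
  moreover have "topspace M \<subseteq> A \<union> B" "A \<inter> B = {}" unfolding A_def B_def by auto
  ultimately have "A = {} \<or> B = {}" using conn unfolding connected_space_def by blast
  moreover have mem: "\<psi> q \<in> topspace M" if "local_param M x V \<psi>" "q \<in> V" for V :: "(real \<times> real) set" and \<psi> q
    using that openin_subset unfolding local_param_def by blast
  ultimately show ?thesis using vert mem unfolding A_def B_def by blast
qed

lemma model_case:
  assumes I: "is_interval I" and tl: "timelike_surface I f M x"
    and null: "\<And>V \<psi> q. local_param M x V \<psi> \<Longrightarrow> q \<in> V \<Longrightarrow> null_dir f (x \<circ> \<psi>) q (patch.X f (x \<circ> \<psi>) q)"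
    and N: "\<And>V \<psi> q. local_param M x V \<psi> \<Longrightarrow> q \<in> V \<Longrightarrow> patch.N (x \<circ> \<psi>) q \<noteq> 0"
  shows "locally_congruent_to_model I f M x"
  unfolding locally_congruent_to_model_def
proof
  fix m assume m: "m \<in> topspace M"
  have "\<exists>(V :: (real \<times> real) set) \<psi>. local_param M x V \<psi> \<and> m \<in> \<psi> ` V"
    using tl m unfolding timelike_surface_def immersed_surface_def by blast
  then obtain V' :: "(real \<times> real) set" and \<psi> q where V': "local_param M x V' \<psi>" "q \<in> V'" "m = \<psi> q"
    by blast
  have "open V'" using V'(1) unfolding local_param_def by blast
  \<comment> \<open>A ball, because constancy of f^2 (s - 1) is derived on convex sets.\<close>
  then obtain e where e: "e > 0" "ball q e \<subseteq> V'" using V'(2) open_contains_ball by blast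
  define V where "V = ball q e"
  have V: "local_param M x V \<psi>" unfolding V_def by (rule local_param_restrict[OF V'(1) open_ball e(2)])
  have qV: "q \<in> V" unfolding V_def using e(1) by simp
  interpret patch I f V "x \<circ> \<psi>" by (rule patch_local_param[OF tl V])
  have NV: "N r \<noteq> 0" if "r \<in> V" for r by (rule N[OF V that])
  have nullV: "null_dir f (x \<circ> \<psi>) r (X r)" if "r \<in> V" for r by (rule null[OF V that])
  define a where "a = sqrt ((f (t q))\<^sup>2 * (s q - 1))"
  have sq: "s q - 1 > 0" using s_ge_1[OF qV] s_eq_1_iff[OF qV] NV[OF qV] by simp
  have pos: "(f (t q))\<^sup>2 * (s q - 1) > 0" using sq fq[OF qV] by (intro mult_pos_pos) simp_all
  have a: "a > 0" "a\<^sup>2 = (f (t q))\<^sup>2 * (s q - 1)" unfolding a_def using pos by simp_all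
  have Q: "(f (t r))\<^sup>2 * (s r - 1) = a\<^sup>2" if "r \<in> V" for r
    unfolding a(2) by (rule gradient_length_const[OF tl nullV V _ subset_refl that qV]) (simp_all add: V_def)
  obtain \<epsilon> U1 d F G a1 a2 \<phi>1 \<phi>2 \<phi>3 \<alpha>1 \<alpha>2 \<alpha>3 where G:
    "\<epsilon> > 0" "open U1" "q \<in> U1" "U1 \<subseteq> V" "homeomorphism U1 (square (t q) d \<epsilon>) F G"
    "smooth_on (square (t q) d \<epsilon>) G" "\<And>z. z \<in> square (t q) d \<epsilon> \<Longrightarrow> inj (dd G z)"
    "model_data I {d - \<epsilon> <..< d + \<epsilon>} a (t q) d a1 a2 \<phi>1 \<phi>2 \<phi>3 \<alpha>1 \<alpha>2 \<alpha>3"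
    "\<And>z. z \<in> square (t q) d \<epsilon> \<Longrightarrow> (x \<circ> \<psi>) (G z) = model_surface f a (t q) \<phi>1 \<phi>2 \<phi>3 \<alpha>1 \<alpha>2 \<alpha>3 z"
    by (rule model_coordinates[OF I _ _ a(1) _ qV], rule NV, assumption, rule nullV, assumption, rule Q, assumption, rule that)
  let ?D = "square (t q) d \<epsilon>" and ?y = "model_surface f a (t q) \<phi>1 \<phi>2 \<phi>3 \<alpha>1 \<alpha>2 \<alpha>3"
  have D: "local_param M x ?D (\<psi> \<circ> G)" by (rule local_param_compose[OF V G(2,4) open_square G(5,6,7)])
  have eq: "(x \<circ> (\<psi> \<circ> G)) z = ?y z" if "z \<in> ?D" for z using G(9)[OF that] by simp
  have "timelike_patch f ?D (x \<circ> (\<psi> \<circ> G))" using tl D unfolding timelike_surface_def by blast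
  then have tp: "timelike_patch f ?D ?y" by (rule timelike_patch_cong[OF open_square _ eq])
  have sub: "?D \<subseteq> I \<times> {d - \<epsilon> <..< d + \<epsilon>}"
  proof
    fix z assume z: "z \<in> ?D"
    have "G z \<in> V" using G(4,5) z unfolding homeomorphism_def by blast
    then have "fst ((x \<circ> \<psi>) (G z)) \<in> I" by (rule tI)
    then have "fst z \<in> I" unfolding G(9)[OF z] model_surface_eq by simp
    moreover have "snd z \<in> {d - \<epsilon> <..< d + \<epsilon>}" using z unfolding square_mem by simp
    ultimately show "z \<in> I \<times> {d - \<epsilon> <..< d + \<epsilon>}" by (simp add: mem_Times_iff)
  qed
  have "m \<in> (\<psi> \<circ> G) ` ?D"
  proof (rule image_eqI)
    show "F q \<in> ?D" using G(3,5) unfolding homeomorphism_def by blast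
    show "m = (\<psi> \<circ> G) (F q)" using G(3,5) V'(3) unfolding homeomorphism_def by simp
  qed
  then have near: "open_part_near M (id \<circ> x) m ?D ?y"
    unfolding open_part_near_def using D eq by (intro exI[of _ ?D] exI[of _ "\<psi> \<circ> G"]) simp
  show "\<exists>\<Phi> J a u0 v0 a1 a2 \<phi>1 \<phi>2 \<phi>3 \<alpha>1 \<alpha>2 \<alpha>3 E. isometry_on g L \<Phi> \<and>
      model_data I J a u0 v0 a1 a2 \<phi>1 \<phi>2 \<phi>3 \<alpha>1 \<alpha>2 \<alpha>3 \<and> open E \<and> E \<subseteq> I \<times> J \<and>
      timelike_patch f E (model_surface f a u0 \<phi>1 \<phi>2 \<phi>3 \<alpha>1 \<alpha>2 \<alpha>3) \<and>
      open_part_near M (\<Phi> \<circ> x) m E (model_surface f a u0 \<phi>1 \<phi>2 \<phi>3 \<alpha>1 \<alpha>2 \<alpha>3)"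
    \<comment> \<open>The identity serves as the isometry: the initial frame of
      \<open>model_data\<close> is arbitrary, so every position of the surface is covered.\<close>
    by (rule exI[of _ id], rule exI[of _ "{d - \<epsilon> <..< d + \<epsilon>}"], rule exI[of _ a], rule exI[of _ "t q"], rule exI[of _ d],
        rule exI[of _ a1], rule exI[of _ a2], rule exI[of _ \<phi>1], rule exI[of _ \<phi>2], rule exI[of _ \<phi>3],
        rule exI[of _ \<alpha>1], rule exI[of _ \<alpha>2], rule exI[of _ \<alpha>3], rule exI[of _ ?D])
       (use isometry_id G(8) open_square sub tp near in blast)
qed

text \<open>One curve has to serve all points of M. The Lindelof property reduces the local
  cylinders to a sequence; the base curve of each is rescaled to (-1, 1), and
  \<open>join_curves\<close> places its part |s| < 1/4 around the integer n.\<close>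

lemma cylinder_case:
  fixes M :: "'m topology"
  assumes tl: "timelike_surface I f M x"
    and N: "\<And>V \<psi> q. local_param M x V \<psi> \<Longrightarrow> q \<in> V \<Longrightarrow> patch.N (x \<circ> \<psi>) q = 0"
  shows "open_part_of_warped_cylinder I M x"
proof (cases "topspace M = {}")
  case True
  \<comment> \<open>An empty surface still requires a regular curve; a straight line is
    supplied.\<close>
  have "((\<lambda>s. s *\<^sub>R axis 1 1 :: real^3) has_vector_derivative axis 1 1) (at s)" for s
    by (rule has_vector_derivative_eq_rhs, (rule derivative_intros)+) simp
  then have "vector_derivative (\<lambda>s. s *\<^sub>R axis 1 1 :: real^3) (at s) \<noteq> 0" for s
    by (simp add: vector_derivative_at axis_eq_0_iff)
  moreover have "smooth_on UNIV (\<lambda>s. s *\<^sub>R axis 1 1 :: real^3)"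
    by (intro smooth_on_scaleR smooth_on_ident smooth_on_const) simp
  ultimately show ?thesis
    unfolding open_part_of_warped_cylinder_def open_interval_def using True
    by (intro exI[of _ UNIV] exI[of _ "\<lambda>s. s *\<^sub>R axis 1 1"]) simp
next
  case False
  define piece :: "'m \<Rightarrow> real \<Rightarrow> real \<Rightarrow> real \<Rightarrow> (real \<times> real \<Rightarrow> 'm) \<Rightarrow> (real \<Rightarrow> real^3) \<Rightarrow> bool" where
    "piece m c d \<epsilon> \<sigma> \<beta> \<longleftrightarrow> local_param M x (square c d \<epsilon>) \<sigma> \<and> \<sigma> (c, d) = m \<and> \<epsilon> > 0 \<and>
      smooth_on {d - \<epsilon> <..< d + \<epsilon>} \<beta> \<and> (\<forall>v\<in>{d - \<epsilon> <..< d + \<epsilon>}. dd \<beta> v 1 \<noteq> 0) \<and>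
      (\<forall>z\<in>square c d \<epsilon>. x (\<sigma> z) = (fst z, \<beta> (snd z)))" for m c d \<epsilon> \<sigma> \<beta>
  have "\<exists>c d \<epsilon> \<sigma> \<beta>. piece m c d \<epsilon> \<sigma> \<beta>" if m: "m \<in> topspace M" for m
  proof -
    have "\<exists>(V :: (real \<times> real) set) \<psi>. local_param M x V \<psi> \<and> m \<in> \<psi> ` V"
      using tl m unfolding timelike_surface_def immersed_surface_def by blast
    then obtain V :: "(real \<times> real) set" and \<psi> q where V: "local_param M x V \<psi>" "q \<in> V" "m = \<psi> q"
      by blast
    interpret patch I f V "x \<circ> \<psi>" by (rule patch_local_param[OF tl V(1)])
    obtain \<epsilon> U1 c d F G \<beta> where G: "\<epsilon> > 0" "open U1" "q \<in> U1" "U1 \<subseteq> V" "homeomorphism U1 (square c d \<epsilon>) F G"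
      "G (c, d) = q" "smooth_on (square c d \<epsilon>) G" "\<And>z. z \<in> square c d \<epsilon> \<Longrightarrow> inj (dd G z)"
      "smooth_on {d - \<epsilon> <..< d + \<epsilon>} \<beta>" "\<And>v. v \<in> {d - \<epsilon> <..< d + \<epsilon>} \<Longrightarrow> dd \<beta> v 1 \<noteq> 0"
      "\<And>z. z \<in> square c d \<epsilon> \<Longrightarrow> (x \<circ> \<psi>) (G z) = (fst z, \<beta> (snd z))"
      by (rule cylinder_coordinates[OF _ V(2)], rule N[OF V(1)], assumption, rule that)
    have "local_param M x (square c d \<epsilon>) (\<psi> \<circ> G)"
      by (rule local_param_compose[OF V(1) G(2,4) open_square G(5,7,8)])
    then show ?thesis using G(1,6,9-11) V(3) unfolding piece_def
      by (intro exI[of _ c] exI[of _ d] exI[of _ \<epsilon>] exI[of _ "\<psi> \<circ> G"] exI[of _ \<beta>]) simp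
  qed
  then obtain c d \<epsilon> \<sigma> \<beta> where "\<And>m. m \<in> topspace M \<Longrightarrow> piece m (c m) (d m) (\<epsilon> m) (\<sigma> m) (\<beta> m)"
    by metis
  then have P: "\<And>m. m \<in> topspace M \<Longrightarrow> local_param M x (square (c m) (d m) (\<epsilon> m)) (\<sigma> m)"
    "\<And>m. m \<in> topspace M \<Longrightarrow> \<sigma> m (c m, d m) = m" "\<And>m. m \<in> topspace M \<Longrightarrow> \<epsilon> m > 0"
    "\<And>m. m \<in> topspace M \<Longrightarrow> smooth_on {d m - \<epsilon> m <..< d m + \<epsilon> m} (\<beta> m)"
    "\<And>m v. m \<in> topspace M \<Longrightarrow> v \<in> {d m - \<epsilon> m <..< d m + \<epsilon> m} \<Longrightarrow> dd (\<beta> m) v 1 \<noteq> 0"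
    "\<And>m z. m \<in> topspace M \<Longrightarrow> z \<in> square (c m) (d m) (\<epsilon> m) \<Longrightarrow> x (\<sigma> m z) = (fst z, \<beta> m (snd z))"
    unfolding piece_def by blast+
  \<comment> \<open>The bound \<open>\<epsilon> m / 4\<close> becomes 1/4 after rescaling, the part
    of each curve that \<open>join_curves\<close> keeps unchanged.\<close>
  define S where "S m = {z \<in> square (c m) (d m) (\<epsilon> m). \<bar>snd z - d m\<bar> < \<epsilon> m / 4}" for m
  define Ob where "Ob m = \<sigma> m ` S m" for m
  have opO: "openin M (Ob m)" if m: "m \<in> topspace M" for m
    unfolding Ob_def
  proof (rule local_param_open_image[OF P(1)[OF m]])
    have "S m = square (c m) (d m) (\<epsilon> m) \<inter> {z. \<bar>snd z - d m\<bar> < \<epsilon> m / 4}" unfolding S_def by auto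
    then show "open (S m)" by (simp add: open_square open_Int open_Collect_less continuous_intros)
    show "S m \<subseteq> square (c m) (d m) (\<epsilon> m)" unfolding S_def by blast
  qed
  have mO: "m \<in> Ob m" if m: "m \<in> topspace M" for m
    unfolding Ob_def S_def using P(2,3)[OF m] by (intro image_eqI[of _ _ "(c m, d m)"]) (auto simp: square_mem)
  have "Lindelof_space M"
    using tl second_countable_imp_Lindelof_space unfolding timelike_surface_def immersed_surface_def by blast
  moreover have "\<Union>(Ob ` topspace M) = topspace M"
  proof (intro equalityI subsetI)
    fix p assume "p \<in> \<Union>(Ob ` topspace M)"
    then obtain m where m: "m \<in> topspace M" "p \<in> Ob m" by blast
    show "p \<in> topspace M" using openin_subset[OF opO[OF m(1)]] m(2) by blast
  next
    fix p assume "p \<in> topspace M"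
    then show "p \<in> \<Union>(Ob ` topspace M)" using mO by blast
  qed
  moreover have "\<forall>U\<in>Ob ` topspace M. openin M U" using opO by blast
  ultimately obtain \<V> where \<V>: "countable \<V>" "\<V> \<subseteq> Ob ` topspace M" "\<Union>\<V> = topspace M"
    unfolding Lindelof_space_def by metis
  then obtain C where C: "C \<subseteq> topspace M" "countable C" "\<V> = Ob ` C"
    by (metis countable_subset_image)
  have Cne: "C \<noteq> {}"
  proof
    assume "C = {}"
    then have "\<Union>\<V> = {}" using C(3) by simp
    then show False using \<V>(3) \<open>topspace M \<noteq> {}\<close> by argo
  qed
  \<comment> \<open>An enumeration, possibly with repetitions, so that finite covers also give a
    sequence.\<close>
  define mm where "mm = from_nat_into C"
  have mmC: "mm n \<in> topspace M" for n using from_nat_into[OF Cne, of n] C(1) unfolding mm_def by blast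
  have cover: "\<exists>n. p \<in> Ob (mm n)" if "p \<in> topspace M" for p
  proof -
    have "p \<in> \<Union>(Ob ` C)" using that \<V>(3) C(3) by simp
    then obtain m where m: "m \<in> C" "p \<in> Ob m" by blast
    obtain n where "from_nat_into C n = m" using from_nat_into_surj[OF C(2) m(1)] by blast
    then show ?thesis using m(2) unfolding mm_def by (intro exI[of _ n]) simp
  qed
  define b where "b n s = \<beta> (mm n) (d (mm n) + \<epsilon> (mm n) * s)" for n s
  have bJ: "d (mm n) + \<epsilon> (mm n) * s \<in> {d (mm n) - \<epsilon> (mm n) <..< d (mm n) + \<epsilon> (mm n)}" if "s \<in> {-1<..<1}" for n s
  proof -
    have "\<epsilon> (mm n) * (-1) < \<epsilon> (mm n) * s" "\<epsilon> (mm n) * s < \<epsilon> (mm n) * 1"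
      using that P(3)[OF mmC] by (intro mult_strict_left_mono; simp)+
    then show ?thesis by simp
  qed
  have smb: "smooth_on {-1<..<1} (b n)" for n
    unfolding b_def[abs_def]
    by (rule smooth_on_compose[OF _ _ P(4)[OF mmC]])
       (use bJ in \<open>auto intro!: smooth_on_add smooth_on_mult smooth_on_const smooth_on_ident\<close>)
  have db: "dd (b n) s 1 \<noteq> 0" if s: "s \<in> {-1<..<1}" for n s
  proof -
    let ?v = "d (mm n) + \<epsilon> (mm n) * s"
    have "((\<lambda>s. d (mm n) + \<epsilon> (mm n) * s) has_derivative (\<lambda>h. \<epsilon> (mm n) * h)) (at s)"
      by (rule has_derivative_eq_rhs, (rule derivative_eq_intros refl)+) auto
    from has_derivative_compose[OF this smooth_on_has_derivative[OF P(4)[OF mmC] bJ[OF s]]]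
    have "(b n has_derivative (\<lambda>h. dd (\<beta> (mm n)) ?v (\<epsilon> (mm n) * h))) (at s)" unfolding b_def[abs_def] .
    then have "dd (b n) s 1 = dd (\<beta> (mm n)) ?v (\<epsilon> (mm n) *\<^sub>R 1)" using dd_eqI[of "b n" _ s 1] by simp
    also have "\<dots> = \<epsilon> (mm n) *\<^sub>R dd (\<beta> (mm n)) ?v 1"
      by (rule linear_scale[OF smooth_on_linear_dd[OF P(4)[OF mmC] bJ[OF s]]])
    finally show ?thesis using P(3)[OF mmC, of n] P(5)[OF mmC bJ[OF s]] by simp
  qed
  obtain \<alpha> where \<alpha>: "smooth_on {-1/4<..} \<alpha>" "\<And>s. s \<in> {-1/4<..} \<Longrightarrow> dd \<alpha> s 1 \<noteq> 0"
    "\<And>n s. \<bar>s\<bar> < 1/4 \<Longrightarrow> \<alpha> (s + real n) = b n s"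
    by (rule join_curves[of b, OF smb], rule db, assumption, rule that)
  have near: "open_part_near M x p (I \<times> {-1/4<..}) (\<lambda>(t, s). (t, \<alpha> s))" if p: "p \<in> topspace M" for p
  proof -
    obtain n where n: "p \<in> Ob (mm n)" using cover[OF p] by blast
    let ?m = "mm n"
    have mM: "?m \<in> topspace M" by (rule mmC)
    have e: "\<epsilon> ?m > 0" by (rule P(3)[OF mM])
    have "open (S ?m)"
    proof -
      have "S ?m = square (c ?m) (d ?m) (\<epsilon> ?m) \<inter> {z. \<bar>snd z - d ?m\<bar> < \<epsilon> ?m / 4}" unfolding S_def by auto
      then show ?thesis by (simp add: open_square open_Int open_Collect_less continuous_intros)
    qed
    then have lpS: "local_param M x (S ?m) (\<sigma> ?m)"
      by (rule local_param_restrict[OF P(1)[OF mM]]) (auto simp: S_def)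
    \<comment> \<open>With this shift the parameter \<open>real n\<close> of the joined curve
      corresponds to the centre \<open>d ?m\<close> of the piece.\<close>
    let ?A = "d ?m - \<epsilon> ?m * real n"
    let ?D = "{z. (fst z, ?A + \<epsilon> ?m * snd z) \<in> S ?m}"
    let ?\<sigma> = "\<lambda>z. \<sigma> ?m (fst z, ?A + \<epsilon> ?m * snd z)"
    have lp: "local_param M x ?D ?\<sigma>" by (rule local_param_affine[OF lpS]) (use e in simp)
    have arg: "?A + \<epsilon> ?m * r = d ?m + \<epsilon> ?m * (r - real n)" for r by (simp add: algebra_simps)
    have small: "\<bar>snd z - real n\<bar> < 1/4" if "z \<in> ?D" for z
    proof -
      have "\<bar>\<epsilon> ?m * (snd z - real n)\<bar> < \<epsilon> ?m / 4" using that unfolding S_def arg by simp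
      then show ?thesis using e by (simp add: abs_mult)
    qed
    have val: "x (?\<sigma> z) = (fst z, \<alpha> (snd z))" if z: "z \<in> ?D" for z
    proof -
      have "(fst z, ?A + \<epsilon> ?m * snd z) \<in> square (c ?m) (d ?m) (\<epsilon> ?m)" using z unfolding S_def by blast
      then have "x (?\<sigma> z) = (fst z, \<beta> ?m (?A + \<epsilon> ?m * snd z))" using P(6)[OF mM] by simp
      also have "\<beta> ?m (?A + \<epsilon> ?m * snd z) = b n (snd z - real n)" unfolding b_def arg ..
      also have "\<dots> = \<alpha> (snd z)" using \<alpha>(3)[OF small[OF z], of n] by simp
      finally show ?thesis .
    qed
    show ?thesis unfolding open_part_near_def
    proof (intro exI[of _ ?D] exI[of _ ?\<sigma>] conjI ballI lp)
      show "?D \<subseteq> I \<times> {-1/4<..}"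
      proof
        fix z assume z: "z \<in> ?D"
        interpret P: patch I f ?D "x \<circ> ?\<sigma>" by (rule patch_local_param[OF tl lp])
        have "fst z \<in> I" using P.tI[OF z] val[OF z] by simp
        moreover have "snd z > -1/4" using small[OF z] by linarith
        ultimately show "z \<in> I \<times> {-1/4<..}" by (simp add: mem_Times_iff)
      qed
      obtain z where z: "z \<in> S ?m" "p = \<sigma> ?m z" using n unfolding Ob_def by blast
      have "?A + \<epsilon> ?m * ((snd z - ?A) / \<epsilon> ?m) = snd z" using e by simp
      then show "p \<in> ?\<sigma> ` ?D" using z by (intro image_eqI[of _ _ "(fst z, (snd z - ?A) / \<epsilon> ?m)"]) simp_all
      show "x (?\<sigma> z) = (case z of (t, s) \<Rightarrow> (t, \<alpha> s))" if "z \<in> ?D" for z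
        using val[OF that] by (simp add: case_prod_beta)
    qed
  qed
  have "vector_derivative \<alpha> (at s) \<noteq> 0" if s: "s \<in> {-1/4<..}" for s
    using vector_derivative_at[OF smooth_on_has_vector_derivative[OF \<alpha>(1) s]] \<alpha>(2)[OF s] by simp
  moreover have "open_interval {-1/4::real<..}" unfolding open_interval_def by (auto simp: is_interval_1)
  ultimately show ?thesis
    unfolding open_part_of_warped_cylinder_def using \<alpha>(1) near by blast
qed

end

theorem theorem4p4:
  fixes I :: "real set" and f :: "real \<Rightarrow> real"
    and M :: "'m topology" and x :: "'m \<Rightarrow> real \<times> (real^3)"
  assumes "open_interval I" and "smooth_on I f" and "\<forall>t\<in>I. f t \<noteq> 0"
    and "timelike_surface I f M x"
    and "\<forall>t\<in>I. deriv (deriv f) t / f t - (deriv f t)\<^sup>2 / (f t)\<^sup>2 \<noteq> 0"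
    and "T_nonvanishing f M x"
    and "positive_relative_nullity f M x \<longrightarrow> null_spaces_smooth_line_distribution f M x"
    and "connected_space M"
    and "\<not> (\<exists>U S. openin M U \<and> U \<noteq> {} \<and> x ` U \<subseteq> S \<and>
           totally_geodesic_hypersurface (rw_metric f) (rw_space I) S)"
  shows "positive_relative_nullity f M x \<longleftrightarrow>
         open_part_of_warped_cylinder I M x \<or> locally_congruent_to_model I f M x"
proof -
  have I: "open I" "is_interval I" using assms(1) unfolding open_interval_def by blast+
  interpret rw I f using I(1) assms(2,3) by unfold_locales auto
  show ?thesis
  proof
    assume "positive_relative_nullity f M x"
    then have dist: "null_spaces_smooth_line_distribution f M x" using assms(7) by blast
    have null: "null_dir f (x \<circ> \<psi>) q (patch.X f (x \<circ> \<psi>) q)" if "local_param M x V \<psi>" "q \<in> V" for V \<psi> q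
      by (rule null_dir_gradient[OF assms(4) _ dist assms(9) that]) (use assms(5) in blast)
    have "(\<forall>V \<psi>. local_param M x V \<psi> \<longrightarrow> (\<forall>q\<in>V. patch.N (x \<circ> \<psi>) q = 0)) \<or>
        (\<forall>V \<psi>. local_param M x V \<psi> \<longrightarrow> (\<forall>q\<in>V. patch.N (x \<circ> \<psi>) q \<noteq> 0))"
      by (rule vertical_dichotomy[OF assms(4,8)]) (rule null)
    then show "open_part_of_warped_cylinder I M x \<or> locally_congruent_to_model I f M x"
    proof
      assume N: "\<forall>V \<psi>. local_param M x V \<psi> \<longrightarrow> (\<forall>q\<in>V. patch.N (x \<circ> \<psi>) q = 0)"
      have "open_part_of_warped_cylinder I M x"
        by (rule cylinder_case[OF assms(4)]) (use N in blast)
      then show ?thesis by blast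
    next
      assume N: "\<forall>V \<psi>. local_param M x V \<psi> \<longrightarrow> (\<forall>q\<in>V. patch.N (x \<circ> \<psi>) q \<noteq> 0)"
      have "locally_congruent_to_model I f M x"
        by (rule model_case[OF I(2) assms(4)], rule null) (use N in blast)+
      then show ?thesis by blast
    qed
  next
    assume "open_part_of_warped_cylinder I M x \<or> locally_congruent_to_model I f M x"
    then show "positive_relative_nullity f M x"
      using cylinder_positive_nullity[OF assms(4)] model_positive_nullity[OF I(2) assms(4)] by blast
  qed
qed

end
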